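(* Let $(M,J,D)$ be a manifold with an almost complex structure $J$ and a linear connection $D$. The almost complex structure $J^{\pm}$ on $T^*M$ defined by $D$ and the generalized complex structure $$\mathcal J^{\pm}:=\begin{pmatrix}J&0\\0&\pm J^*\end{pmatrix}$$ is integrable if and only if $J$ is a complex structure (i.e. integrable), $D_X(J)=\pm J\,D_{JX}(J)$ and $$(R^D_{X,Y}-R^D_{JX,JY})(Z)\pm(R^D_{JX,Y}+R^D_{X,JY})(JZ)=0,$$ for any $X,Y,Z\in TM$. (The signs $\pm$ correspond: all upper signs for $J^+$, all lower signs for $J^-$.)
   Context: $J^*\xi=\xi\circ J$ for $\xi\in T^*M$. The connection $D$, acting on $\pi:T^*M\to M$, induces a decomposition $T(T^*M)=H^D\oplus T^{\mathrm{vert}}(T^*M)\cong\pi^*(TM)\oplus\pi^*(T^*M)=\pi^*(TM\oplus T^*M)$ into horizontal and vertical bundles. The almost complex structure on $T^*M$ defined by $D$ and a field $\mathcal J$ of endomorphisms of $TM\oplus T^*M$ with $\mathcal J^2=-\mathrm{Id}$ is $\pi^*(\mathcal J)$ under this identification. $D_X(J)$ is the covariant derivative of the endomorphism $J$, and $R^D_{X,Y}=-D_XD_Y+D_YD_X+D_{[X,Y]}$ is the curvature. *)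

theory Defs
  imports "HOL-Analysis.Analysis"
begin

section \<open>Smooth manifolds\<close>

fun C_k_on :: "nat \<Rightarrow> 'a::euclidean_space set \<Rightarrow> ('a \<Rightarrow> 'b::real_normed_vector) \<Rightarrow> bool" where
  "C_k_on 0 S f \<longleftrightarrow> continuous_on S f"
| "C_k_on (Suc k) S f \<longleftrightarrow> (\<forall>x\<in>S. f differentiable (at x)) \<and>
     (\<forall>v. C_k_on k S (\<lambda>x. frechet_derivative f (at x) v))"

text \<open>Only used for open \<^term>\<open>S\<close>.\<close>
definition smooth_on :: "'a::euclidean_space set \<Rightarrow> ('a \<Rightarrow> 'b::real_normed_vector) \<Rightarrow> bool" where
  "smooth_on S f \<longleftrightarrow> (\<forall>k. C_k_on k S f)"

text \<open>A chart is a pair (domain, coordinate map); the coordinate map is relevant on the domain only.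
  The underlying set and the topology of a manifold are read off from its atlas.\<close>
type_synonym ('m, 'e) chart = "'m set \<times> ('m \<Rightarrow> 'e)"

definition chart_inv :: "('m, 'e) chart \<Rightarrow> 'e \<Rightarrow> 'm" where
  "chart_inv c = inv_into (fst c) (snd c)"

definition transition :: "('m, 'e) chart \<Rightarrow> ('m, 'e) chart \<Rightarrow> 'e \<Rightarrow> 'e" where
  "transition c c' = snd c' \<circ> chart_inv c"

definition carrier_of :: "('m, 'e) chart set \<Rightarrow> 'm set" where
  "carrier_of A = (\<Union>c\<in>A. fst c)"

definition smooth_atlas :: "('m, 'e::euclidean_space) chart set \<Rightarrow> bool" where
  "smooth_atlas A \<longleftrightarrow>
     (\<forall>c\<in>A. inj_on (snd c) (fst c) \<and> open (snd c ` fst c)) \<and>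
     (\<forall>c\<in>A. \<forall>c'\<in>A. open (snd c ` (fst c \<inter> fst c')) \<and>
        smooth_on (snd c ` (fst c \<inter> fst c')) (transition c c'))"

definition mtop :: "('m, 'e::euclidean_space) chart set \<Rightarrow> 'm topology" where
  "mtop A = topology (\<lambda>U. U \<subseteq> carrier_of A \<and> (\<forall>c\<in>A. open (snd c ` (U \<inter> fst c))))"

definition smooth_manifold :: "('m, 'e::euclidean_space) chart set \<Rightarrow> bool" where
  "smooth_manifold A \<longleftrightarrow>
     smooth_atlas A \<and> Hausdorff_space (mtop A) \<and> second_countable (mtop A)"

lemma openin_mtop:
  assumes "smooth_atlas A"
  shows "openin (mtop A) U \<longleftrightarrow>
    U \<subseteq> carrier_of A \<and> (\<forall>c\<in>A. open (snd c ` (U \<inter> fst c)))"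
proof -
  let ?P = "\<lambda>U. U \<subseteq> carrier_of A \<and> (\<forall>c\<in>A. open (snd c ` (U \<inter> fst c)))"
  have "istopology ?P"
    unfolding istopology_def
  proof (intro conjI allI impI)
    fix S T assume S: "?P S" and T: "?P T"
    have "open (snd c ` (S \<inter> T \<inter> fst c))" if c: "c \<in> A" for c
    proof -
      have inj: "inj_on (snd c) (fst c)" using assms c by (auto simp: smooth_atlas_def)
      have eq: "S \<inter> T \<inter> fst c = (S \<inter> fst c) \<inter> (T \<inter> fst c)" by auto
      have "snd c ` (S \<inter> T \<inter> fst c) = snd c ` (S \<inter> fst c) \<inter> snd c ` (T \<inter> fst c)"
        unfolding eq by (rule inj_on_image_Int[OF inj]) auto
      then show ?thesis using S T c by auto
    qed
    then show "S \<inter> T \<subseteq> carrier_of A" "\<forall>c\<in>A. open (snd c ` (S \<inter> T \<inter> fst c))"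
      using S by auto
  next
    fix \<K> assume K: "\<forall>K\<in>\<K>. ?P K"
    then show "\<Union>\<K> \<subseteq> carrier_of A" by auto
    have "open (snd c ` (\<Union>\<K> \<inter> fst c))" if "c \<in> A" for c
    proof -
      have "snd c ` (\<Union>\<K> \<inter> fst c) = (\<Union>K\<in>\<K>. snd c ` (K \<inter> fst c))" by auto
      then show ?thesis using K that by auto
    qed
    then show "\<forall>c\<in>A. open (snd c ` (\<Union>\<K> \<inter> fst c))" by blast
  qed
  then show ?thesis unfolding mtop_def by (subst topology_inverse') auto
qed


section \<open>Tangent vectors and smooth fields\<close>

text \<open>Each tangent space is identified with the model space \<^typ>\<open>'e\<close> through the coordinates of a
  chart \<open>chart_at A p\<close> chosen once and for all around each point \<open>p\<close>. The components in an arbitrary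
  chart \<open>c\<close> are then obtained by differentiating the transition map.
  Tensors at \<open>p\<close> are correspondingly tensors on \<^typ>\<open>'e\<close>; a field is a function of the point,
  of which only the values on the relevant open set matter.\<close>

definition chart_at :: "('m, 'e) chart set \<Rightarrow> 'm \<Rightarrow> ('m, 'e) chart" where
  "chart_at A p = (SOME c. c \<in> A \<and> p \<in> fst c)"

definition to_coords ::
  "('m, 'e::euclidean_space) chart set \<Rightarrow> ('m, 'e) chart \<Rightarrow> 'm \<Rightarrow> 'e \<Rightarrow> 'e" where
  "to_coords A c p v =
     frechet_derivative (transition (chart_at A p) c) (at (snd (chart_at A p) p)) v"

definition from_coords ::
  "('m, 'e::euclidean_space) chart set \<Rightarrow> ('m, 'e) chart \<Rightarrow> 'm \<Rightarrow> 'e \<Rightarrow> 'e" where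
  "from_coords A c p x =
     frechet_derivative (transition c (chart_at A p)) (at (snd c p)) x"

definition tangent_map ::
  "('m, 'e::euclidean_space) chart set \<Rightarrow> ('n, 'f::euclidean_space) chart set \<Rightarrow>
   ('m \<Rightarrow> 'n) \<Rightarrow> 'm \<Rightarrow> 'e \<Rightarrow> 'f" where
  "tangent_map A B f p v =
     frechet_derivative (snd (chart_at B (f p)) \<circ> f \<circ> chart_inv (chart_at A p))
       (at (snd (chart_at A p) p)) v"

definition smooth_fun :: "('m, 'e::euclidean_space) chart set \<Rightarrow> 'm set \<Rightarrow> ('m \<Rightarrow> real) \<Rightarrow> bool" where
  "smooth_fun A U f \<longleftrightarrow> (\<forall>c\<in>A. smooth_on (snd c ` (U \<inter> fst c)) (f \<circ> chart_inv c))"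

text \<open>\<open>differential A f p v\<close> is \<open>df\<^sub>p(v)\<close>, the derivative of the function \<open>f\<close> in direction \<open>v\<close>.\<close>
definition differential ::
  "('m, 'e::euclidean_space) chart set \<Rightarrow> ('m \<Rightarrow> real) \<Rightarrow> 'm \<Rightarrow> 'e \<Rightarrow> real" where
  "differential A f p v =
     frechet_derivative (f \<circ> chart_inv (chart_at A p)) (at (snd (chart_at A p) p)) v"

definition local_rep ::
  "('m, 'e::euclidean_space) chart set \<Rightarrow> ('m, 'e) chart \<Rightarrow> ('m \<Rightarrow> 'e) \<Rightarrow> 'e \<Rightarrow> 'e" where
  "local_rep A c X x = to_coords A c (chart_inv c x) (X (chart_inv c x))"

definition vector_fields :: "('m, 'e::euclidean_space) chart set \<Rightarrow> 'm set \<Rightarrow> ('m \<Rightarrow> 'e) set" where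
  "vector_fields A U = {X. \<forall>c\<in>A. smooth_on (snd c ` (U \<inter> fst c)) (local_rep A c X)}"

definition one_forms ::
  "('m, 'e::euclidean_space) chart set \<Rightarrow> 'm set \<Rightarrow> ('m \<Rightarrow> 'e \<Rightarrow>\<^sub>L real) set" where
  "one_forms A U = {s. \<forall>V Y. openin (mtop A) V \<and> V \<subseteq> U \<and> Y \<in> vector_fields A V \<longrightarrow>
     smooth_fun A V (\<lambda>p. blinfun_apply (s p) (Y p))}"

text \<open>\<open>[X,Y] = \<Sum> (X\<^sup>j \<partial>\<^sub>j Y\<^sup>i - Y\<^sup>j \<partial>\<^sub>j X\<^sup>i) \<partial>\<^sub>i\<close>, evaluated at \<open>p\<close> in the chart that identifies the tangent
  space at \<open>p\<close> with \<^typ>\<open>'e\<close>.\<close>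
definition lie_bracket ::
  "('m, 'e::euclidean_space) chart set \<Rightarrow> ('m \<Rightarrow> 'e) \<Rightarrow> ('m \<Rightarrow> 'e) \<Rightarrow> 'm \<Rightarrow> 'e" where
  "lie_bracket A X Y p =
     (let c = chart_at A p; x = snd c p in
        frechet_derivative (local_rep A c Y) (at x) (X p)
        - frechet_derivative (local_rep A c X) (at x) (Y p))"


section \<open>Almost complex structures\<close>

definition endo_app :: "('m \<Rightarrow> 'e \<Rightarrow> 'e) \<Rightarrow> ('m \<Rightarrow> 'e) \<Rightarrow> 'm \<Rightarrow> 'e" where
  "endo_app J X = (\<lambda>p. J p (X p))"

definition almost_complex_structure ::
  "('m, 'e::euclidean_space) chart set \<Rightarrow> ('m \<Rightarrow> 'e \<Rightarrow> 'e) \<Rightarrow> bool" where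
  "almost_complex_structure A J \<longleftrightarrow>
     (\<forall>p\<in>carrier_of A. linear (J p) \<and> (\<forall>v. J p (J p v) = - v)) \<and>
     (\<forall>U X. openin (mtop A) U \<and> X \<in> vector_fields A U \<longrightarrow> endo_app J X \<in> vector_fields A U)"

definition nijenhuis ::
  "('m, 'e::euclidean_space) chart set \<Rightarrow> ('m \<Rightarrow> 'e \<Rightarrow> 'e) \<Rightarrow> ('m \<Rightarrow> 'e) \<Rightarrow> ('m \<Rightarrow> 'e) \<Rightarrow> 'm \<Rightarrow> 'e" where
  "nijenhuis A J X Y p =
     lie_bracket A X Y p
     + J p (lie_bracket A (endo_app J X) Y p + lie_bracket A X (endo_app J Y) p)
     - lie_bracket A (endo_app J X) (endo_app J Y) p"

definition integrable_structure ::
  "('m, 'e::euclidean_space) chart set \<Rightarrow> ('m \<Rightarrow> 'e \<Rightarrow> 'e) \<Rightarrow> bool" where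
  "integrable_structure A J \<longleftrightarrow>
     almost_complex_structure A J \<and>
     (\<forall>U X Y p. openin (mtop A) U \<and> X \<in> vector_fields A U \<and> Y \<in> vector_fields A U \<and> p \<in> U \<longrightarrow>
        nijenhuis A J X Y p = 0)"


section \<open>Linear connections\<close>

text \<open>A covariant derivative acting on locally defined vector fields. By the locality axiom (the
  last one) \<open>D X Y p\<close> depends on the germs of \<open>X\<close> and \<open>Y\<close> at \<open>p\<close> only; this is the same as a
  covariant derivative on global vector fields, which extends uniquely to local ones.\<close>
definition linear_connection ::
  "('m, 'e::euclidean_space) chart set \<Rightarrow> (('m \<Rightarrow> 'e) \<Rightarrow> ('m \<Rightarrow> 'e) \<Rightarrow> 'm \<Rightarrow> 'e) \<Rightarrow> bool" where
  "linear_connection A D \<longleftrightarrow> (\<forall>U. openin (mtop A) U \<longrightarrow>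
     (\<forall>X\<in>vector_fields A U. \<forall>Y\<in>vector_fields A U. D X Y \<in> vector_fields A U) \<and>
     (\<forall>X\<in>vector_fields A U. \<forall>X'\<in>vector_fields A U. \<forall>Y\<in>vector_fields A U. \<forall>p\<in>U.
        D (\<lambda>q. X q + X' q) Y p = D X Y p + D X' Y p) \<and>
     (\<forall>f X Y. smooth_fun A U f \<and> X \<in> vector_fields A U \<and> Y \<in> vector_fields A U \<longrightarrow>
        (\<forall>p\<in>U. D (\<lambda>q. f q *\<^sub>R X q) Y p = f p *\<^sub>R D X Y p)) \<and>
     (\<forall>X\<in>vector_fields A U. \<forall>Y\<in>vector_fields A U. \<forall>Y'\<in>vector_fields A U. \<forall>p\<in>U.
        D X (\<lambda>q. Y q + Y' q) p = D X Y p + D X Y' p) \<and>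
     (\<forall>f X Y. smooth_fun A U f \<and> X \<in> vector_fields A U \<and> Y \<in> vector_fields A U \<longrightarrow>
        (\<forall>p\<in>U. D X (\<lambda>q. f q *\<^sub>R Y q) p = differential A f p (X p) *\<^sub>R Y p + f p *\<^sub>R D X Y p)) \<and>
     (\<forall>X\<in>vector_fields A U. \<forall>X'\<in>vector_fields A U. \<forall>Y\<in>vector_fields A U. \<forall>Y'\<in>vector_fields A U.
        (\<forall>q\<in>U. X q = X' q \<and> Y q = Y' q) \<longrightarrow> (\<forall>p\<in>U. D X Y p = D X' Y' p)))"

text \<open>\<open>(D\<^sub>X J)(Y)\<close>\<close>
definition cov_deriv_endo ::
  "(('m \<Rightarrow> 'e) \<Rightarrow> ('m \<Rightarrow> 'e) \<Rightarrow> 'm \<Rightarrow> 'e) \<Rightarrow> ('m \<Rightarrow> 'e \<Rightarrow> 'e) \<Rightarrow>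
   ('m \<Rightarrow> 'e) \<Rightarrow> ('m \<Rightarrow> 'e) \<Rightarrow> 'm \<Rightarrow> 'e::euclidean_space" where
  "cov_deriv_endo D J X Y p = D X (endo_app J Y) p - J p (D X Y p)"

definition curvature ::
  "('m, 'e::euclidean_space) chart set \<Rightarrow> (('m \<Rightarrow> 'e) \<Rightarrow> ('m \<Rightarrow> 'e) \<Rightarrow> 'm \<Rightarrow> 'e) \<Rightarrow>
   ('m \<Rightarrow> 'e) \<Rightarrow> ('m \<Rightarrow> 'e) \<Rightarrow> ('m \<Rightarrow> 'e) \<Rightarrow> 'm \<Rightarrow> 'e" where
  "curvature A D X Y Z p =
     - D X (D Y Z) p + D Y (D X Z) p + D (lie_bracket A X Y) Z p"

text \<open>The dual connection on 1-forms: \<open>(D\<^sub>X s)(Y) = X(s(Y)) - s(D\<^sub>X Y)\<close>.\<close>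
definition dual_connection ::
  "('m, 'e::euclidean_space) chart set \<Rightarrow> (('m \<Rightarrow> 'e) \<Rightarrow> ('m \<Rightarrow> 'e) \<Rightarrow> 'm \<Rightarrow> 'e) \<Rightarrow>
   ('m \<Rightarrow> 'e) \<Rightarrow> ('m \<Rightarrow> 'e \<Rightarrow>\<^sub>L real) \<Rightarrow> ('m \<Rightarrow> 'e) \<Rightarrow> 'm \<Rightarrow> real" where
  "dual_connection A D X s Y p =
     differential A (\<lambda>q. blinfun_apply (s q) (Y q)) p (X p) - blinfun_apply (s p) (D X Y p)"


section \<open>The cotangent bundle\<close>

text \<open>The canonical coordinates \<open>(x\<^sup>i, p\<^sub>i)\<close>, where \<open>p\<^sub>i = \<alpha>(\<partial>/\<partial>x\<^sup>i)\<close>.\<close>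
definition cotangent_chart ::
  "('m, 'e::euclidean_space) chart set \<Rightarrow> ('m, 'e) chart \<Rightarrow> ('m \<times> ('e \<Rightarrow>\<^sub>L real), 'e \<times> 'e) chart" where
  "cotangent_chart A c =
     (fst c \<times> UNIV,
      \<lambda>(p, \<alpha>). (snd c p, \<Sum>b\<in>Basis. blinfun_apply \<alpha> (from_coords A c p b) *\<^sub>R b))"

definition cotangent_atlas ::
  "('m, 'e::euclidean_space) chart set \<Rightarrow> ('m \<times> ('e \<Rightarrow>\<^sub>L real), 'e \<times> 'e) chart set" where
  "cotangent_atlas A = cotangent_chart A ` A"

text \<open>\<open>H\<^sup>D\<close> at \<open>\<xi>\<close>: the vectors \<open>ds\<^sub>p(X)\<close> where \<open>s\<close> is a local section of the cotangent bundle through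
  \<open>\<xi>\<close> with \<open>(D\<^sub>X s)\<^sub>p = 0\<close>.\<close>
definition horizontal_space ::
  "('m, 'e::euclidean_space) chart set \<Rightarrow> (('m \<Rightarrow> 'e) \<Rightarrow> ('m \<Rightarrow> 'e) \<Rightarrow> 'm \<Rightarrow> 'e) \<Rightarrow>
   'm \<times> ('e \<Rightarrow>\<^sub>L real) \<Rightarrow> ('e \<times> 'e) set" where
  "horizontal_space A D \<xi> =
     {tangent_map A (cotangent_atlas A) (\<lambda>q. (q, s q)) (fst \<xi>) (X (fst \<xi>)) | U s X.
        openin (mtop A) U \<and> fst \<xi> \<in> U \<and> s \<in> one_forms A U \<and> X \<in> vector_fields A U \<and>
        s (fst \<xi>) = snd \<xi> \<and>
        (\<forall>V Y. openin (mtop A) V \<and> fst \<xi> \<in> V \<and> V \<subseteq> U \<and> Y \<in> vector_fields A V \<longrightarrow>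
           dual_connection A D X s Y (fst \<xi>) = 0)}"

definition horizontal_lift ::
  "('m, 'e::euclidean_space) chart set \<Rightarrow> (('m \<Rightarrow> 'e) \<Rightarrow> ('m \<Rightarrow> 'e) \<Rightarrow> 'm \<Rightarrow> 'e) \<Rightarrow>
   'm \<times> ('e \<Rightarrow>\<^sub>L real) \<Rightarrow> 'e \<Rightarrow> 'e \<times> 'e" where
  "horizontal_lift A D \<xi> v =
     (THE w. w \<in> horizontal_space A D \<xi> \<and> tangent_map (cotangent_atlas A) A fst \<xi> w = v)"

text \<open>The velocity at \<open>t = 0\<close> of the curve \<open>\<xi> + t \<alpha>\<close> in the fibre.\<close>
definition vertical_lift ::
  "('m, 'e::euclidean_space) chart set \<Rightarrow> 'm \<times> ('e \<Rightarrow>\<^sub>L real) \<Rightarrow> ('e \<Rightarrow>\<^sub>L real) \<Rightarrow> 'e \<times> 'e" where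
  "vertical_lift A \<xi> \<alpha> =
     vector_derivative (\<lambda>t. snd (chart_at (cotangent_atlas A) \<xi>) (fst \<xi>, snd \<xi> + t *\<^sub>R \<alpha>)) (at 0)"

text \<open>The isomorphism from \<open>T\<^sub>pM \<oplus> T\<^sub>p\<^sup>*M\<close> onto the tangent space of the cotangent bundle at \<open>\<xi> \<in> T\<^sub>p\<^sup>*M\<close>.\<close>
definition cotangent_splitting ::
  "('m, 'e::euclidean_space) chart set \<Rightarrow> (('m \<Rightarrow> 'e) \<Rightarrow> ('m \<Rightarrow> 'e) \<Rightarrow> 'm \<Rightarrow> 'e) \<Rightarrow>
   'm \<times> ('e \<Rightarrow>\<^sub>L real) \<Rightarrow> 'e \<times> ('e \<Rightarrow>\<^sub>L real) \<Rightarrow> 'e \<times> 'e" where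
  "cotangent_splitting A D \<xi> = (\<lambda>(v, \<alpha>). horizontal_lift A D \<xi> v + vertical_lift A \<xi> \<alpha>)"

definition cotangent_structure ::
  "('m, 'e::euclidean_space) chart set \<Rightarrow> (('m \<Rightarrow> 'e) \<Rightarrow> ('m \<Rightarrow> 'e) \<Rightarrow> 'm \<Rightarrow> 'e) \<Rightarrow>
   ('m \<Rightarrow> 'e \<times> ('e \<Rightarrow>\<^sub>L real) \<Rightarrow> 'e \<times> ('e \<Rightarrow>\<^sub>L real)) \<Rightarrow>
   'm \<times> ('e \<Rightarrow>\<^sub>L real) \<Rightarrow> 'e \<times> 'e \<Rightarrow> 'e \<times> 'e" where
  "cotangent_structure A D \<J> \<xi> =
     cotangent_splitting A D \<xi> \<circ> \<J> (fst \<xi>) \<circ> inv (cotangent_splitting A D \<xi>)"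

text \<open>The block-diagonal structure \<open>diag(J, \<sigma> J\<^sup>*)\<close> with \<open>J\<^sup>* \<alpha> = \<alpha> \<circ> J\<close>.\<close>
definition gen_structure ::
  "real \<Rightarrow> ('m \<Rightarrow> 'e \<Rightarrow> 'e) \<Rightarrow>
   'm \<Rightarrow> 'e::euclidean_space \<times> ('e \<Rightarrow>\<^sub>L real) \<Rightarrow> 'e \<times> ('e \<Rightarrow>\<^sub>L real)" where
  "gen_structure \<sigma> J p = (\<lambda>(v, \<alpha>). (J p v, \<sigma> *\<^sub>R Blinfun (\<lambda>u. blinfun_apply \<alpha> (J p u))))"

end

(* In a chart, D is given by Christoffel symbols and the cotangent bundle has coordinates (x, y). The
   horizontal lift of u is H_u = (u, G(u) y), where G(u) is the transpose of the Christoffel map of u, and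
   a one-form a gives the vertical field V_a = (0, a). The lifted structure maps H_u to H_{Ju} and V_a to
   V_{s J^* a}, where s is the sign. Since [H_u, H_v] = H_{[u,v]} - V_{y o R(u,v)}, [H_u, V_a] = V_{D_u a}
   and [V_a, V_b] = 0, its Nijenhuis tensor is
     N(H_u, H_v) = H_{N_J(u,v)} - V_{y o Q(u,v)},  Q(u,v) = R(u,v) - R(Ju,Jv) + s (R(Ju,v) + R(u,Jv)) J,
     N(H_u, V_a) = V_{a o P(u)},  P(u) = (D_u J) J - s D_{Ju} J,
     N(V_a, V_b) = 0.
   It vanishes iff N_J, Q and P do, and P(u) = 0 is equivalent to D_u J = s J D_{Ju} J. *)
theory Submission
  imports Defs
begin

section \<open>Differential calculus for \<open>smooth_on\<close>, up to the symmetry of second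
  derivatives\<close>

section \<open>Calculus of smooth maps\<close>

text \<open>Tangent spaces are identified with \<open>'e\<close> through the chart picked by
  \<open>chart_at\<close>, which changes from point to point, so nothing can be differentiated in
  this identification; every notion is first carried to one fixed chart. There each condition is
  tensorial, hence an identity between vectors at a point, and coordinate fields realise all
  vectors. The same freedom serves upstairs: N may be evaluated on any fields with the given values.
  Lifts of constant u and a are chosen, but J u and J^* a vary with the point, so the lifts must
  accept variable fields; their derivatives supply the derivative of J in P. Horizontal and vertical
  values span the tangent space, so bilinearity leaves only the listed cases. P and Q are isolated
  because a and y are arbitrary: once N_J = 0, N(H_u, H_v) at y gives y o Q = 0 for all y.
  Tensoriality of N rests on K^2 = -1; invariance of brackets under change of chart and tensoriality
  of the curvature rest on the symmetry of second derivatives, obtained here from second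
  differences. Covectors are stored as vectors of \<open>'e\<close> via its inner product, so
  precomposition becomes a transpose.\<close>

lemma C_k_on_cong:
  assumes "open S" "\<And>x. x \<in> S \<Longrightarrow> f x = g x"
  shows "C_k_on k S f \<longleftrightarrow> C_k_on k S g"
  using assms(2)
proof (induction k arbitrary: f g)
  case 0
  then show ?case by (simp cong: continuous_on_cong)
next
  case (Suc k)
  have 1: "C_k_on (Suc k) S g" if C: "C_k_on (Suc k) S f" and eq: "\<And>x. x \<in> S \<Longrightarrow> f x = g x"
    for f g :: "'a \<Rightarrow> 'b"
  proof -
    have d: "f differentiable (at x)" if "x \<in> S" for x using C that by simp
    have fr: "frechet_derivative f (at x) = frechet_derivative g (at x)" if "x \<in> S" for x
      using frechet_derivative_transform_within_open[OF d[OF that] assms(1) that eq] by simp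
    have "g differentiable (at x)" if "x \<in> S" for x
      using d[OF that] has_derivative_transform_within_open[where f=f and g=g, OF _ assms(1) that eq]
      unfolding differentiable_def by blast
    then show ?thesis using C Suc.IH[of "\<lambda>x. frechet_derivative f (at x) _" "\<lambda>x. frechet_derivative g (at x) _"] fr by simp
  qed
  show ?case using 1[of f g] 1[of g f] Suc.prems by metis
qed

lemma C_k_on_subset: "C_k_on k S f \<Longrightarrow> T \<subseteq> S \<Longrightarrow> C_k_on k T f"
proof (induction k arbitrary: f)
  case 0 then show ?case by (simp add: continuous_on_subset)
next
  case (Suc k) then show ?case by (auto simp: subset_iff)
qed

lemma C_k_on_Suc_imp: "C_k_on (Suc k) S f \<Longrightarrow> C_k_on k S f"
proof (induction k arbitrary: f)
  case 0 
  then show ?case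
    by (auto intro!: continuous_at_imp_continuous_on differentiable_imp_continuous_within)
next
  case (Suc k)
  have "C_k_on k S (\<lambda>x. frechet_derivative f (at x) v)" for v
    using Suc.prems by (intro Suc.IH) simp
  then show ?case using Suc.prems by simp
qed

lemma C_k_on_const: "C_k_on k S (\<lambda>x. c)"
  by (induction k arbitrary: c) auto

lemma frechet_eq: "(f has_derivative f') (at x) \<Longrightarrow> frechet_derivative f (at x) = f'"
  by (metis frechet_derivative_at)

lemma differentiable_has_frechet: "f differentiable at x \<Longrightarrow> (f has_derivative frechet_derivative f (at x)) (at x)"
  by (simp add: frechet_derivative_works)

lemma C_k_on_bounded_linear:
  assumes "open S" "bounded_linear h"
  shows "C_k_on k S f \<Longrightarrow> C_k_on k S (\<lambda>x. h (f x))"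
proof (induction k arbitrary: f)
  case 0 then show ?case using linear_continuous_on[OF assms(2)] 
    by (auto intro: continuous_on_compose2[where t=UNIV])
next
  case (Suc k)
  have hd: "((\<lambda>x. h (f x)) has_derivative (\<lambda>v. h (frechet_derivative f (at x) v))) (at x)" if "x \<in> S" for x
    using Suc.prems that by (auto intro!: bounded_linear.has_derivative[OF assms(2)] differentiable_has_frechet)
  then have "(\<lambda>x. h (f x)) differentiable at x" if "x \<in> S" for x
    using that differentiable_def by blast
  moreover have "C_k_on k S (\<lambda>x. frechet_derivative (\<lambda>x. h (f x)) (at x) v)" for v
    using Suc.IH[of "\<lambda>x. frechet_derivative f (at x) v"] Suc.prems
    by (subst C_k_on_cong[OF assms(1), where g="\<lambda>x. h (frechet_derivative f (at x) v)"])
       (auto simp: frechet_eq[OF hd])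
  ultimately show ?case by simp
qed

lemma C_k_on_add:
  assumes "open S"
  shows "C_k_on k S f \<Longrightarrow> C_k_on k S g \<Longrightarrow> C_k_on k S (\<lambda>x. f x + g x)"
proof (induction k arbitrary: f g)
  case 0 then show ?case by (simp add: continuous_on_add)
next
  case (Suc k)
  have hd: "((\<lambda>x. f x + g x) has_derivative (\<lambda>v. frechet_derivative f (at x) v + frechet_derivative g (at x) v)) (at x)"
    if "x \<in> S" for x
    using Suc.prems that by (auto intro!: has_derivative_add differentiable_has_frechet)
  then have "(\<lambda>x. f x + g x) differentiable at x" if "x \<in> S" for x
    using that differentiable_def by blast
  moreover have "C_k_on k S (\<lambda>x. frechet_derivative (\<lambda>x. f x + g x) (at x) v)" for v
    using Suc.IH[of "\<lambda>x. frechet_derivative f (at x) v" "\<lambda>x. frechet_derivative g (at x) v"] Suc.prems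
    by (subst C_k_on_cong[OF assms(1)]) (auto simp: frechet_eq[OF hd])
  ultimately show ?case by simp
qed

lemma C_k_on_bilinear:
  assumes "open S" "bounded_bilinear h"
  shows "C_k_on k S f \<Longrightarrow> C_k_on k S g \<Longrightarrow> C_k_on k S (\<lambda>x. h (f x) (g x))"
proof (induction k arbitrary: f g)
  case 0 then show ?case by (simp add: bounded_bilinear.continuous_on[OF assms(2)])
next
  case (Suc k)
  have hd: "((\<lambda>x. h (f x) (g x)) has_derivative (\<lambda>v. h (f x) (frechet_derivative g (at x) v) + h (frechet_derivative f (at x) v) (g x))) (at x)"
    if "x \<in> S" for x
    using Suc.prems that by (auto intro!: bounded_bilinear.FDERIV[OF assms(2)] differentiable_has_frechet)
  then have "(\<lambda>x. h (f x) (g x)) differentiable at x" if "x \<in> S" for x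
    using that differentiable_def by blast
  moreover have "C_k_on k S (\<lambda>x. frechet_derivative (\<lambda>x. h (f x) (g x)) (at x) v)" for v
  proof (subst C_k_on_cong[OF assms(1)])
    show "C_k_on k S (\<lambda>x. h (f x) (frechet_derivative g (at x) v) + h (frechet_derivative f (at x) v) (g x))"
      \<comment> \<open>In each Leibniz term one factor stays undifferentiated, so its order has to
        be lowered from \<open>Suc k\<close> to \<open>k\<close> before the induction hypothesis
        applies.\<close>
      using Suc.prems C_k_on_Suc_imp[of k S f] C_k_on_Suc_imp[of k S g]
      by (intro C_k_on_add[OF assms(1)] Suc.IH) simp_all
  qed (auto simp: frechet_eq[OF hd])
  ultimately show ?case by simp
qed

lemma C_k_on_sum:
  assumes "open S" "\<And>i. i \<in> I \<Longrightarrow> C_k_on k S (f i)"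
  shows "C_k_on k S (\<lambda>x. \<Sum>i\<in>I. f i x)"
  using assms(2)
  by (induction I rule: infinite_finite_induct) (auto intro: C_k_on_const C_k_on_add[OF assms(1)])

lemma linear_Basis_expansion:
  fixes v :: "'a::euclidean_space"
  assumes "linear L" shows "L v = (\<Sum>b\<in>Basis. (v \<bullet> b) *\<^sub>R L b)"
proof -
  have "L v = L (\<Sum>b\<in>Basis. (v \<bullet> b) *\<^sub>R b)" by (simp add: euclidean_representation)
  also have "\<dots> = (\<Sum>b\<in>Basis. (v \<bullet> b) *\<^sub>R L b)"
    using assms by (simp add: linear_sum linear_cmul)
  finally show ?thesis .
qed

lemma C_k_on_compose:
  fixes g :: "'a::euclidean_space \<Rightarrow> 'b::euclidean_space"
  assumes "open S" "open T"
  shows "C_k_on k T f \<Longrightarrow> C_k_on k S g \<Longrightarrow> g ` S \<subseteq> T \<Longrightarrow> C_k_on k S (\<lambda>x. f (g x))"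
proof (induction k arbitrary: f g)
  case 0 then show ?case by (auto intro: continuous_on_compose2)
next
  case (Suc k)
  have df: "f differentiable at (g x)" if "x \<in> S" for x
    using Suc.prems that by auto
  have hd: "((\<lambda>x. f (g x)) has_derivative (\<lambda>v. frechet_derivative f (at (g x)) (frechet_derivative g (at x) v))) (at x)"
    if "x \<in> S" for x
    using Suc.prems that df[OF that]
    by (auto intro!: has_derivative_compose[of g] differentiable_has_frechet)
  then have "(\<lambda>x. f (g x)) differentiable at x" if "x \<in> S" for x
    using that differentiable_def by blast
  moreover have "C_k_on k S (\<lambda>x. frechet_derivative (\<lambda>x. f (g x)) (at x) v)" for v
  proof (subst C_k_on_cong[OF assms(1)])
    \<comment> \<open>\<open>C_k_on\<close> speaks of derivatives in fixed directions, while the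
      chain rule applies f' to a moving vector. Expanding that vector in the basis leaves fixed
      directions b with scalar coefficients.\<close>
    show "C_k_on k S (\<lambda>x. \<Sum>b\<in>Basis. (frechet_derivative g (at x) v \<bullet> b) *\<^sub>R frechet_derivative f (at (g x)) b)"
    proof (intro C_k_on_sum[OF assms(1)] C_k_on_bilinear[OF assms(1) bounded_bilinear_scaleR])
      fix b :: 'b
      show "C_k_on k S (\<lambda>x. frechet_derivative g (at x) v \<bullet> b)"
        using Suc.prems by (intro C_k_on_bounded_linear[OF assms(1) bounded_linear_inner_left]) auto
      show "C_k_on k S (\<lambda>x. frechet_derivative f (at (g x)) b)"
        using Suc.prems C_k_on_Suc_imp[of k S g] by (intro Suc.IH[of "\<lambda>y. frechet_derivative f (at y) b"]) auto
    qed
  next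
    fix x assume x: "x \<in> S"
    show "frechet_derivative (\<lambda>x. f (g x)) (at x) v
      = (\<Sum>b\<in>Basis. (frechet_derivative g (at x) v \<bullet> b) *\<^sub>R frechet_derivative f (at (g x)) b)"
      unfolding frechet_eq[OF hd[OF x]]
      by (rule linear_Basis_expansion) (use df[OF x] linear_frechet_derivative in blast)
  qed
  ultimately show ?case by simp
qed

lemma smooth_on_cong:
  "open S \<Longrightarrow> (\<And>x. x \<in> S \<Longrightarrow> f x = g x) \<Longrightarrow> smooth_on S f \<longleftrightarrow> smooth_on S g"
  using C_k_on_cong[of S f g] by (simp add: smooth_on_def)

lemma smooth_on_subset: "smooth_on S f \<Longrightarrow> T \<subseteq> S \<Longrightarrow> smooth_on T f"
  using C_k_on_subset by (metis smooth_on_def)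

lemma smooth_on_differentiable: "smooth_on S f \<Longrightarrow> x \<in> S \<Longrightarrow> f differentiable at x"
  unfolding smooth_on_def by (drule spec[where x="Suc 0"]) simp

lemma smooth_on_has_derivative:
  "smooth_on S f \<Longrightarrow> x \<in> S \<Longrightarrow> (f has_derivative frechet_derivative f (at x)) (at x)"
  by (intro differentiable_has_frechet smooth_on_differentiable)

lemma smooth_on_frechet: "smooth_on S f \<Longrightarrow> smooth_on S (\<lambda>x. frechet_derivative f (at x) v)"
  unfolding smooth_on_def by (metis C_k_on.simps(2))

lemma smooth_on_const: "smooth_on S (\<lambda>x. c)"
  by (simp add: smooth_on_def C_k_on_const)

lemma smooth_on_bounded_linear:
  "open S \<Longrightarrow> bounded_linear h \<Longrightarrow> smooth_on S f \<Longrightarrow> smooth_on S (\<lambda>x. h (f x))"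
  by (simp add: smooth_on_def C_k_on_bounded_linear)

lemma smooth_on_ident:
  assumes "open S" shows "smooth_on S (\<lambda>x. x)"
proof -
  have "C_k_on k S (\<lambda>x. x)" for k
  proof (cases k)
    case 0 then show ?thesis by simp
  next
    case (Suc n)
    then show ?thesis by (simp add: C_k_on_const)
  qed
  then show ?thesis by (simp add: smooth_on_def)
qed

lemma smooth_on_add:
  "open S \<Longrightarrow> smooth_on S f \<Longrightarrow> smooth_on S g \<Longrightarrow> smooth_on S (\<lambda>x. f x + g x)"
  by (simp add: smooth_on_def C_k_on_add)

lemma smooth_on_bilinear:
  "open S \<Longrightarrow> bounded_bilinear h \<Longrightarrow> smooth_on S f \<Longrightarrow> smooth_on S g \<Longrightarrow> smooth_on S (\<lambda>x. h (f x) (g x))"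
  by (simp add: smooth_on_def C_k_on_bilinear)

lemmas smooth_on_scaleR = smooth_on_bilinear[OF _ bounded_bilinear_scaleR]
lemmas smooth_on_inner = smooth_on_bilinear[OF _ bounded_bilinear_inner]

lemma smooth_on_diff:
  assumes "open S" "smooth_on S f" "smooth_on S g" shows "smooth_on S (\<lambda>x. f x - g x)"
  using smooth_on_add[OF assms(1,2) smooth_on_bounded_linear[OF assms(1) bounded_linear_minus[OF bounded_linear_ident] assms(3)]]
  by simp

lemma smooth_on_sum:
  "open S \<Longrightarrow> (\<And>i. i \<in> I \<Longrightarrow> smooth_on S (f i)) \<Longrightarrow> smooth_on S (\<lambda>x. \<Sum>i\<in>I. f i x)"
  by (simp add: smooth_on_def C_k_on_sum)

lemma smooth_on_compose:
  fixes g :: "'a::euclidean_space \<Rightarrow> 'b::euclidean_space"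
  shows "open S \<Longrightarrow> open T \<Longrightarrow> smooth_on T f \<Longrightarrow> smooth_on S g \<Longrightarrow> g ` S \<subseteq> T \<Longrightarrow>
    smooth_on S (\<lambda>x. f (g x))"
  by (simp add: smooth_on_def C_k_on_compose)

lemma smooth_on_Pair:
  fixes f :: "'a::euclidean_space \<Rightarrow> 'b::real_normed_vector" and g :: "'a \<Rightarrow> 'c::real_normed_vector"
  assumes "open S" "smooth_on S f" "smooth_on S g"
  shows "smooth_on S (\<lambda>x. (f x, g x))"
proof -
  have 1: "bounded_linear (\<lambda>a::'b. (a, 0::'c))" "bounded_linear (\<lambda>a::'c. (0::'b, a))"
    by (intro bounded_linear_Pair bounded_linear_ident bounded_linear_zero)+
  show ?thesis
    using smooth_on_add[OF assms(1) smooth_on_bounded_linear[OF assms(1) 1(1) assms(2)]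
        smooth_on_bounded_linear[OF assms(1) 1(2) assms(3)]] by simp
qed

text \<open>Two applications of the mean value theorem: along u to the difference of f between two
  opposite sides of the parallelogram, then along v to the derivative so obtained. The second
  difference is symmetric in u and v, which is what the symmetry proof exploits.\<close>

lemma second_difference_mvt:
  fixes f :: "'a::euclidean_space \<Rightarrow> real"
  assumes f: "smooth_on S f" and "t > 0"
    and seg: "\<And>a b. 0 \<le> a \<Longrightarrow> a \<le> t \<Longrightarrow> 0 \<le> b \<Longrightarrow> b \<le> t \<Longrightarrow> x + a *\<^sub>R u + b *\<^sub>R v \<in> S"
  obtains a b where "0 < a" "a < t" "0 < b" "b < t"
    "f (x + t *\<^sub>R u + t *\<^sub>R v) - f (x + t *\<^sub>R u) - f (x + t *\<^sub>R v) + f x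
      = t * t * frechet_derivative (\<lambda>y. frechet_derivative f (at y) u) (at (x + a *\<^sub>R u + b *\<^sub>R v)) v"
proof -
  let ?g = "\<lambda>a. f (x + a *\<^sub>R u + t *\<^sub>R v) - f (x + a *\<^sub>R u)"
  let ?fu = "\<lambda>y. frechet_derivative f (at y) u"
  have fu: "smooth_on S ?fu" by (rule smooth_on_frechet[OF f])
  have along: "((\<lambda>a. h (x + a *\<^sub>R u + b *\<^sub>R v)) has_real_derivative frechet_derivative h (at (x + a *\<^sub>R u + b *\<^sub>R v)) u) (at a)"
    "((\<lambda>b. h (x + a *\<^sub>R u + b *\<^sub>R v)) has_real_derivative frechet_derivative h (at (x + a *\<^sub>R u + b *\<^sub>R v)) v) (at b)"
    if h: "smooth_on S h" and ab: "0 \<le> a" "a \<le> t" "0 \<le> b" "b \<le> t" for h :: "'a \<Rightarrow> real" and a b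
  proof -
    note d = smooth_on_has_derivative[OF h seg[OF ab]]
    have lin: "linear (frechet_derivative h (at (x + a *\<^sub>R u + b *\<^sub>R v)))"
      using d has_derivative_linear by blast
    have "((\<lambda>a. x + a *\<^sub>R u + b *\<^sub>R v) has_derivative (\<lambda>r. r *\<^sub>R u)) (at a)"
      "((\<lambda>b. x + a *\<^sub>R u + b *\<^sub>R v) has_derivative (\<lambda>r. r *\<^sub>R v)) (at b)"
      by (auto intro!: derivative_eq_intros)
    from this[THEN has_derivative_compose, OF d] 
    show "((\<lambda>a. h (x + a *\<^sub>R u + b *\<^sub>R v)) has_real_derivative frechet_derivative h (at (x + a *\<^sub>R u + b *\<^sub>R v)) u) (at a)"
      "((\<lambda>b. h (x + a *\<^sub>R u + b *\<^sub>R v)) has_real_derivative frechet_derivative h (at (x + a *\<^sub>R u + b *\<^sub>R v)) v) (at b)"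
      by (auto simp: has_field_derivative_def linear_cmul[OF lin] mult_commute_abs)
  qed
  have "\<exists>a>0. a < t \<and> ?g t - ?g 0 = (t - 0) * (?fu (x + a *\<^sub>R u + t *\<^sub>R v) - ?fu (x + a *\<^sub>R u))"
    using \<open>t > 0\<close> along(1)[OF f, of _ t] along(1)[OF f, of _ 0]
    by (intro MVT2) (auto intro!: DERIV_diff)
  then obtain a where a: "0 < a" "a < t" "?g t - ?g 0 = t * (?fu (x + a *\<^sub>R u + t *\<^sub>R v) - ?fu (x + a *\<^sub>R u))"
    by auto
  have "\<exists>b>0. b < t \<and> ?fu (x + a *\<^sub>R u + t *\<^sub>R v) - ?fu (x + a *\<^sub>R u + 0 *\<^sub>R v)
      = (t - 0) * frechet_derivative ?fu (at (x + a *\<^sub>R u + b *\<^sub>R v)) v"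
    using \<open>t > 0\<close> along(2)[OF fu, of a] a by (intro MVT2) auto
  then obtain b where "0 < b" "b < t"
    "?fu (x + a *\<^sub>R u + t *\<^sub>R v) - ?fu (x + a *\<^sub>R u) = t * frechet_derivative ?fu (at (x + a *\<^sub>R u + b *\<^sub>R v)) v"
    by auto
  then show thesis using that[of a b] a by (simp add: algebra_simps)
qed

text \<open>The second difference divided by t^2 equals either iterated derivative at some point of
  a small parallelogram; by continuity both are close to their values at x.\<close>

lemma frechet_derivative_symmetric_real:
  fixes f :: "'a::euclidean_space \<Rightarrow> real"
  assumes S: "open S" "x \<in> S" and f: "smooth_on S f"
  shows "frechet_derivative (\<lambda>y. frechet_derivative f (at y) u) (at x) v
    = frechet_derivative (\<lambda>y. frechet_derivative f (at y) v) (at x) u"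
proof -
  let ?D = "\<lambda>u v y. frechet_derivative (\<lambda>y. frechet_derivative f (at y) u) (at y) v"
  have cont: "continuous_on S (?D u v)" for u v
    using smooth_on_frechet[OF smooth_on_frechet[OF f]] unfolding smooth_on_def by (metis C_k_on.simps(1))
  have "\<bar>?D u v x - ?D v u x\<bar> < 2 * e" if "e > 0" for e
  proof -
    have "\<exists>d>0. ball x d \<subseteq> S \<and> (\<forall>y\<in>ball x d. \<bar>?D u v y - ?D u v x\<bar> < e)" for u v
    proof -
      obtain r where r: "r > 0" "ball x r \<subseteq> S" using S openE by blast
      obtain d where d: "d > 0" "\<And>y. y \<in> S \<Longrightarrow> dist y x < d \<Longrightarrow> dist (?D u v y) (?D u v x) < e"
        using cont[of u v] S(2) \<open>e > 0\<close> unfolding continuous_on_iff by blast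
      show ?thesis using r d by (intro exI[of _ "min r d"]) (auto simp: dist_commute dist_real_def subset_iff)
    qed
    then obtain d1 d2 where d: "d1 > 0" "d2 > 0" "ball x d1 \<subseteq> S" "ball x d2 \<subseteq> S"
      "\<forall>y\<in>ball x d1. \<bar>?D u v y - ?D u v x\<bar> < e" "\<forall>y\<in>ball x d2. \<bar>?D v u y - ?D v u x\<bar> < e" by meson
    define d where "d = min d1 d2"
    \<comment> \<open>Keeps every point of the parallelogram within distance d of x, for both orders
      of u and v; the summand 1 makes the denominator positive and the estimate strict.\<close>
    define t where "t = d / (norm u + norm v + 1)"
    have pos: "norm u + norm v + 1 > 0" by (simp add: add_nonneg_pos)
    have t: "t > 0" using d pos by (simp add: t_def d_def)
    have tn: "t * (norm u + norm v + 1) = d" using pos by (simp add: t_def)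
    have nr: "x + a *\<^sub>R w + b *\<^sub>R w' \<in> ball x d"
      if "0 \<le> a" "a \<le> t" "0 \<le> b" "b \<le> t" "w = u \<and> w' = v \<or> w = v \<and> w' = u" for a b w w'
    proof -
      have "norm (a *\<^sub>R w + b *\<^sub>R w') \<le> a * norm w + b * norm w'"
        using that norm_triangle_ineq[of "a *\<^sub>R w" "b *\<^sub>R w'"] by simp
      also have "\<dots> \<le> t * norm w + t * norm w'"
        using that by (intro add_mono mult_right_mono) auto
      also have "\<dots> < t * (norm u + norm v + 1)" using that t by (auto simp: algebra_simps)
      finally show ?thesis using tn by (simp add: dist_norm norm_minus_commute algebra_simps)
    qed
    have sub: "ball x d \<subseteq> S" using d by (auto simp: d_def)
    obtain a b where ab: "0 < a" "a < t" "0 < b" "b < t"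
      "f (x + t *\<^sub>R u + t *\<^sub>R v) - f (x + t *\<^sub>R u) - f (x + t *\<^sub>R v) + f x = t * t * ?D u v (x + a *\<^sub>R u + b *\<^sub>R v)"
      using second_difference_mvt[OF f t, of x u v] nr sub by blast
    obtain a' b' where ab': "0 < a'" "a' < t" "0 < b'" "b' < t"
      "f (x + t *\<^sub>R v + t *\<^sub>R u) - f (x + t *\<^sub>R v) - f (x + t *\<^sub>R u) + f x = t * t * ?D v u (x + a' *\<^sub>R v + b' *\<^sub>R u)"
      using second_difference_mvt[OF f t, of x v u] nr sub by blast
    have "t * t * ?D u v (x + a *\<^sub>R u + b *\<^sub>R v) = t * t * ?D v u (x + a' *\<^sub>R v + b' *\<^sub>R u)"
      using ab(5) ab'(5) by (simp add: algebra_simps)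
    then have "?D u v (x + a *\<^sub>R u + b *\<^sub>R v) = ?D v u (x + a' *\<^sub>R v + b' *\<^sub>R u)" using t by simp
    moreover have "\<bar>?D u v (x + a *\<^sub>R u + b *\<^sub>R v) - ?D u v x\<bar> < e"
      using d(5) nr[of a b u v] ab by (simp add: d_def)
    moreover have "\<bar>?D v u (x + a' *\<^sub>R v + b' *\<^sub>R u) - ?D v u x\<bar> < e"
      using d(6) nr[of a' b' v u] ab' by (simp add: d_def)
    ultimately show ?thesis by linarith
  qed
  \<comment> \<open>Half of a positive gap, taken as e, would make the gap smaller than
    itself.\<close>
  from this[of "\<bar>?D u v x - ?D v u x\<bar> / 2"] show ?thesis by fastforce
qed

lemma frechet_derivative_bounded_linear:
  assumes "bounded_linear h" "f differentiable at x"
  shows "frechet_derivative (\<lambda>x. h (f x)) (at x) v = h (frechet_derivative f (at x) v)"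
  using frechet_eq[OF bounded_linear.has_derivative[OF assms(1) differentiable_has_frechet[OF assms(2)]]] by simp

lemma frechet_derivative_cong:
  assumes "open S" "x \<in> S" "\<And>y. y \<in> S \<Longrightarrow> f y = g y"
  shows "frechet_derivative f (at x) = frechet_derivative g (at x)"
proof -
  have "(f has_derivative D) (at x) \<longleftrightarrow> (g has_derivative D) (at x)" for D
    using has_derivative_transform_within_open[OF _ assms(1,2), of f D UNIV g]
      has_derivative_transform_within_open[OF _ assms(1,2), of g D UNIV f] assms(3) by auto
  then show ?thesis by (simp add: frechet_derivative_def)
qed

lemma frechet_derivative_symmetric:
  fixes f :: "'a::euclidean_space \<Rightarrow> 'b::euclidean_space"
  assumes S: "open S" "x \<in> S" and f: "smooth_on S f"
  shows "frechet_derivative (\<lambda>y. frechet_derivative f (at y) u) (at x) v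
    = frechet_derivative (\<lambda>y. frechet_derivative f (at y) v) (at x) u"
proof (rule euclidean_eqI)
  fix b :: 'b
  let ?h = "\<lambda>y::'b. y \<bullet> b"
  have h: "bounded_linear ?h" by (rule bounded_linear_inner_left)
  have "frechet_derivative (\<lambda>y. frechet_derivative (\<lambda>y. ?h (f y)) (at y) u) (at x) v
      = ?h (frechet_derivative (\<lambda>y. frechet_derivative f (at y) u) (at x) v)" for u v
  proof -
    have "frechet_derivative (\<lambda>y. frechet_derivative (\<lambda>y. ?h (f y)) (at y) u) (at x)
        = frechet_derivative (\<lambda>y. ?h (frechet_derivative f (at y) u)) (at x)"
      using frechet_derivative_bounded_linear[OF h smooth_on_differentiable[OF f]]
      by (intro frechet_derivative_cong[OF S])
    then show ?thesis
      using frechet_derivative_bounded_linear[OF h smooth_on_differentiable[OF smooth_on_frechet[OF f] S(2)]] by simp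
  qed
  then show "?h (frechet_derivative (\<lambda>y. frechet_derivative f (at y) u) (at x) v)
    = ?h (frechet_derivative (\<lambda>y. frechet_derivative f (at y) v) (at x) u)"
    using frechet_derivative_symmetric_real[OF S smooth_on_bounded_linear[OF S(1) h f], of u v] by simp
qed

section \<open>Product rule for operator fields that are known to be smooth for each frozen
  argument\<close>

subsection \<open>Fields of linear maps\<close>

definition field_deriv :: "('a::euclidean_space \<Rightarrow> 'b \<Rightarrow> 'c::real_normed_vector) \<Rightarrow> 'a \<Rightarrow> 'a \<Rightarrow> 'b \<Rightarrow> 'c" where
  "field_deriv L x h u = frechet_derivative (\<lambda>x. L x u) (at x) h"

lemma field_expansion_eq:
  fixes L :: "'a::euclidean_space \<Rightarrow> 'b::euclidean_space \<Rightarrow> 'c::real_normed_vector"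
  assumes "\<And>x. x \<in> S \<Longrightarrow> linear (L x)" "x \<in> S"
  shows "L x (X x) = (\<Sum>b\<in>Basis. (X x \<bullet> b) *\<^sub>R L x b)"
  using assms by (intro linear_Basis_expansion)

lemma smooth_on_field:
  fixes L :: "'a::euclidean_space \<Rightarrow> 'b::euclidean_space \<Rightarrow> 'c::real_normed_vector"
  assumes S: "open S" and lin: "\<And>x. x \<in> S \<Longrightarrow> linear (L x)"
    and "\<And>u. smooth_on S (\<lambda>x. L x u)" "smooth_on S X"
  shows "smooth_on S (\<lambda>x. L x (X x))"
proof (subst smooth_on_cong[OF S])
  show "smooth_on S (\<lambda>x. \<Sum>b\<in>Basis. (X x \<bullet> b) *\<^sub>R L x b)"
    using assms by (intro smooth_on_sum smooth_on_scaleR smooth_on_inner smooth_on_const)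
qed (rule field_expansion_eq[OF lin])

lemma linear_field_deriv:
  fixes L :: "'a::euclidean_space \<Rightarrow> 'b::euclidean_space \<Rightarrow> 'c::real_normed_vector"
  assumes S: "open S" "x \<in> S" and lin: "\<And>x. x \<in> S \<Longrightarrow> linear (L x)"
    and diff: "\<And>u. (\<lambda>x. L x u) differentiable at x"
  shows "linear (\<lambda>h. field_deriv L x h u)" "linear (field_deriv L x h)"
proof -
  show "linear (\<lambda>h. field_deriv L x h u)"
    using linear_frechet_derivative[OF diff] by (simp add: field_deriv_def)
  note hd = differentiable_has_frechet[OF diff]
  show "linear (field_deriv L x h)"
  proof (rule linearI)
    fix u v
    have "frechet_derivative (\<lambda>x. L x (u + v)) (at x) = frechet_derivative (\<lambda>x. L x u + L x v) (at x)"
      using lin by (intro frechet_derivative_cong[OF S]) (auto simp: linear_add)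
    then show "field_deriv L x h (u + v) = field_deriv L x h u + field_deriv L x h v"
      using frechet_eq[OF has_derivative_add[OF hd[of u] hd[of v]]] by (simp add: field_deriv_def)
  next
    fix r u
    have "frechet_derivative (\<lambda>x. L x (r *\<^sub>R u)) (at x) = frechet_derivative (\<lambda>x. r *\<^sub>R L x u) (at x)"
      using lin by (intro frechet_derivative_cong[OF S]) (auto simp: linear_cmul)
    then show "field_deriv L x h (r *\<^sub>R u) = r *\<^sub>R field_deriv L x h u"
      using frechet_eq[OF has_derivative_scaleR_right[OF hd[of u], of r]] by (simp add: field_deriv_def)
  qed
qed

text \<open>L is not treated as a map into a space of operators; the basis expansion makes
  \<open>L x (X x)\<close> a finite sum of products of differentiable functions, to which the usual
  product rule applies.\<close>

lemma has_derivative_field: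
  fixes L :: "'a::euclidean_space \<Rightarrow> 'b::euclidean_space \<Rightarrow> 'c::real_normed_vector"
  assumes S: "open S" "x \<in> S" and lin: "\<And>x. x \<in> S \<Longrightarrow> linear (L x)"
    and diff: "\<And>u. (\<lambda>x. L x u) differentiable at x"
    and X: "(X has_derivative X') (at x)"
  shows "((\<lambda>x. L x (X x)) has_derivative (\<lambda>h. field_deriv L x h (X x) + L x (X' h))) (at x)"
proof -
  note hd = differentiable_has_frechet[OF diff]
  have "((\<lambda>x. \<Sum>b\<in>Basis. (X x \<bullet> b) *\<^sub>R L x b) has_derivative
      (\<lambda>h. \<Sum>b\<in>Basis. (X x \<bullet> b) *\<^sub>R field_deriv L x h b + (X' h \<bullet> b) *\<^sub>R L x b)) (at x)"
    unfolding field_deriv_def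
    by (intro has_derivative_sum has_derivative_scaleR hd has_derivative_inner_left X)
  moreover have "(\<Sum>b\<in>Basis. (X x \<bullet> b) *\<^sub>R field_deriv L x h b + (X' h \<bullet> b) *\<^sub>R L x b)
      = field_deriv L x h (X x) + L x (X' h)" for h
    by (subst linear_Basis_expansion[OF linear_field_deriv(2)[OF S lin diff], of h "X x"],
        simp, subst linear_Basis_expansion[OF lin[OF S(2)], of "X' h"]) (simp_all add: sum.distrib)
  ultimately have "((\<lambda>x. \<Sum>b\<in>Basis. (X x \<bullet> b) *\<^sub>R L x b) has_derivative
      (\<lambda>h. field_deriv L x h (X x) + L x (X' h))) (at x)" by simp
  then show ?thesis
    by (rule has_derivative_transform_within_open[OF _ S]) (simp add: field_expansion_eq[where L=L and X=X, OF lin, symmetric])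
qed

section \<open>Coordinate forms of the Lie bracket and the Nijenhuis tensor\<close>

section \<open>Brackets in Euclidean space\<close>

definition lie_euc :: "('e::euclidean_space \<Rightarrow> 'e) \<Rightarrow> ('e \<Rightarrow> 'e) \<Rightarrow> 'e \<Rightarrow> 'e" where
  "lie_euc X Y x = frechet_derivative Y (at x) (X x) - frechet_derivative X (at x) (Y x)"

text \<open>The Nijenhuis tensor on constant fields u and v: their own bracket vanishes, and [Ku, v]
  and [u, Kv] reduce to minus the derivative of K along v on u and the derivative of K along u on
  v.\<close>

definition nijenhuis_euc :: "('e::euclidean_space \<Rightarrow> 'e \<Rightarrow> 'e) \<Rightarrow> 'e \<Rightarrow> 'e \<Rightarrow> 'e \<Rightarrow> 'e" where
  "nijenhuis_euc K x u v = K x (field_deriv K x u v - field_deriv K x v u)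
     - field_deriv K x (K x u) v + field_deriv K x (K x v) u"

lemma lie_euc_eq:
  "(X has_derivative X') (at x) \<Longrightarrow> (Y has_derivative Y') (at x) \<Longrightarrow> lie_euc X Y x = Y' (X x) - X' (Y x)"
  by (simp add: lie_euc_def frechet_eq)

lemma lie_euc_cong:
  assumes "open S" "x \<in> S" "\<And>y. y \<in> S \<Longrightarrow> X y = X' y" "\<And>y. y \<in> S \<Longrightarrow> Y y = Y' y"
  shows "lie_euc X Y x = lie_euc X' Y' x"
  unfolding lie_euc_def using frechet_derivative_cong[OF assms(1,2,3)] frechet_derivative_cong[OF assms(1,2,4)]
    assms by simp

text \<open>All derivatives of X and Y cancel, partly because K K = -1 and partly because they occur
  with opposite signs. This is the tensoriality of the Nijenhuis tensor: any fields with the right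
  values at x may be used to compute it.\<close>

lemma nijenhuis_euc_fields:
  assumes S: "open S" "x \<in> S" and lin: "\<And>y. y \<in> S \<Longrightarrow> linear (K y)" and sq: "\<And>u. K x (K x u) = - u"
    and diff: "\<And>u. (\<lambda>y. K y u) differentiable at x"
    and X: "X differentiable at x" and Y: "Y differentiable at x"
  shows "lie_euc X Y x + K x (lie_euc (\<lambda>y. K y (X y)) Y x + lie_euc X (\<lambda>y. K y (Y y)) x)
      - lie_euc (\<lambda>y. K y (X y)) (\<lambda>y. K y (Y y)) x = nijenhuis_euc K x (X x) (Y x)"
proof -
  note dX = differentiable_has_frechet[OF X] and dY = differentiable_has_frechet[OF Y]
  have dKX: "((\<lambda>y. K y (X y)) has_derivative (\<lambda>h. field_deriv K x h (X x) + K x (frechet_derivative X (at x) h))) (at x)"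
    by (rule has_derivative_field[OF S lin diff dX])
  have dKY: "((\<lambda>y. K y (Y y)) has_derivative (\<lambda>h. field_deriv K x h (Y x) + K x (frechet_derivative Y (at x) h))) (at x)"
    by (rule has_derivative_field[OF S lin diff dY])
  note l = lin[OF S(2)]
  show ?thesis
    unfolding lie_euc_eq[OF dX dY] lie_euc_eq[OF dKX dY] lie_euc_eq[OF dX dKY] lie_euc_eq[OF dKX dKY] nijenhuis_euc_def
    by (simp add: linear_diff[OF l] linear_add[OF l] sq algebra_simps)
qed

text \<open>Differentiating the relation between the fields brings in the second derivative of
  \<phi> on X and Y; being symmetric, it drops out of the antisymmetric difference.\<close>

lemma lie_euc_related:
  fixes \<phi> :: "'e::euclidean_space \<Rightarrow> 'e"
  assumes S: "open S" "x \<in> S" and \<phi>: "smooth_on S \<phi>"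
    and X: "X differentiable at x" and Y: "Y differentiable at x"
    and X': "X' differentiable at (\<phi> x)" and Y': "Y' differentiable at (\<phi> x)"
    and XX': "\<And>y. y \<in> S \<Longrightarrow> X' (\<phi> y) = frechet_derivative \<phi> (at y) (X y)"
    and YY': "\<And>y. y \<in> S \<Longrightarrow> Y' (\<phi> y) = frechet_derivative \<phi> (at y) (Y y)"
  shows "lie_euc X' Y' (\<phi> x) = frechet_derivative \<phi> (at x) (lie_euc X Y x)"
proof -
  let ?L = "\<lambda>y. frechet_derivative \<phi> (at y)"
  have lin: "linear (?L y)" if "y \<in> S" for y
    using smooth_on_has_derivative[OF \<phi> that] has_derivative_linear by blast
  have sym: "field_deriv ?L x u v = field_deriv ?L x v u" for u v
    unfolding field_deriv_def by (rule frechet_derivative_symmetric[OF S \<phi>])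
  have *: "frechet_derivative Z' (at (\<phi> x)) (?L x h) = field_deriv ?L x h (Z x) + ?L x (frechet_derivative Z (at x) h)"
    if Z: "Z differentiable at x" "Z' differentiable at (\<phi> x)"
      and ZZ: "\<And>y. y \<in> S \<Longrightarrow> Z' (\<phi> y) = ?L y (Z y)" for Z Z' h
  proof -
    have "frechet_derivative (\<lambda>y. Z' (\<phi> y)) (at x) = frechet_derivative (\<lambda>y. ?L y (Z y)) (at x)"
      by (rule frechet_derivative_cong[OF S ZZ])
    moreover have "frechet_derivative (\<lambda>y. Z' (\<phi> y)) (at x) = (\<lambda>h. frechet_derivative Z' (at (\<phi> x)) (?L x h))"
      by (rule frechet_eq[OF has_derivative_compose[OF smooth_on_has_derivative[OF \<phi> S(2)] differentiable_has_frechet[OF Z(2)]]])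
    moreover have "frechet_derivative (\<lambda>y. ?L y (Z y)) (at x) = (\<lambda>h. field_deriv ?L x h (Z x) + ?L x (frechet_derivative Z (at x) h))"
      using S by (intro frechet_eq[OF has_derivative_field[OF S lin]] differentiable_has_frechet Z
        smooth_on_differentiable[OF smooth_on_frechet[OF \<phi>]])
    ultimately have "(\<lambda>h. frechet_derivative Z' (at (\<phi> x)) (?L x h))
        = (\<lambda>h. field_deriv ?L x h (Z x) + ?L x (frechet_derivative Z (at x) h))" by simp
    from fun_cong[OF this, of h] show ?thesis .
  qed
  show ?thesis
    using sym[of "X x" "Y x"]
    by (simp add: lie_euc_def XX'[OF S(2)] YY'[OF S(2)] *[OF X X' XX'] *[OF Y Y' YY'] linear_diff[OF lin[OF S(2)]])
qed

section \<open>Passage from the pointwise identification of tangent spaces to an arbitrary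
  chart\<close>

section \<open>Fields in charts\<close>

text \<open>Indexed by the manifold point rather than by coordinates, so that the chain rule becomes
  the cocycle rule \<open>tmap_comp\<close>; \<open>to_coords\<close> and \<open>from_coords\<close>
  are the cases in which one chart is \<open>chart_at A p\<close>.\<close>

definition tmap :: "('m, 'e::euclidean_space) chart \<Rightarrow> ('m, 'e) chart \<Rightarrow> 'm \<Rightarrow> 'e \<Rightarrow> 'e" where
  "tmap c c' p = frechet_derivative (transition c c') (at (snd c p))"

definition local_endo ::
  "('m, 'e::euclidean_space) chart set \<Rightarrow> ('m, 'e) chart \<Rightarrow> ('m \<Rightarrow> 'e \<Rightarrow> 'e) \<Rightarrow> 'e \<Rightarrow> 'e \<Rightarrow> 'e" where
  "local_endo A c J x u = to_coords A c (chart_inv c x) (J (chart_inv c x) (from_coords A c (chart_inv c x) u))"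

definition coord_field :: "('m, 'e::euclidean_space) chart set \<Rightarrow> ('m, 'e) chart \<Rightarrow> 'e \<Rightarrow> 'm \<Rightarrow> 'e" where
  "coord_field A c u p = from_coords A c p u"

locale atlas =
  fixes A :: "('m, 'e::euclidean_space) chart set"
  assumes smooth_atlas: "smooth_atlas A"
begin

lemma inj_chart: "c \<in> A \<Longrightarrow> inj_on (snd c) (fst c)"
  using smooth_atlas by (auto simp: smooth_atlas_def)

lemma chart_inv_chart [simp]: "c \<in> A \<Longrightarrow> p \<in> fst c \<Longrightarrow> chart_inv c (snd c p) = p"
  by (simp add: chart_inv_def inj_chart)

lemma transition_chart [simp]: "c \<in> A \<Longrightarrow> p \<in> fst c \<Longrightarrow> transition c c' (snd c p) = snd c' p"
  by (simp add: transition_def)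

lemma in_carrier: "c \<in> A \<Longrightarrow> p \<in> fst c \<Longrightarrow> p \<in> carrier_of A"
  by (auto simp: carrier_of_def)

lemma open_overlap: "c \<in> A \<Longrightarrow> c' \<in> A \<Longrightarrow> open (snd c ` (fst c \<inter> fst c'))"
  using smooth_atlas by (auto simp: smooth_atlas_def)

lemma smooth_transition: "c \<in> A \<Longrightarrow> c' \<in> A \<Longrightarrow> smooth_on (snd c ` (fst c \<inter> fst c')) (transition c c')"
  using smooth_atlas by (auto simp: smooth_atlas_def)

lemma open_chart: "c \<in> A \<Longrightarrow> open (snd c ` fst c)"
  using open_overlap[of c c] by simp

lemma openin_chart: "c \<in> A \<Longrightarrow> openin (mtop A) (fst c)"
  using openin_mtop[OF smooth_atlas] open_overlap
  by (auto simp: carrier_of_def Int_commute)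

lemma open_image: "openin (mtop A) U \<Longrightarrow> c \<in> A \<Longrightarrow> open (snd c ` (U \<inter> fst c))"
  using openin_mtop[OF smooth_atlas] by auto

lemma openin_carrier: "openin (mtop A) U \<Longrightarrow> p \<in> U \<Longrightarrow> p \<in> carrier_of A"
  using openin_mtop[OF smooth_atlas] by auto

lemma chart_at: "p \<in> carrier_of A \<Longrightarrow> chart_at A p \<in> A" "p \<in> carrier_of A \<Longrightarrow> p \<in> fst (chart_at A p)"
proof -
  assume "p \<in> carrier_of A"
  then have "\<exists>c. c \<in> A \<and> p \<in> fst c" by (auto simp: carrier_of_def)
  then have "chart_at A p \<in> A \<and> p \<in> fst (chart_at A p)"
    unfolding chart_at_def by (rule someI_ex)
  then show "chart_at A p \<in> A" "p \<in> fst (chart_at A p)" by auto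
qed

lemma obtain_chart: assumes "openin (mtop A) U" "p \<in> U" obtains c where "c \<in> A" "p \<in> fst c"
  using openin_carrier[OF assms] chart_at by blast

lemma transition_deriv:
  assumes "c \<in> A" "c' \<in> A" "p \<in> fst c" "p \<in> fst c'"
  shows "(transition c c' has_derivative tmap c c' p) (at (snd c p))"
  unfolding tmap_def using assms by (intro smooth_on_has_derivative[OF smooth_transition]) auto

lemma tmap_linear:
  "c \<in> A \<Longrightarrow> c' \<in> A \<Longrightarrow> p \<in> fst c \<Longrightarrow> p \<in> fst c' \<Longrightarrow> linear (tmap c c' p)"
  using transition_deriv has_derivative_linear by blast

lemma tmap_comp:
  assumes "c \<in> A" "c' \<in> A" "c'' \<in> A" "p \<in> fst c" "p \<in> fst c'" "p \<in> fst c''"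
  shows "tmap c' c'' p (tmap c c' p v) = tmap c c'' p v"
proof -
  let ?S = "snd c ` (fst c \<inter> fst c')"
  have "((\<lambda>x. transition c' c'' (transition c c' x)) has_derivative (\<lambda>v. tmap c' c'' p (tmap c c' p v))) (at (snd c p))"
    using transition_deriv[of c' c'' p] assms by (intro has_derivative_compose[OF transition_deriv]) auto
  then have "(transition c c'' has_derivative (\<lambda>v. tmap c' c'' p (tmap c c' p v))) (at (snd c p))"
    by (rule has_derivative_transform_within_open[OF _ open_overlap[OF assms(1,2)]]) (use assms in auto)
  then show ?thesis using has_derivative_unique[OF transition_deriv] assms by metis
qed

lemma tmap_same: assumes "c \<in> A" "p \<in> fst c" shows "tmap c c p v = v"
proof -
  have "(transition c c has_derivative (\<lambda>v. v)) (at (snd c p))"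
    by (rule has_derivative_transform_within_open[OF has_derivative_ident open_chart[OF assms(1)]]) (use assms in auto)
  then show ?thesis using has_derivative_unique[OF transition_deriv] assms by metis
qed

lemma to_coords_tmap: "to_coords A c p = tmap (chart_at A p) c p"
  by (auto simp: to_coords_def tmap_def)

lemma from_coords_tmap: "from_coords A c p = tmap c (chart_at A p) p"
  by (auto simp: from_coords_def tmap_def)

context
  fixes c p assumes c: "c \<in> A" "p \<in> fst c"
begin

lemma to_from [simp]: "to_coords A c p (from_coords A c p u) = u"
  using c chart_at[OF in_carrier[OF c]] by (simp add: to_coords_tmap from_coords_tmap tmap_comp tmap_same)

lemma from_to [simp]: "from_coords A c p (to_coords A c p u) = u"
  using c chart_at[OF in_carrier[OF c]] by (simp add: to_coords_tmap from_coords_tmap tmap_comp tmap_same)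

lemma linear_to_coords: "linear (to_coords A c p)"
  using c chart_at[OF in_carrier[OF c]] by (simp add: to_coords_tmap tmap_linear)

lemma linear_from_coords: "linear (from_coords A c p)"
  using c chart_at[OF in_carrier[OF c]] by (simp add: from_coords_tmap tmap_linear)

lemma tmap_to_coords: "c' \<in> A \<Longrightarrow> p \<in> fst c' \<Longrightarrow> tmap c c' p (to_coords A c p v) = to_coords A c' p v"
  using c chart_at[OF in_carrier[OF c]] by (simp add: to_coords_tmap tmap_comp)

lemma local_rep_chart [simp]: "local_rep A c X (snd c p) = to_coords A c p (X p)"
  using c by (simp add: local_rep_def)

lemma local_endo_chart: "local_endo A c J (snd c p) u = to_coords A c p (J p (from_coords A c p u))"
  using c by (simp add: local_endo_def)

lemma local_endo_to_coords: "local_endo A c J (snd c p) (to_coords A c p u) = to_coords A c p (J p u)"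
  using c by (simp add: local_endo_def)

end

lemma to_coords_self: "p \<in> carrier_of A \<Longrightarrow> to_coords A (chart_at A p) p v = v"
  using chart_at by (simp add: to_coords_tmap tmap_same)

lemma to_coords_inj:
  "c \<in> A \<Longrightarrow> p \<in> fst c \<Longrightarrow> to_coords A c p u = to_coords A c p v \<longleftrightarrow> u = v"
  by (metis from_to)

lemma vector_fields_local: "X \<in> vector_fields A U \<Longrightarrow> c \<in> A \<Longrightarrow> smooth_on (snd c ` (U \<inter> fst c)) (local_rep A c X)"
  by (simp add: vector_fields_def)

lemma local_rep_differentiable:
  "X \<in> vector_fields A U \<Longrightarrow> c \<in> A \<Longrightarrow> p \<in> U \<Longrightarrow> p \<in> fst c \<Longrightarrow> local_rep A c X differentiable at (snd c p)"
  by (rule smooth_on_differentiable[OF vector_fields_local]) auto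

lemma vector_fields_subset: "X \<in> vector_fields A U \<Longrightarrow> V \<subseteq> U \<Longrightarrow> X \<in> vector_fields A V"
  unfolding vector_fields_def
proof (intro CollectI ballI)
  fix c assume "X \<in> {X. \<forall>c\<in>A. smooth_on (snd c ` (U \<inter> fst c)) (local_rep A c X)}" "V \<subseteq> U" "c \<in> A"
  then show "smooth_on (snd c ` (V \<inter> fst c)) (local_rep A c X)"
    by (auto intro: smooth_on_subset[of "snd c ` (U \<inter> fst c)"])
qed

lemma vector_fieldsI:
  assumes "openin (mtop A) U"
    and "\<And>c. c \<in> A \<Longrightarrow> smooth_on (snd c ` (U \<inter> fst c)) (F c)"
    and "\<And>c p. c \<in> A \<Longrightarrow> p \<in> U \<Longrightarrow> p \<in> fst c \<Longrightarrow> to_coords A c p (X p) = F c (snd c p)"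
  shows "X \<in> vector_fields A U"
  unfolding vector_fields_def
proof safe
  fix c assume c: "c \<in> A"
  show "smooth_on (snd c ` (U \<inter> fst c)) (local_rep A c X)"
  proof (subst smooth_on_cong[OF open_image[OF assms(1) c]])
    show "smooth_on (snd c ` (U \<inter> fst c)) (F c)" by (rule assms(2)[OF c])
    show "local_rep A c X x = F c x" if "x \<in> snd c ` (U \<inter> fst c)" for x
      using that assms(3)[OF c] c by auto
  qed
qed

text \<open>In another chart the components are the Jacobian of the transition applied to u,
  evaluated at the point as seen in \<open>c\<close>, hence a smooth composition. Such fields take
  any prescribed value at a point, which turns identities about fields into identities about
  vectors.\<close>

lemma coord_field_in:
  assumes c: "c \<in> A" shows "coord_field A c u \<in> vector_fields A (fst c)"
proof (rule vector_fieldsI[OF openin_chart[OF c]])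
  fix c' assume c': "c' \<in> A"
  let ?S = "snd c' ` (fst c \<inter> fst c')"
  show "smooth_on ?S (\<lambda>x. frechet_derivative (transition c c') (at (transition c' c x)) u)"
  proof (rule smooth_on_compose[where f="\<lambda>y. frechet_derivative (transition c c') (at y) u"])
    show "open ?S" using open_overlap[OF c' c] by (simp add: Int_commute)
    show "open (snd c ` (fst c \<inter> fst c'))" by (rule open_overlap[OF c c'])
    show "smooth_on (snd c ` (fst c \<inter> fst c')) (\<lambda>y. frechet_derivative (transition c c') (at y) u)"
      by (intro smooth_on_frechet smooth_transition c c')
    show "smooth_on ?S (transition c' c)" using smooth_transition[OF c' c] by (simp add: Int_commute)
  qed (use c' in auto)
  fix p assume "p \<in> fst c" "p \<in> fst c'"
  then show "to_coords A c' p (coord_field A c u p) = frechet_derivative (transition c c') (at (transition c' c (snd c' p))) u"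
    using c c' tmap_to_coords[of c p c' "from_coords A c p u"] by (simp add: coord_field_def tmap_def)
qed

lemma local_rep_transition:
  "c \<in> A \<Longrightarrow> c' \<in> A \<Longrightarrow> x \<in> snd c ` (fst c \<inter> fst c') \<Longrightarrow>
    local_rep A c' X (transition c c' x) = frechet_derivative (transition c c') (at x) (local_rep A c X x)"
  using tmap_to_coords by (fastforce simp: tmap_def)

text \<open>The definition evaluates the bracket in \<open>chart_at A p\<close>. Representatives in
  \<open>c\<close> are related to those in that chart by the transition map, so naturality of the
  bracket moves the formula to any chart.\<close>

lemma to_coords_lie_bracket:
  assumes U: "openin (mtop A) U" "X \<in> vector_fields A U" "Y \<in> vector_fields A U" "p \<in> U"
    and c: "c \<in> A" "p \<in> fst c"
  shows "to_coords A c p (lie_bracket A X Y p) = lie_euc (local_rep A c X) (local_rep A c Y) (snd c p)"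
proof -
  define c0 where "c0 = chart_at A p"
  have c0: "c0 \<in> A" "p \<in> fst c0" using chart_at[OF in_carrier[OF c]] by (simp_all add: c0_def)
  have br: "lie_bracket A X Y p = lie_euc (local_rep A c0 X) (local_rep A c0 Y) (snd c0 p)"
    using c0 to_coords_self[OF in_carrier[OF c]] by (simp add: lie_bracket_def lie_euc_def Let_def flip: c0_def)
  have tr: "transition c0 c (snd c0 p) = snd c p" using c0 by simp
  have "lie_euc (local_rep A c X) (local_rep A c Y) (transition c0 c (snd c0 p))
    = frechet_derivative (transition c0 c) (at (snd c0 p)) (lie_euc (local_rep A c0 X) (local_rep A c0 Y) (snd c0 p))"
    by (rule lie_euc_related[OF open_overlap[OF c0(1) c(1)] _ smooth_transition[OF c0(1) c(1)]])
       (use c c0 U local_rep_transition in \<open>auto intro: local_rep_differentiable simp: tr\<close>)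
  then show ?thesis by (simp add: tr br to_coords_tmap tmap_def flip: c0_def)
qed

text \<open>The curvature feeds the bracket into the connection, whose axioms speak only of smooth
  fields.\<close>

lemma lie_bracket_in:
  assumes U: "openin (mtop A) U" "X \<in> vector_fields A U" "Y \<in> vector_fields A U"
  shows "lie_bracket A X Y \<in> vector_fields A U"
proof (rule vector_fieldsI[OF U(1)])
  fix c assume c: "c \<in> A"
  let ?S = "snd c ` (U \<inter> fst c)"
  have S: "open ?S" by (rule open_image[OF U(1) c])
  note X = vector_fields_local[OF U(2) c] and Y = vector_fields_local[OF U(3) c]
  have "smooth_on ?S (\<lambda>x. frechet_derivative V (at x) (W x))" if V: "smooth_on ?S V" and W: "smooth_on ?S W" for V W :: "'e \<Rightarrow> 'e"
    by (rule smooth_on_field[OF S has_derivative_linear[OF smooth_on_has_derivative[OF V]] smooth_on_frechet[OF V] W])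
  from smooth_on_diff[OF S this[OF Y X] this[OF X Y]]
  show "smooth_on ?S (lie_euc (local_rep A c X) (local_rep A c Y))"
    by (simp add: lie_euc_def[abs_def])
qed (use to_coords_lie_bracket U in auto)

lemma almost_complex_structureI:
  assumes lin: "\<And>p. p \<in> carrier_of A \<Longrightarrow> linear (K p)" and sq: "\<And>p v. p \<in> carrier_of A \<Longrightarrow> K p (K p v) = - v"
    and smooth: "\<And>c u. c \<in> A \<Longrightarrow> smooth_on (snd c ` fst c) (\<lambda>x. local_endo A c K x u)"
  shows "almost_complex_structure A K"
  unfolding almost_complex_structure_def
proof (intro conjI ballI allI impI)
  fix U X assume "openin (mtop A) U \<and> X \<in> vector_fields A U"
  then have U: "openin (mtop A) U" and X: "X \<in> vector_fields A U" by auto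
  show "endo_app K X \<in> vector_fields A U"
  proof (rule vector_fieldsI[OF U])
    fix c assume c: "c \<in> A"
    show "smooth_on (snd c ` (U \<inter> fst c)) (\<lambda>x. local_endo A c K x (local_rep A c X x))"
    proof (rule smooth_on_field[OF open_image[OF U c] _ _ vector_fields_local[OF X c]])
      fix x assume "x \<in> snd c ` (U \<inter> fst c)"
      then obtain p where "p \<in> fst c" "x = snd c p" by auto
      then show "linear (local_endo A c K x)"
        using linear_compose[OF linear_compose[OF linear_from_coords lin] linear_to_coords, of c p] c
          in_carrier by (simp add: local_endo_def[abs_def] o_def)
    next
      show "smooth_on (snd c ` (U \<inter> fst c)) (\<lambda>x. local_endo A c K x u)" for u
        by (rule smooth_on_subset[OF smooth[OF c]]) auto
    qed
    fix p assume "p \<in> U" "p \<in> fst c"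
    then show "to_coords A c p (endo_app K X p) = local_endo A c K (snd c p) (local_rep A c X (snd c p))"
      using c by (simp add: local_endo_to_coords endo_app_def)
  qed
qed (use lin sq in auto)

end

locale almost_complex = atlas A for A :: "('m, 'e::euclidean_space) chart set" +
  fixes J :: "'m \<Rightarrow> 'e \<Rightarrow> 'e"
  assumes acs: "almost_complex_structure A J"
begin

lemma linear_J: "p \<in> carrier_of A \<Longrightarrow> linear (J p)" and J_J: "p \<in> carrier_of A \<Longrightarrow> J p (J p v) = - v"
  using acs by (auto simp: almost_complex_structure_def)

lemma endo_app_in: "openin (mtop A) U \<Longrightarrow> X \<in> vector_fields A U \<Longrightarrow> endo_app J X \<in> vector_fields A U"
  using acs by (auto simp: almost_complex_structure_def)

lemma linear_local_endo:
  assumes c: "c \<in> A" and x: "x \<in> snd c ` fst c" shows "linear (local_endo A c J x)"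
proof -
  obtain p where p: "p \<in> fst c" "x = snd c p" using x by auto
  show ?thesis
    using linear_compose[OF linear_compose[OF linear_from_coords[OF c p(1)] linear_J] linear_to_coords[OF c p(1)], of p]
    by (simp add: local_endo_def[abs_def] o_def in_carrier[OF c p(1)] p c)
qed

lemma local_endo_sq: "c \<in> A \<Longrightarrow> x \<in> snd c ` fst c \<Longrightarrow> local_endo A c J x (local_endo A c J x u) = - u"
  by (auto simp: local_endo_chart J_J in_carrier linear_neg[OF linear_to_coords])

lemma smooth_local_endo: assumes c: "c \<in> A" shows "smooth_on (snd c ` fst c) (\<lambda>x. local_endo A c J x u)"
proof (subst smooth_on_cong[OF open_chart[OF c]])
  show "smooth_on (snd c ` fst c) (local_rep A c (endo_app J (coord_field A c u)))"
    using vector_fields_local[OF endo_app_in[OF openin_chart[OF c] coord_field_in[OF c]] c] by simp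
qed (use c in \<open>auto simp: local_endo_chart endo_app_def coord_field_def\<close>)

lemma local_rep_endo_app:
  "c \<in> A \<Longrightarrow> x \<in> snd c ` fst c \<Longrightarrow> local_rep A c (endo_app J X) x = local_endo A c J x (local_rep A c X x)"
  by (auto simp: local_endo_to_coords endo_app_def)

lemma to_coords_nijenhuis:
  assumes U: "openin (mtop A) U" "X \<in> vector_fields A U" "Y \<in> vector_fields A U" "p \<in> U"
    and c: "c \<in> A" "p \<in> fst c"
  shows "to_coords A c p (nijenhuis A J X Y p)
    = nijenhuis_euc (local_endo A c J) (snd c p) (to_coords A c p (X p)) (to_coords A c p (Y p))"
proof -
  let ?K = "local_endo A c J" and ?X = "local_rep A c X" and ?Y = "local_rep A c Y"
  have x: "snd c p \<in> snd c ` fst c" using c by simp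
  note l = linear_to_coords[OF c] and O = open_chart[OF c(1)]
  note JX = endo_app_in[OF U(1,2)] and JY = endo_app_in[OF U(1,3)]
  have "to_coords A c p (nijenhuis A J X Y p)
      = lie_euc ?X ?Y (snd c p) + ?K (snd c p) (lie_euc (\<lambda>y. ?K y (?X y)) ?Y (snd c p) + lie_euc ?X (\<lambda>y. ?K y (?Y y)) (snd c p))
      - lie_euc (\<lambda>y. ?K y (?X y)) (\<lambda>y. ?K y (?Y y)) (snd c p)"
    unfolding nijenhuis_def linear_add[OF l] linear_diff[OF l]
      local_endo_to_coords[OF c, of J, symmetric]
      to_coords_lie_bracket[OF U c] to_coords_lie_bracket[OF U(1) JX U(3,4) c]
      to_coords_lie_bracket[OF U(1,2) JY U(4) c] to_coords_lie_bracket[OF U(1) JX JY U(4) c]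
    using local_rep_endo_app[OF c(1)]
    by (simp add: lie_euc_cong[OF O x, of "local_rep A c (endo_app J X)" "\<lambda>y. ?K y (?X y)" ?Y ?Y]
        lie_euc_cong[OF O x, of ?X ?X "local_rep A c (endo_app J Y)" "\<lambda>y. ?K y (?Y y)"]
        lie_euc_cong[OF O x, of "local_rep A c (endo_app J X)" "\<lambda>y. ?K y (?X y)" "local_rep A c (endo_app J Y)" "\<lambda>y. ?K y (?Y y)"])
  also have "\<dots> = nijenhuis_euc ?K (snd c p) (?X (snd c p)) (?Y (snd c p))"
    by (rule nijenhuis_euc_fields[OF O x linear_local_endo[OF c(1)] local_endo_sq[OF c(1) x]
          smooth_on_differentiable[OF smooth_local_endo[OF c(1)] x]])
       (use c U local_rep_differentiable in auto)
  finally show ?thesis using c by simp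
qed

text \<open>Coordinate fields realise every pair of vectors at every point of a chart, and the chart
  expression of the tensor sees only these values.\<close>

lemma integrable_iff_nijenhuis_euc:
  "integrable_structure A J \<longleftrightarrow> (\<forall>c\<in>A. \<forall>x\<in>snd c ` fst c. \<forall>u v. nijenhuis_euc (local_endo A c J) x u v = 0)"
  (is "?L \<longleftrightarrow> ?R")
proof
  assume ?L
  then have N: "nijenhuis A J X Y p = 0" if "openin (mtop A) U" "X \<in> vector_fields A U" "Y \<in> vector_fields A U" "p \<in> U" for U X Y p
    using that by (auto simp: integrable_structure_def)
  show ?R
  proof (intro ballI allI)
    fix c x u v assume c: "c \<in> A" and "x \<in> snd c ` fst c"
    then obtain p where p: "p \<in> fst c" "x = snd c p" by auto
    note f = openin_chart[OF c] coord_field_in[OF c, of u] coord_field_in[OF c, of v] p(1)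
    show "nijenhuis_euc (local_endo A c J) x u v = 0"
      using to_coords_nijenhuis[OF f c p(1)] c p N[OF f] linear_0[OF linear_to_coords[OF c p(1)]]
      by (simp add: coord_field_def)
  qed
next
  assume R: ?R
  show ?L unfolding integrable_structure_def
  proof (intro conjI acs allI impI, elim conjE)
    fix U X Y p assume U: "openin (mtop A) U" "X \<in> vector_fields A U" "Y \<in> vector_fields A U" "p \<in> U"
    obtain c where c: "c \<in> A" "p \<in> fst c" using obtain_chart[OF U(1,4)] .
    then have "to_coords A c p (nijenhuis A J X Y p) = to_coords A c p 0"
      using R to_coords_nijenhuis[OF U c] linear_0[OF linear_to_coords[OF c]] by auto
    then show "nijenhuis A J X Y p = 0" using to_coords_inj[OF c] by blast
  qed
qed

end

section \<open>Horizontal and vertical fields over an open set, their brackets, and the Nijenhuis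
  tensor of the lift\<close>

section \<open>The lifted structure in coordinates\<close>

text \<open>The vector representing a functional in the inner product of the model space. This is
  how \<open>cotangent_chart\<close> lists momenta, so fibre coordinates can be handled as
  vectors.\<close>

definition riesz :: "('e::euclidean_space \<Rightarrow> real) \<Rightarrow> 'e" where
  "riesz f = (\<Sum>b\<in>Basis. f b *\<^sub>R b)"

lemma riesz_inner: assumes "linear f" shows "riesz f \<bullet> u = f u"
proof -
  have "riesz f \<bullet> u = (\<Sum>b\<in>Basis. f b * (b \<bullet> u))" by (simp add: riesz_def inner_sum_left)
  also have "\<dots> = f u" by (subst linear_Basis_expansion[OF assms, of u]) (simp add: inner_commute mult.commute)
  finally show ?thesis .
qed

lemma riesz_eqI: assumes "linear f" "\<And>u. f u = v \<bullet> u" shows "riesz f = v"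
  by (metis assms riesz_inner vector_eq_rdot)

lemma inner_linear_eqI: "(\<And>u. v \<bullet> u = w \<bullet> u) \<Longrightarrow> v = (w :: 'a::real_inner)"
  by (metis vector_eq_rdot)

lemma nijenhuis_euc_antisym: "linear (K x) \<Longrightarrow> nijenhuis_euc K x v u = - nijenhuis_euc K x u v"
  by (simp add: nijenhuis_euc_def linear_diff)

lemma nijenhuis_euc_add_right:
  assumes S: "open S" "x \<in> S" and lin: "\<And>y. y \<in> S \<Longrightarrow> linear (K y)" and diff: "\<And>u. (\<lambda>y. K y u) differentiable at x"
  shows "nijenhuis_euc K x u (v + w) = nijenhuis_euc K x u v + nijenhuis_euc K x u w"
proof -
  have a: "linear (\<lambda>h. field_deriv K x h u)" "linear (field_deriv K x h)" for h u
    by (rule linear_field_deriv[OF S lin diff]; assumption)+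
  show ?thesis using lin[OF S(2)]
    by (simp add: nijenhuis_euc_def linear_add[OF a(1)] linear_add[OF a(2)] linear_diff linear_add)
qed

definition hor_part :: "('e::euclidean_space \<Rightarrow> 'e \<Rightarrow> 'e \<Rightarrow> 'e) \<Rightarrow> 'e \<times> 'e \<Rightarrow> 'e \<Rightarrow> 'e" where
  "hor_part \<Gamma> z v = riesz (\<lambda>u. snd z \<bullet> \<Gamma> (fst z) v u)"

text \<open>On the cotangent bundle with coordinates \<open>z = (x, y)\<close>, the horizontal lift of \<open>v\<close> is \<open>(v, hor_part \<Gamma> z v)\<close>,
  since a section \<open>y\<close> is parallel in direction \<open>v\<close> iff \<open>dy(v) \<bullet> u = y \<bullet> \<Gamma>(v, u)\<close> for all \<open>u\<close>.\<close>
definition lifted_endo ::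
  "('e::euclidean_space \<Rightarrow> 'e \<Rightarrow> 'e) \<Rightarrow> ('e \<Rightarrow> 'e \<Rightarrow> 'e \<Rightarrow> 'e) \<Rightarrow> real \<Rightarrow> 'e \<times> 'e \<Rightarrow> 'e \<times> 'e \<Rightarrow> 'e \<times> 'e" where
  "lifted_endo J \<Gamma> \<sigma> z q = (J (fst z) (fst q), hor_part \<Gamma> z (J (fst z) (fst q))
     + \<sigma> *\<^sub>R riesz (\<lambda>u. (snd q - hor_part \<Gamma> z (fst q)) \<bullet> J (fst z) u))"

definition d_christoffel :: "('e::euclidean_space \<Rightarrow> 'e \<Rightarrow> 'e \<Rightarrow> 'e) \<Rightarrow> 'e \<Rightarrow> 'e \<Rightarrow> 'e \<Rightarrow> 'e \<Rightarrow> 'e" where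
  "d_christoffel \<Gamma> x h u v = frechet_derivative (\<lambda>x. \<Gamma> x u v) (at x) h"

text \<open>The flat derivative of J along u plus the commutator [\<Gamma>(u), J].\<close>

definition nabla_endo_euc :: "('e::euclidean_space \<Rightarrow> 'e \<Rightarrow> 'e) \<Rightarrow> ('e \<Rightarrow> 'e \<Rightarrow> 'e \<Rightarrow> 'e) \<Rightarrow> 'e \<Rightarrow> 'e \<Rightarrow> 'e \<Rightarrow> 'e" where
  "nabla_endo_euc J \<Gamma> x u v = field_deriv J x u v + \<Gamma> x u (J x v) - J x (\<Gamma> x u v)"

text \<open>The value of - D_u D_v + D_v D_u on constant fields, whose bracket vanishes.\<close>

definition curvature_euc :: "('e::euclidean_space \<Rightarrow> 'e \<Rightarrow> 'e \<Rightarrow> 'e) \<Rightarrow> 'e \<Rightarrow> 'e \<Rightarrow> 'e \<Rightarrow> 'e \<Rightarrow> 'e" where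
  "curvature_euc \<Gamma> x u v w = d_christoffel \<Gamma> x v u w + \<Gamma> x v (\<Gamma> x u w)
     - d_christoffel \<Gamma> x u v w - \<Gamma> x u (\<Gamma> x v w)"

lemma smooth_on_fst:
  fixes f :: "'a::euclidean_space \<Rightarrow> 'c::real_normed_vector"
  assumes "open S" "smooth_on S f" shows "smooth_on (S \<times> (UNIV :: 'b::euclidean_space set)) (\<lambda>z. f (fst z))"
proof (rule smooth_on_compose[OF _ assms(1,2)])
  show o: "open (S \<times> (UNIV :: 'b set))" using assms by (intro open_Times) auto
  show "smooth_on (S \<times> (UNIV :: 'b set)) fst"
    using smooth_on_bounded_linear[OF o bounded_linear_fst smooth_on_ident[OF o]] by simp
qed auto

lemma smooth_on_snd: "open S \<Longrightarrow> smooth_on S (snd :: 'a::euclidean_space \<times> 'b::euclidean_space \<Rightarrow> 'b)"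
  using smooth_on_bounded_linear[OF _ bounded_linear_snd smooth_on_ident] by blast

locale connection_euc =
  fixes S :: "'e::euclidean_space set" and \<Gamma> :: "'e \<Rightarrow> 'e \<Rightarrow> 'e \<Rightarrow> 'e"
  assumes open_S: "open S"
    and linear_G1: "\<And>x v. x \<in> S \<Longrightarrow> linear (\<lambda>u. \<Gamma> x u v)"
    and linear_G2: "\<And>x u. x \<in> S \<Longrightarrow> linear (\<Gamma> x u)"
    and smooth_G: "\<And>u v. smooth_on S (\<lambda>x. \<Gamma> x u v)"
begin

lemma dG_linear:
  assumes x: "x \<in> S"
  shows "linear (\<lambda>h. d_christoffel \<Gamma> x h u v)" "linear (\<lambda>u. d_christoffel \<Gamma> x h u v)" "linear (d_christoffel \<Gamma> x h u)"
proof -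
  note d = smooth_on_differentiable[OF smooth_G x]
  show "linear (\<lambda>h. d_christoffel \<Gamma> x h u v)" "linear (\<lambda>u. d_christoffel \<Gamma> x h u v)"
    using linear_field_deriv[where L="\<lambda>x u. \<Gamma> x u v", OF open_S x linear_G1 d, simplified]
    by (simp_all add: field_deriv_def[abs_def] d_christoffel_def)
  show "linear (d_christoffel \<Gamma> x h u)"
    using linear_field_deriv(2)[where L="\<lambda>x. \<Gamma> x u", OF open_S x linear_G2 d, simplified]
    by (simp add: field_deriv_def[abs_def] d_christoffel_def[abs_def])
qed

lemma open_T: "open (S \<times> (UNIV :: 'e set))"
  using open_S by (intro open_Times) auto

lemma linear_curvature_euc: "x \<in> S \<Longrightarrow> linear (curvature_euc \<Gamma> x u v)"
  by (rule linearI) (simp_all add: curvature_euc_def linear_add[OF linear_G2] linear_cmul[OF linear_G2]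
    linear_add[OF dG_linear(3)] linear_cmul[OF dG_linear(3)] algebra_simps)

lemma hor_part_inner: "fst z \<in> S \<Longrightarrow> hor_part \<Gamma> z v \<bullet> u = snd z \<bullet> \<Gamma> (fst z) v u"
  unfolding hor_part_def using linear_G2[of "fst z" v]
  by (subst riesz_inner) (auto intro!: linearI simp: linear_add linear_cmul inner_add_right)

lemma linear_hor_part: "fst z \<in> S \<Longrightarrow> linear (hor_part \<Gamma> z)"
  by (rule linearI; rule inner_linear_eqI)
    (simp_all add: hor_part_inner inner_add_left inner_add_right linear_add[OF linear_G1] linear_cmul[OF linear_G1])

lemma smooth_hor_part: "smooth_on (S \<times> UNIV) (\<lambda>z. hor_part \<Gamma> z v)"
  unfolding hor_part_def riesz_def
  by (rule smooth_on_sum[OF open_T] smooth_on_scaleR[OF open_T] smooth_on_const smooth_on_inner[OF open_T]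
      smooth_on_snd[OF open_T] smooth_on_fst[OF open_S smooth_G])+

text \<open>\<open>hor_part\<close> is linear in the momentum and depends on the base point through
  \<Gamma> alone, so a displacement in the fibre gives the first term and one in the base the
  second.\<close>

lemma field_deriv_hor_part:
  assumes z: "fst z \<in> S"
  shows "field_deriv (hor_part \<Gamma>) z h v \<bullet> e = snd h \<bullet> \<Gamma> (fst z) v e + snd z \<bullet> d_christoffel \<Gamma> (fst z) (fst h) v e"
proof -
  have "((\<lambda>w. \<Gamma> (fst w) v b) has_derivative (\<lambda>h. d_christoffel \<Gamma> (fst z) (fst h) v b)) (at z)" for b
    unfolding d_christoffel_def
    by (rule has_derivative_compose[OF has_derivative_fst[OF has_derivative_ident] smooth_on_has_derivative[OF smooth_G z]])
  then have "((\<lambda>w. hor_part \<Gamma> w v) has_derivative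
      (\<lambda>h. \<Sum>b\<in>Basis. (snd z \<bullet> d_christoffel \<Gamma> (fst z) (fst h) v b + snd h \<bullet> \<Gamma> (fst z) v b) *\<^sub>R b)) (at z)"
    unfolding hor_part_def riesz_def
    by (intro has_derivative_sum has_derivative_scaleR_left has_derivative_inner has_derivative_snd has_derivative_ident)
  then have "field_deriv (hor_part \<Gamma>) z h v = riesz (\<lambda>b. snd z \<bullet> d_christoffel \<Gamma> (fst z) (fst h) v b + snd h \<bullet> \<Gamma> (fst z) v b)"
    by (simp add: field_deriv_def frechet_eq riesz_def)
  moreover have "linear (\<lambda>b. snd z \<bullet> d_christoffel \<Gamma> (fst z) (fst h) v b + snd h \<bullet> \<Gamma> (fst z) v b)"
    using linear_G2[OF z, of v] dG_linear(3)[OF z, of "fst h" v]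
    by (auto intro!: linearI simp: linear_add linear_cmul inner_add_right algebra_simps)
  ultimately show ?thesis by (simp add: riesz_inner)
qed

text \<open>The argument is a field, not a vector: the lifted structure sends the lift of a constant
  u to the lift of the nonconstant field x |-> J x u.\<close>

definition H :: "('e \<Rightarrow> 'e) \<Rightarrow> 'e \<times> 'e \<Rightarrow> 'e \<times> 'e" where
  "H u z = (u (fst z), hor_part \<Gamma> z (u (fst z)))"

definition V :: "('e \<Rightarrow> 'e) \<Rightarrow> 'e \<times> 'e \<Rightarrow> 'e \<times> 'e" where
  "V a z = (0, a (fst z))"

lemma H_deriv:
  assumes z: "fst z \<in> S" and u: "(u has_derivative u') (at (fst z))"
  shows "(H u has_derivative (\<lambda>h. (u' (fst h), field_deriv (hor_part \<Gamma>) z h (u (fst z)) + hor_part \<Gamma> z (u' (fst h))))) (at z)"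
proof -
  have zT: "z \<in> S \<times> UNIV" using z by (cases z) auto
  have u1: "((\<lambda>z. u (fst z)) has_derivative (\<lambda>h. u' (fst h))) (at z)"
    by (rule has_derivative_compose[OF has_derivative_fst[OF has_derivative_ident] u])
  show ?thesis unfolding H_def[abs_def]
    by (intro has_derivative_Pair u1 has_derivative_field[where L="hor_part \<Gamma>", OF open_T zT _ _ u1])
      (use linear_hor_part smooth_on_differentiable[OF smooth_hor_part zT] in auto)
qed

lemma V_deriv:
  assumes a: "(a has_derivative a') (at (fst z))"
  shows "(V a has_derivative (\<lambda>h. (0, a' (fst h)))) (at z)"
  unfolding V_def[abs_def]
  by (intro has_derivative_Pair has_derivative_const has_derivative_compose[OF has_derivative_fst[OF has_derivative_ident] a])

text \<open>Transposition reverses products: the derivative of \<open>hor_part\<close> along the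
  lift of u pairs y with \<Gamma>(u) \<Gamma>(v) e, the one along the lift of v with \<Gamma>(v)
  \<Gamma>(u) e. With the derivatives of \<Gamma> they form minus the curvature, while the
  derivatives of u and v assemble to the lift of the bracket.\<close>

lemma lie_H_H:
  assumes z: "fst z \<in> S" and u: "u differentiable at (fst z)" and v: "v differentiable at (fst z)"
  defines "x \<equiv> fst z"
  shows "lie_euc (H u) (H v) z = (lie_euc u v x,
    hor_part \<Gamma> z (lie_euc u v x) - riesz (\<lambda>e. snd z \<bullet> curvature_euc \<Gamma> x (u x) (v x) e))"
proof -
  note du = differentiable_has_frechet[OF u] and dv = differentiable_has_frechet[OF v]
  have lin: "linear (\<lambda>e. snd z \<bullet> curvature_euc \<Gamma> x (u x) (v x) e)"
    using linear_curvature_euc[OF z] unfolding x_def by (auto intro!: linearI simp: linear_add linear_cmul inner_add_right)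
  have x: "x \<in> S" using z by (simp add: x_def)
  show ?thesis
    unfolding lie_euc_eq[OF H_deriv[OF z du] H_deriv[OF z dv]] lie_euc_eq[OF du dv] x_def[symmetric]
    by (rule prod_eqI; (rule inner_linear_eqI)?)
      (simp_all add: H_def field_deriv_hor_part[OF z] hor_part_inner[OF z] lie_euc_def
      inner_diff_left inner_add_left riesz_inner[OF lin] flip: x_def,
       simp add: linear_diff[OF linear_G1[OF x]] curvature_euc_def inner_diff_right inner_add_right)
qed

text \<open>Moving vertically by a changes \<open>hor_part\<close> by the transpose of \<Gamma>(u)
  applied to a; subtracted from the derivative of a, this is the dual connection. The base component
  vanishes because u does not change along the fibre.\<close>

lemma lie_H_V:
  assumes z: "fst z \<in> S" and u: "u differentiable at (fst z)" and a: "(a has_derivative a') (at (fst z))"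
  defines "x \<equiv> fst z"
  shows "lie_euc (H u) (V a) z = (0, a' (u x) - riesz (\<lambda>e. a x \<bullet> \<Gamma> x (u x) e))"
proof -
  note du = differentiable_has_frechet[OF u]
  have lin: "linear (\<lambda>e. a x \<bullet> \<Gamma> x (u x) e)"
    using linear_G2[OF z] unfolding x_def by (auto intro!: linearI simp: linear_add linear_cmul inner_add_right)
  have x: "x \<in> S" using z by (simp add: x_def)
  have l0: "frechet_derivative u (at x) 0 = 0"
    using du has_derivative_linear linear_0 unfolding x_def by blast
  show ?thesis
    unfolding lie_euc_eq[OF H_deriv[OF z du] V_deriv[where z=z, OF a]] x_def[symmetric]
    by (rule prod_eqI; (rule inner_linear_eqI)?)
      (simp_all add: V_def H_def l0 linear_0[OF linear_hor_part[OF z]] field_deriv_hor_part[OF z]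
       inner_diff_left riesz_inner[OF lin] linear_0[OF dG_linear(1)[OF x]] flip: x_def)
qed

text \<open>The coefficients depend on the base point only, and a vertical direction does not move
  it.\<close>

lemma lie_V_V:
  assumes a: "a differentiable at (fst z)" and b: "b differentiable at (fst z)"
  shows "lie_euc (V a) (V b) z = 0"
proof -
  note da = differentiable_has_frechet[OF a] and db = differentiable_has_frechet[OF b]
  have "linear (frechet_derivative a (at (fst z)))" "linear (frechet_derivative b (at (fst z)))"
    using da db has_derivative_linear by blast+
  then show ?thesis
    unfolding lie_euc_eq[OF V_deriv[where z=z, OF da] V_deriv[where z=z, OF db]]
    by (simp add: V_def linear_0)
qed

end

locale complex_connection_euc = connection_euc S \<Gamma>
  for S :: "'e::euclidean_space set" and \<Gamma> +
  fixes J :: "'e \<Rightarrow> 'e \<Rightarrow> 'e" and \<sigma> :: real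
  assumes linear_J: "\<And>x. x \<in> S \<Longrightarrow> linear (J x)"
    and J_J: "\<And>x v. x \<in> S \<Longrightarrow> J x (J x v) = - v"
    and smooth_J: "\<And>u. smooth_on S (\<lambda>x. J x u)"
    and sigma: "\<sigma> * \<sigma> = 1"
begin

abbreviation "K \<equiv> lifted_endo J \<Gamma> \<sigma>"

definition J_transp :: "'e \<Rightarrow> 'e \<Rightarrow> 'e" where
  "J_transp x a = riesz (\<lambda>u. a \<bullet> J x u)"

lemma linear_inner_right_comp: "linear f \<Longrightarrow> linear (\<lambda>e. a \<bullet> f e)"
  by (auto intro!: linearI simp: linear_add linear_cmul inner_add_right)

lemma J_transp_inner: "x \<in> S \<Longrightarrow> J_transp x a \<bullet> u = a \<bullet> J x u"
  unfolding J_transp_def by (rule riesz_inner[OF linear_inner_right_comp[OF linear_J]])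

lemma linear_J_transp: "x \<in> S \<Longrightarrow> linear (J_transp x)"
  by (rule linearI; rule inner_linear_eqI) (simp_all add: J_transp_inner inner_add_left)

lemma J_transp_J_transp: "x \<in> S \<Longrightarrow> J_transp x (J_transp x a) = - a"
  by (rule inner_linear_eqI) (simp add: J_transp_inner J_J)

lemma smooth_J_transp: "smooth_on S (\<lambda>x. J_transp x a)"
  unfolding J_transp_def riesz_def
  by (rule smooth_on_sum[OF open_S] smooth_on_scaleR[OF open_S] smooth_on_const smooth_on_inner[OF open_S] smooth_J)+

lemma K_eq: "K z q = (J (fst z) (fst q), hor_part \<Gamma> z (J (fst z) (fst q)) + \<sigma> *\<^sub>R J_transp (fst z) (snd q - hor_part \<Gamma> z (fst q)))"
  by (simp add: lifted_endo_def J_transp_def)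

lemma linear_K: "z \<in> S \<times> UNIV \<Longrightarrow> linear (K z)"
  using linear_J[of "fst z"] linear_hor_part[of z] linear_J_transp[of "fst z"]
  by (intro linearI) (auto simp: K_eq linear_add linear_cmul linear_diff algebra_simps mem_Times_iff)

lemma K_K: "z \<in> S \<times> UNIV \<Longrightarrow> K z (K z q) = - q"
  using linear_hor_part[of z] sigma
  by (auto simp: K_eq J_J linear_neg linear_cmul[OF linear_J_transp] J_transp_J_transp mem_Times_iff prod_eq_iff)

lemma smooth_K: "smooth_on (S \<times> UNIV) (\<lambda>z. K z q)"
proof -
  note T = open_T
  have J: "smooth_on (S \<times> (UNIV :: 'e set)) (\<lambda>z. J (fst z) (fst q))" by (rule smooth_on_fst[OF open_S smooth_J])
  have JT: "smooth_on (S \<times> (UNIV :: 'e set)) (\<lambda>z. J_transp (fst z) a)" for a by (rule smooth_on_fst[OF open_S smooth_J_transp])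
  have h: "smooth_on (S \<times> (UNIV :: 'e set)) (\<lambda>z. hor_part \<Gamma> z (J (fst z) (fst q)))"
    by (rule smooth_on_field[OF T _ smooth_hor_part J]) (auto intro: linear_hor_part)
  have "smooth_on (S \<times> (UNIV :: 'e set)) (\<lambda>z. J_transp (fst z) (snd q - hor_part \<Gamma> z (fst q)))"
    by (rule smooth_on_field[OF T _ JT smooth_on_diff[OF T smooth_on_const smooth_hor_part]]) (auto intro: linear_J_transp)
  then show ?thesis unfolding K_eq
    by (intro smooth_on_Pair[OF T J] smooth_on_add[OF T h] smooth_on_bounded_linear[OF T bounded_linear_scaleR_right])
qed

lemma K_H: "fst z \<in> S \<Longrightarrow> K z (H u z) = H (\<lambda>x. J x (u x)) z"
  by (simp add: K_eq H_def linear_0[OF linear_J_transp])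

lemma K_V: "fst z \<in> S \<Longrightarrow> K z (V a z) = V (\<lambda>x. \<sigma> *\<^sub>R J_transp x (a x)) z"
  by (simp add: K_eq V_def linear_0[OF linear_J] linear_0[OF linear_hor_part])

lemma K_pair: "fst z \<in> S \<Longrightarrow> K z (v, hor_part \<Gamma> z v + w) = (J (fst z) v, hor_part \<Gamma> z (J (fst z) v) + \<sigma> *\<^sub>R J_transp (fst z) w)"
  by (simp add: K_eq)

lemma J_differentiable: "x \<in> S \<Longrightarrow> (\<lambda>x. J x u) differentiable at x"
  by (rule smooth_on_differentiable[OF smooth_J])

lemma linear_dJ: "x \<in> S \<Longrightarrow> linear (field_deriv J x h)"
  by (rule linear_field_deriv(2)[OF open_S _ linear_J J_differentiable])

text \<open>The images under K are replaced by known fields on the whole open set, not just at z,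
  since the brackets differentiate them.\<close>

lemma nijenhuis_K_fields:
  assumes z: "z \<in> S \<times> UNIV" and X: "X differentiable at z" and Y: "Y differentiable at z"
    and KX: "\<And>w. w \<in> S \<times> UNIV \<Longrightarrow> K w (X w) = X' w" and KY: "\<And>w. w \<in> S \<times> UNIV \<Longrightarrow> K w (Y w) = Y' w"
  shows "nijenhuis_euc K z (X z) (Y z) = lie_euc X Y z + K z (lie_euc X' Y z + lie_euc X Y' z) - lie_euc X' Y' z"
proof -
  have "nijenhuis_euc K z (X z) (Y z) = lie_euc X Y z + K z (lie_euc (\<lambda>y. K y (X y)) Y z + lie_euc X (\<lambda>y. K y (Y y)) z)
      - lie_euc (\<lambda>y. K y (X y)) (\<lambda>y. K y (Y y)) z"
    by (rule nijenhuis_euc_fields[symmetric, OF open_T z linear_K K_K[OF z] smooth_on_differentiable[OF smooth_K z] X Y])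
  then show ?thesis
  by (simp add: lie_euc_cong[OF open_T z, of "\<lambda>y. K y (X y)" X' Y Y] KX KY
     lie_euc_cong[OF open_T z, of "\<lambda>y. K y (X y)" X' "\<lambda>y. K y (Y y)" Y'] lie_euc_cong[OF open_T z, of X X "\<lambda>y. K y (Y y)" Y'])
qed

lemma H_differentiable: "fst z \<in> S \<Longrightarrow> u differentiable at (fst z) \<Longrightarrow> H u differentiable at z"
  using H_deriv differentiable_has_frechet differentiable_def by blast

lemma V_differentiable: "a differentiable at (fst z) \<Longrightarrow> V a differentiable at z"
  using V_deriv differentiable_has_frechet differentiable_def by blast

lemma nijenhuis_V_V:
  assumes z: "z \<in> S \<times> UNIV" shows "nijenhuis_euc K z (0, a) (0, b) = 0"
proof -
  have x: "fst z \<in> S" using z by auto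
  have d: "(\<lambda>x. \<sigma> *\<^sub>R J_transp x a) differentiable at (fst z)" for a
    using smooth_on_differentiable[OF smooth_J_transp x] by simp
  have K: "K w (V (\<lambda>_. a) w) = V (\<lambda>x. \<sigma> *\<^sub>R J_transp x a) w" if "w \<in> S \<times> UNIV" for a w
    using K_V that by auto
  have "nijenhuis_euc K z (V (\<lambda>_. a) z) (V (\<lambda>_. b) z) = 0"
    using nijenhuis_K_fields[OF z V_differentiable V_differentiable K K, of a b]
    by (simp add: linear_0[OF linear_K[OF z]] lie_V_V d)
  then show ?thesis by (simp add: V_def)
qed

lemma nijenhuis_H_H:
  assumes z: "z \<in> S \<times> UNIV" defines "x \<equiv> fst z"
  shows "nijenhuis_euc K z (u, hor_part \<Gamma> z u) (v, hor_part \<Gamma> z v)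
    = (nijenhuis_euc J x u v, hor_part \<Gamma> z (nijenhuis_euc J x u v)
       - riesz (\<lambda>e. snd z \<bullet> (curvature_euc \<Gamma> x u v e - curvature_euc \<Gamma> x (J x u) (J x v) e
           + \<sigma> *\<^sub>R (curvature_euc \<Gamma> x (J x u) v (J x e) + curvature_euc \<Gamma> x u (J x v) (J x e)))))"
proof -
  have x: "x \<in> S" "fst z \<in> S" using z by (auto simp: x_def)
  have K: "K w (H (\<lambda>_. a) w) = H (\<lambda>x. J x a) w" if "w \<in> S \<times> UNIV" for a w
    using K_H that by auto
  let ?l = "\<lambda>u v. lie_euc u v x"
  have N: "nijenhuis_euc J x u v = ?l (\<lambda>_. u) (\<lambda>_. v) + J x (?l (\<lambda>x. J x u) (\<lambda>_. v) + ?l (\<lambda>_. u) (\<lambda>x. J x v)) - ?l (\<lambda>x. J x u) (\<lambda>x. J x v)"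
    using nijenhuis_euc_fields[where K=J and X="\<lambda>_. u" and Y="\<lambda>_. v", OF open_S x(1) linear_J J_J[OF x(1)] J_differentiable[OF x(1)]]
    by simp
  note dJ = J_differentiable[OF x(2)] J_differentiable[OF x(1)]
  let ?C = "\<lambda>u v. riesz (\<lambda>e. snd z \<bullet> curvature_euc \<Gamma> x u v e)"
  have C: "?C u v \<bullet> e = snd z \<bullet> curvature_euc \<Gamma> x u v e" for u v e
    by (rule riesz_inner[OF linear_inner_right_comp[OF linear_curvature_euc[OF x(1)]]])
  have lQ: "linear (\<lambda>e. snd z \<bullet> (curvature_euc \<Gamma> x u v e - curvature_euc \<Gamma> x (J x u) (J x v) e
           + \<sigma> *\<^sub>R (curvature_euc \<Gamma> x (J x u) v (J x e) + curvature_euc \<Gamma> x u (J x v) (J x e))))"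
    using linear_curvature_euc[OF x(1)] linear_J[OF x(1)]
    by (intro linear_inner_right_comp linearI) (simp_all add: linear_add linear_cmul algebra_simps)
  note h = linear_hor_part[OF x(2)]
  \<comment> \<open>Brackets of horizontal lifts carry their curvature term with a minus sign; K
    keeps it and applies \<sigma> times the transpose of J to the term.\<close>
  have Kp: "K z (v, hor_part \<Gamma> z v - w) = (J x v, hor_part \<Gamma> z (J x v) - \<sigma> *\<^sub>R J_transp x w)" for v w
    using K_pair[OF x(2), of v "- w"] linear_neg[OF linear_J_transp[OF x(1)]] by (simp add: x_def)
  have "nijenhuis_euc K z (H (\<lambda>_. u) z) (H (\<lambda>_. v) z)
     = lie_euc (H (\<lambda>_. u)) (H (\<lambda>_. v)) z + (K z (lie_euc (H (\<lambda>x. J x u)) (H (\<lambda>_. v)) z) + K z (lie_euc (H (\<lambda>_. u)) (H (\<lambda>x. J x v)) z))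
       - lie_euc (H (\<lambda>x. J x u)) (H (\<lambda>x. J x v)) z"
    using nijenhuis_K_fields[OF z H_differentiable[OF x(2)] H_differentiable[OF x(2)] K K, of u v]
    by (simp add: linear_add[OF linear_K[OF z]])
  also have "\<dots> = (nijenhuis_euc J x u v, hor_part \<Gamma> z (nijenhuis_euc J x u v)
      - (?C u v + \<sigma> *\<^sub>R J_transp x (?C (J x u) v) + \<sigma> *\<^sub>R J_transp x (?C u (J x v)) - ?C (J x u) (J x v)))"
    by (simp add: lie_H_H[OF x(2)] dJ Kp N linear_add[OF h] linear_diff[OF h] linear_add[OF linear_J[OF x(1)]] algebra_simps flip: x_def)
  \<comment> \<open>Moving the transpose of J across the inner product puts J into the last slot of
    the two mixed curvature terms.\<close>
  also have "?C u v + \<sigma> *\<^sub>R J_transp x (?C (J x u) v) + \<sigma> *\<^sub>R J_transp x (?C u (J x v)) - ?C (J x u) (J x v)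
     = riesz (\<lambda>e. snd z \<bullet> (curvature_euc \<Gamma> x u v e - curvature_euc \<Gamma> x (J x u) (J x v) e
           + \<sigma> *\<^sub>R (curvature_euc \<Gamma> x (J x u) v (J x e) + curvature_euc \<Gamma> x u (J x v) (J x e))))"
    by (rule inner_linear_eqI)
      (simp only: riesz_inner[OF lQ] inner_add_left inner_diff_left inner_scaleR_left C J_transp_inner[OF x(1)],
       simp add: inner_add_right inner_diff_right algebra_simps)
  finally show ?thesis by (simp add: H_def)
qed

text \<open>Even for constant a the transposed J applied to a varies with the base point; this
  contributes the derivative of J, and the Christoffel terms of the brackets complete it to a
  covariant derivative.\<close>

lemma nijenhuis_H_V:
  assumes z: "z \<in> S \<times> UNIV" defines "x \<equiv> fst z"
  shows "nijenhuis_euc K z (u, hor_part \<Gamma> z u) (0, a)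
    = (0, riesz (\<lambda>e. a \<bullet> (nabla_endo_euc J \<Gamma> x u (J x e) - \<sigma> *\<^sub>R nabla_endo_euc J \<Gamma> x (J x u) e)))"
proof -
  have x: "x \<in> S" "fst z \<in> S" using z by (auto simp: x_def)
  have KH: "K w (H (\<lambda>_. u) w) = H (\<lambda>x. J x u) w" if "w \<in> S \<times> UNIV" for w using K_H that by auto
  have KV: "K w (V (\<lambda>_. a) w) = V (\<lambda>x. \<sigma> *\<^sub>R J_transp x a) w" if "w \<in> S \<times> UNIV" for w using K_V that by auto
  note dJ = J_differentiable[OF x(2)] J_differentiable[OF x(1)]
  have KV2: "K z (0, b) = (0, \<sigma> *\<^sub>R J_transp x b)" for b using K_V[OF x(2), of "\<lambda>_. b"] by (simp add: V_def x_def)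
  let ?dJT = "\<lambda>h. riesz (\<lambda>e. a \<bullet> field_deriv J x h e)"
  have dJT: "((\<lambda>x. \<sigma> *\<^sub>R J_transp x a) has_derivative (\<lambda>h. \<sigma> *\<^sub>R ?dJT h)) (at x)"
    unfolding J_transp_def riesz_def field_deriv_def
    by (intro has_derivative_scaleR_right has_derivative_sum has_derivative_scaleR_left has_derivative_inner_right
       differentiable_has_frechet J_differentiable x)
  have dJTi: "?dJT h \<bullet> e = a \<bullet> field_deriv J x h e" for h e
    by (rule riesz_inner[OF linear_inner_right_comp[OF linear_dJ[OF x(1)]]])
  let ?G = "\<lambda>u b. riesz (\<lambda>e. b \<bullet> \<Gamma> x u e)"
  have G: "?G u b \<bullet> e = b \<bullet> \<Gamma> x u e" for u b e
    by (rule riesz_inner[OF linear_inner_right_comp[OF linear_G2[OF x(1)]]])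
  have lQ: "linear (\<lambda>e. a \<bullet> (nabla_endo_euc J \<Gamma> x u (J x e) - \<sigma> *\<^sub>R nabla_endo_euc J \<Gamma> x (J x u) e))"
    using linear_dJ[OF x(1)] linear_J[OF x(1)] linear_G2[OF x(1)] unfolding nabla_endo_euc_def
    by (intro linear_inner_right_comp linearI) (simp_all add: linear_add linear_cmul algebra_simps)
  have "nijenhuis_euc K z (H (\<lambda>_. u) z) (V (\<lambda>_. a) z) =
    lie_euc (H (\<lambda>_. u)) (V (\<lambda>_. a)) z + (K z (lie_euc (H (\<lambda>x. J x u)) (V (\<lambda>_. a)) z) + K z (lie_euc (H (\<lambda>_. u)) (V (\<lambda>x. \<sigma> *\<^sub>R J_transp x a)) z))
       - lie_euc (H (\<lambda>x. J x u)) (V (\<lambda>x. \<sigma> *\<^sub>R J_transp x a)) z"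
    using nijenhuis_K_fields[OF z H_differentiable[OF x(2)] V_differentiable KH KV]
    by (simp add: linear_add[OF linear_K[OF z]])
  also have "\<dots> = (0, - ?G u a - \<sigma> *\<^sub>R J_transp x (?G (J x u) a) + \<sigma> *\<^sub>R J_transp x (\<sigma> *\<^sub>R ?dJT u - ?G u (\<sigma> *\<^sub>R J_transp x a))
     - (\<sigma> *\<^sub>R ?dJT (J x u) - ?G (J x u) (\<sigma> *\<^sub>R J_transp x a)))"
    by (simp add: lie_H_V[OF x(2) _ has_derivative_const] lie_H_V[OF x(2) _ dJT[unfolded x_def]] dJ KV2
      linear_neg[OF linear_J_transp[OF x(1)]] flip: x_def)
  also have "- ?G u a - \<sigma> *\<^sub>R J_transp x (?G (J x u) a) + \<sigma> *\<^sub>R J_transp x (\<sigma> *\<^sub>R ?dJT u - ?G u (\<sigma> *\<^sub>R J_transp x a))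
     - (\<sigma> *\<^sub>R ?dJT (J x u) - ?G (J x u) (\<sigma> *\<^sub>R J_transp x a))
     = riesz (\<lambda>e. a \<bullet> (nabla_endo_euc J \<Gamma> x u (J x e) - \<sigma> *\<^sub>R nabla_endo_euc J \<Gamma> x (J x u) e))"
    (is "?lhs = riesz ?f")
  proof (rule inner_linear_eqI)
    fix e
    \<comment> \<open>Where K acts on a field already scaled by \<sigma> the two signs cancel, so no
      \<sigma> is left in the derivative along u. The bare term - \<Gamma>(u) e fits in as
      \<Gamma>(u) applied to J J e.\<close>
    have s: "\<sigma> * (\<sigma> * r) = r" for r using sigma by (simp flip: mult.assoc)
    have G': "riesz (\<lambda>e. \<sigma> * (a \<bullet> J x (\<Gamma> x u e))) \<bullet> e = \<sigma> * (a \<bullet> J x (\<Gamma> x u e))" for u e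
      using G[of "\<sigma> *\<^sub>R J_transp x a" u e] by (simp add: J_transp_inner[OF x(1)])
    show "?lhs \<bullet> e = riesz ?f \<bullet> e"
      by (simp only: riesz_inner[OF lQ] inner_add_left inner_diff_left inner_minus_left inner_scaleR_left G dJTi J_transp_inner[OF x(1)],
          simp add: inner_add_right inner_diff_right G'
        nabla_endo_euc_def J_J[OF x(1)] linear_neg[OF linear_G2[OF x(1)]] linear_neg[OF linear_J[OF x(1)]] ring_distribs s)
  qed
  finally show ?thesis by (simp add: H_def V_def)
qed

text \<open>Differentiating J J = -1 makes the flat derivative of J anticommute with J; the
  Christoffel part does so because it is a commutator with J.\<close>

lemma nabla_endo_J:
  assumes x: "x \<in> S" shows "nabla_endo_euc J \<Gamma> x u (J x v) = - J x (nabla_endo_euc J \<Gamma> x u v)"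
proof -
  have "((\<lambda>x. J x (J x v)) has_derivative (\<lambda>h. field_deriv J x h (J x v) + J x (field_deriv J x h v))) (at x)"
    using has_derivative_field[where L=J and X="\<lambda>x. J x v", OF open_S x linear_J J_differentiable[OF x]
      differentiable_has_frechet[OF J_differentiable[OF x]]] by (simp add: field_deriv_def)
  moreover have "((\<lambda>x. J x (J x v)) has_derivative (\<lambda>h. 0)) (at x)"
    by (rule has_derivative_transform_within_open[OF has_derivative_const[of "- v"] open_S x]) (simp add: J_J)
  ultimately have "(\<lambda>h. field_deriv J x h (J x v) + J x (field_deriv J x h v)) = (\<lambda>h. 0)"
    by (rule has_derivative_unique)
  from fun_cong[OF this, of u] have "field_deriv J x u (J x v) = - J x (field_deriv J x u v)"
    by (simp add: add_eq_0_iff2)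
  then show ?thesis
    by (simp add: nabla_endo_euc_def linear_add[OF linear_J[OF x]] linear_diff[OF linear_J[OF x]]
      J_J[OF x] linear_neg[OF linear_G2[OF x]])
qed

lemma inner_riesz_eq_0: "linear f \<Longrightarrow> riesz f = 0 \<longleftrightarrow> (\<forall>e. f e = 0)"
  by (metis inner_zero_left riesz_inner riesz_eqI)

lemma nijenhuis_lifted_endo_iff:
  "(\<forall>z\<in>S\<times>UNIV. \<forall>p q. nijenhuis_euc K z p q = 0) \<longleftrightarrow>
   (\<forall>x\<in>S. (\<forall>u v. nijenhuis_euc J x u v = 0) \<and>
     (\<forall>u v. nabla_endo_euc J \<Gamma> x u v = \<sigma> *\<^sub>R J x (nabla_endo_euc J \<Gamma> x (J x u) v)) \<and>
     (\<forall>u v w. curvature_euc \<Gamma> x u v w - curvature_euc \<Gamma> x (J x u) (J x v) w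
         + \<sigma> *\<^sub>R (curvature_euc \<Gamma> x (J x u) v (J x w) + curvature_euc \<Gamma> x u (J x v) (J x w)) = 0))"
proof -
  let ?N = "nijenhuis_euc K"
  let ?Q = "\<lambda>x u v e. curvature_euc \<Gamma> x u v e - curvature_euc \<Gamma> x (J x u) (J x v) e
           + \<sigma> *\<^sub>R (curvature_euc \<Gamma> x (J x u) v (J x e) + curvature_euc \<Gamma> x u (J x v) (J x e))"
  let ?P = "\<lambda>x u e. nabla_endo_euc J \<Gamma> x u (J x e) - \<sigma> *\<^sub>R nabla_endo_euc J \<Gamma> x (J x u) e"
  have lQ: "linear (?Q x u v)" if x: "x \<in> S" for x u v
    using linear_curvature_euc[OF x] linear_J[OF x]
    by (intro linearI) (simp_all add: linear_add linear_cmul algebra_simps)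
  have lP: "linear (?P x u)" if x: "x \<in> S" for x u
    using linear_dJ[OF x] linear_J[OF x] linear_G2[OF x] unfolding nabla_endo_euc_def
    by (intro linearI) (simp_all add: linear_add linear_cmul algebra_simps)
  \<comment> \<open>Anticommutation brings J to the left in P; applying J once more gives the form
    in which the condition is stated.\<close>
  have P: "nabla_endo_euc J \<Gamma> x u v = \<sigma> *\<^sub>R J x (nabla_endo_euc J \<Gamma> x (J x u) v) \<longleftrightarrow> ?P x u v = 0" if x: "x \<in> S" for x u v
  proof -
    have "?P x u v = 0 \<longleftrightarrow> - J x (nabla_endo_euc J \<Gamma> x u v) = \<sigma> *\<^sub>R nabla_endo_euc J \<Gamma> x (J x u) v"
      by (simp add: nabla_endo_J[OF x])
    also have "\<dots> \<longleftrightarrow> nabla_endo_euc J \<Gamma> x u v = \<sigma> *\<^sub>R J x (nabla_endo_euc J \<Gamma> x (J x u) v)"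
      by (metis J_J[OF x] linear_cmul[OF linear_J[OF x]] linear_neg[OF linear_J[OF x]] minus_minus)
    finally show ?thesis by simp
  qed
  have bil: "?N z p (q + r) = ?N z p q + ?N z p r" "?N z (q + r) p = ?N z q p + ?N z r p" "?N z p q = - ?N z q p"
    if z: "z \<in> S \<times> UNIV" for z p q r
  proof -
    show *: "?N z p (q + r) = ?N z p q + ?N z p r" for p q r
      by (rule nijenhuis_euc_add_right[OF open_T z linear_K smooth_on_differentiable[OF smooth_K z]])
    show a: "?N z p q = - ?N z q p" for p q by (rule nijenhuis_euc_antisym[where K=K and x=z, OF linear_K[OF z]])
    show "?N z (q + r) p = ?N z q p + ?N z r p" by (metis * a minus_add_distrib)
  qed
  show ?thesis
  proof (intro iffI ballI conjI allI)
    fix x u v w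
    assume N: "\<forall>z\<in>S\<times>UNIV. \<forall>p q. ?N z p q = 0" and x: "x \<in> S"
    \<comment> \<open>The zero section suffices, because the base component of the tensor does not
      involve y.\<close>
    show NJ: "nijenhuis_euc J x u v = 0"
      using nijenhuis_H_H[of "(x, 0)" u v] N x by (simp add: zero_prod_def)
    \<comment> \<open>The covector a is free, so the value of P itself can be inserted, and
      definiteness of the inner product gives P = 0.\<close>
    have "\<forall>e. a \<bullet> ?P x u e = 0" for a
      using nijenhuis_H_V[of "(x, 0)" u a] N x inner_riesz_eq_0[OF linear_inner_right_comp[OF lP[OF x]], of a u] by (simp add: zero_prod_def)
    then have "?P x u v \<bullet> ?P x u v = 0" by blast
    then have "?P x u v = 0" by (simp only: inner_eq_zero_iff)
    then show "nabla_endo_euc J \<Gamma> x u v = \<sigma> *\<^sub>R J x (nabla_endo_euc J \<Gamma> x (J x u) v)" using P[OF x] by blast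
    \<comment> \<open>Here the free covector is the point y of the fibre; since N_J vanishes, only
      the term of y with Q remains.\<close>
    have "\<forall>e. y \<bullet> ?Q x u v e = 0" for y
      using nijenhuis_H_H[of "(x, y)" u v] N x inner_riesz_eq_0[OF linear_inner_right_comp[OF lQ[OF x]], of y u v]
        NJ linear_0[OF linear_hor_part, of "(x, y)"] by (simp add: zero_prod_def)
    then have "?Q x u v w \<bullet> ?Q x u v w = 0" by blast
    then show "?Q x u v w = 0" by (simp only: inner_eq_zero_iff)
  next
    fix z :: "'e \<times> 'e" and p q
    assume R: "\<forall>x\<in>S. (\<forall>u v. nijenhuis_euc J x u v = 0) \<and>
     (\<forall>u v. nabla_endo_euc J \<Gamma> x u v = \<sigma> *\<^sub>R J x (nabla_endo_euc J \<Gamma> x (J x u) v)) \<and>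
     (\<forall>u v w. ?Q x u v w = 0)" and z: "z \<in> S \<times> UNIV"
    have x: "fst z \<in> S" using z by auto
    have HH: "?N z (u, hor_part \<Gamma> z u) (v, hor_part \<Gamma> z v) = 0" for u v
      using nijenhuis_H_H[OF z] R x linear_0[OF linear_hor_part[OF x]] by (simp add: riesz_def zero_prod_def)
    have "?P (fst z) u e = 0" for u e using P[OF x, of u e] R x by blast
    then have HV: "?N z (u, hor_part \<Gamma> z u) (0, a) = 0" for u a
      unfolding nijenhuis_H_V[OF z] by (simp add: riesz_def zero_prod_def)
    \<comment> \<open>The splitting relative to the horizontal space at z; bilinearity reduces the
      claim to horizontal and vertical arguments.\<close>
    have dec: "p = (fst p, hor_part \<Gamma> z (fst p)) + (0, snd p - hor_part \<Gamma> z (fst p))" for p :: "'e \<times> 'e"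
      by (simp add: prod_eq_iff)
    have VH: "?N z (0, a) (u, hor_part \<Gamma> z u) = 0" for u a
      using HV[of u a] bil(3)[OF z, of "(0, a)" "(u, hor_part \<Gamma> z u)"] by simp
    show "?N z p q = 0"
      by (subst dec[of p], subst dec[of q]) (simp add: bil(1,2)[OF z] HH HV VH nijenhuis_V_V[OF z] del: add_Pair)
  qed
qed

end

section \<open>Christoffel maps, covariant derivative and curvature in a chart\<close>

section \<open>Linear connections in charts\<close>

context connection_euc
begin

definition nabla_euc :: "('e \<Rightarrow> 'e) \<Rightarrow> ('e \<Rightarrow> 'e) \<Rightarrow> 'e \<Rightarrow> 'e" where
  "nabla_euc u v x = frechet_derivative v (at x) (u x) + \<Gamma> x (u x) (v x)"

text \<open>The rule for two moving arguments follows from the rule for one: u is absorbed into the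
  operator field x |-> \<Gamma> x (u x), and v is then its argument.\<close>

lemma christoffel_deriv:
  assumes x: "x \<in> S" and u: "(u has_derivative u') (at x)" and v: "(v has_derivative v') (at x)"
  shows "((\<lambda>x. \<Gamma> x (u x) (v x)) has_derivative
     (\<lambda>h. d_christoffel \<Gamma> x h (u x) (v x) + \<Gamma> x (u' h) (v x) + \<Gamma> x (u x) (v' h))) (at x)"
proof -
  let ?L = "\<lambda>x w. \<Gamma> x (u x) w"
  have 1: "((\<lambda>x. ?L x w) has_derivative (\<lambda>h. d_christoffel \<Gamma> x h (u x) w + \<Gamma> x (u' h) w)) (at x)" for w
    using has_derivative_field[where L="\<lambda>x u. \<Gamma> x u w", OF open_S x linear_G1 smooth_on_differentiable[OF smooth_G x] u]
    by (simp add: field_deriv_def d_christoffel_def)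
  have "((\<lambda>x. ?L x (v x)) has_derivative (\<lambda>h. field_deriv ?L x h (v x) + ?L x (v' h))) (at x)"
    by (rule has_derivative_field[OF open_S x linear_G2 _ v]) (use 1 differentiable_def in blast)+
  then show ?thesis by (simp add: field_deriv_def frechet_eq[OF 1])
qed

lemma nabla_euc_deriv:
  assumes T: "open T" "T \<subseteq> S" "x \<in> T" and u: "smooth_on T u" and v: "smooth_on T v"
  defines "u' \<equiv> frechet_derivative u (at x)" and "v' \<equiv> frechet_derivative v (at x)"
  shows "frechet_derivative (nabla_euc u v) (at x) h =
     frechet_derivative (\<lambda>y. frechet_derivative v (at y) (u x)) (at x) h + v' (u' h)
     + (d_christoffel \<Gamma> x h (u x) (v x) + \<Gamma> x (u' h) (v x) + \<Gamma> x (u x) (v' h))"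
proof -
  have x: "x \<in> S" using T by auto
  note du = smooth_on_has_derivative[OF u T(3), folded u'_def] and dv = smooth_on_has_derivative[OF v T(3), folded v'_def]
  let ?L = "\<lambda>y. frechet_derivative v (at y)"
  have "((\<lambda>y. ?L y (u y)) has_derivative (\<lambda>h. field_deriv ?L x h (u x) + ?L x (u' h))) (at x)"
    by (rule has_derivative_field[OF T(1,3) has_derivative_linear[OF smooth_on_has_derivative[OF v]]
        smooth_on_differentiable[OF smooth_on_frechet[OF v] T(3)] du])
  from frechet_eq[OF has_derivative_add[OF this christoffel_deriv[OF x du dv]]]
  show ?thesis by (simp add: nabla_euc_def[abs_def] field_deriv_def v'_def)
qed

text \<open>Tensoriality: second derivatives of w cancel by symmetry, first derivatives of u and v
  against the derivative along the bracket, and the terms with \<Gamma> applied to a derivative of w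
  in pairs.\<close>

lemma curvature_euc_fields:
  assumes T: "open T" "T \<subseteq> S" "x \<in> T" and u: "smooth_on T u" and v: "smooth_on T v" and w: "smooth_on T w"
  shows "- nabla_euc u (nabla_euc v w) x + nabla_euc v (nabla_euc u w) x + nabla_euc (lie_euc u v) w x
    = curvature_euc \<Gamma> x (u x) (v x) (w x)"
proof -
  have x: "x \<in> S" using T by auto
  note l = has_derivative_linear[OF smooth_on_has_derivative[OF w T(3)]]
  note d = nabla_euc_deriv[OF T]
  have sym: "frechet_derivative (\<lambda>y. frechet_derivative w (at y) (u x)) (at x) (v x)
     = frechet_derivative (\<lambda>y. frechet_derivative w (at y) (v x)) (at x) (u x)"
    by (rule frechet_derivative_symmetric[OF T(1,3) w])
  have "- nabla_euc u (nabla_euc v w) x + nabla_euc v (nabla_euc u w) x + nabla_euc (lie_euc u v) w x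
    = - (frechet_derivative (nabla_euc v w) (at x) (u x) + \<Gamma> x (u x) (nabla_euc v w x))
      + (frechet_derivative (nabla_euc u w) (at x) (v x) + \<Gamma> x (v x) (nabla_euc u w x)) + nabla_euc (lie_euc u v) w x"
    by (simp add: nabla_euc_def[of u "nabla_euc v w"] nabla_euc_def[of v "nabla_euc u w"])
  also have "\<dots> = curvature_euc \<Gamma> x (u x) (v x) (w x)"
    unfolding d[OF u w] d[OF v w] sym
    by (simp add: nabla_euc_def lie_euc_def curvature_euc_def linear_add[OF linear_G2[OF x]] linear_diff[OF l] linear_diff[OF linear_G1[OF x]])
  finally show ?thesis .
qed

end

text \<open>The first vector is the direction of differentiation. Symmetry in u and v would mean
  vanishing torsion and is not assumed, so the order matters.\<close>

definition christoffel ::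
  "('m, 'e::euclidean_space) chart set \<Rightarrow> (('m \<Rightarrow> 'e) \<Rightarrow> ('m \<Rightarrow> 'e) \<Rightarrow> 'm \<Rightarrow> 'e) \<Rightarrow> ('m, 'e) chart \<Rightarrow> 'e \<Rightarrow> 'e \<Rightarrow> 'e \<Rightarrow> 'e" where
  "christoffel A D c x u v = local_rep A c (D (coord_field A c u) (coord_field A c v)) x"

context atlas
begin

lemma coord_field_linear:
  assumes "c \<in> A" "q \<in> fst c"
  shows "coord_field A c (u + v) q = coord_field A c u q + coord_field A c v q"
    "coord_field A c (r *\<^sub>R u) q = r *\<^sub>R coord_field A c u q"
  using linear_from_coords[OF assms] by (simp_all add: coord_field_def linear_add linear_cmul)

lemma vector_fields_add:
  assumes U: "openin (mtop A) U" and X: "X \<in> vector_fields A U" and Y: "Y \<in> vector_fields A U"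
  shows "(\<lambda>q. X q + Y q) \<in> vector_fields A U"
  by (rule vector_fieldsI[OF U smooth_on_add[OF open_image[OF U] vector_fields_local[OF X] vector_fields_local[OF Y]]])
    (auto simp: linear_add[OF linear_to_coords])

lemma vector_fields_scale:
  assumes U: "openin (mtop A) U" and f: "smooth_fun A U f" and X: "X \<in> vector_fields A U"
  shows "(\<lambda>q. f q *\<^sub>R X q) \<in> vector_fields A U"
  by (rule vector_fieldsI[where F="\<lambda>c x. (f \<circ> chart_inv c) x *\<^sub>R local_rep A c X x", OF U smooth_on_scaleR[OF open_image[OF U] _ vector_fields_local[OF X]]])
    (use f in \<open>simp_all add: linear_cmul[OF linear_to_coords] smooth_fun_def comp_def\<close>)

lemma smooth_fun_const: "smooth_fun A U (\<lambda>q. r)"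
  by (simp add: smooth_fun_def comp_def smooth_on_const)

lemma vector_fields_sum:
  assumes U: "openin (mtop A) U" "U \<noteq> {}" and "finite I" "\<And>i. i \<in> I \<Longrightarrow> smooth_fun A U (f i)" "\<And>i. i \<in> I \<Longrightarrow> X i \<in> vector_fields A U"
  shows "(\<lambda>q. \<Sum>i\<in>I. f i q *\<^sub>R X i q) \<in> vector_fields A U"
  using assms(3-)
proof (induction I rule: finite_induct)
  case empty
  show ?case by (rule vector_fieldsI[OF U(1) smooth_on_const[where c=0]]) (auto simp: linear_0[OF linear_to_coords])
next
  case (insert i I)
  then show ?case by (simp add: vector_fields_add[OF U(1) vector_fields_scale[OF U(1)]])
qed

text \<open>In any other chart the function becomes the composition of g with a transition
  map.\<close>

lemma smooth_fun_chart:
  fixes g :: "'e \<Rightarrow> real"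
  assumes U: "openin (mtop A) U" and c: "c \<in> A" "U \<subseteq> fst c" and g: "smooth_on (snd c ` U) g"
  shows "smooth_fun A U (\<lambda>q. g (snd c q))"
  unfolding smooth_fun_def
proof
  fix c' assume c': "c' \<in> A"
  let ?S = "snd c' ` (U \<inter> fst c')"
  have S: "open ?S" by (rule open_image[OF U c'])
  have Uc: "U \<inter> fst c = U" using c by auto
  show "smooth_on ?S ((\<lambda>q. g (snd c q)) \<circ> chart_inv c')"
  proof (subst smooth_on_cong[OF S])
    show "smooth_on ?S (\<lambda>x. g (transition c' c x))"
    proof (rule smooth_on_compose[OF S _ g])
      show "open (snd c ` U)" using open_image[OF U c(1)] Uc by simp
      show "smooth_on ?S (transition c' c)"
        by (rule smooth_on_subset[OF smooth_transition[OF c' c(1)]]) (use c in auto)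
      show "transition c' c ` ?S \<subseteq> snd c ` U" using c' by auto
    qed
  qed (use c' in auto)
qed

lemma differential_chart:
  assumes U: "openin (mtop A) U" "p \<in> U" and f: "smooth_fun A U f" and c: "c \<in> A" "p \<in> fst c"
  shows "differential A f p v = frechet_derivative (f \<circ> chart_inv c) (at (snd c p)) (to_coords A c p v)"
proof -
  define c0 where "c0 = chart_at A p"
  have c0: "c0 \<in> A" "p \<in> fst c0" using chart_at[OF in_carrier[OF c]] by (simp_all add: c0_def)
  have "(f \<circ> chart_inv c) differentiable at (transition c0 c (snd c0 p))"
    using f c U c0 by (intro smooth_on_differentiable[of "snd c ` (U \<inter> fst c)"]) (auto simp: smooth_fun_def)
  then have "((\<lambda>x. (f \<circ> chart_inv c) (transition c0 c x)) has_derivative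
      (\<lambda>v. frechet_derivative (f \<circ> chart_inv c) (at (transition c0 c (snd c0 p))) (tmap c0 c p v))) (at (snd c0 p))"
    by (intro has_derivative_compose[OF transition_deriv[OF c0(1) c(1) c0(2) c(2)]] differentiable_has_frechet)
  moreover have "(f \<circ> chart_inv c) (transition c0 c x) = (f \<circ> chart_inv c0) x" if "x \<in> snd c0 ` (fst c0 \<inter> fst c)" for x
    using that c c0 by auto
  ultimately have "((f \<circ> chart_inv c0) has_derivative
      (\<lambda>v. frechet_derivative (f \<circ> chart_inv c) (at (transition c0 c (snd c0 p))) (tmap c0 c p v))) (at (snd c0 p))"
    using c c0 by (elim has_derivative_transform_within_open[OF _ open_overlap[OF c0(1) c(1)]]) auto
  from frechet_eq[OF this] show ?thesis
    using c0 by (simp add: differential_def to_coords_tmap flip: c0_def)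
qed

end

locale connection = atlas A for A :: "('m, 'e::euclidean_space) chart set" +
  fixes D :: "('m \<Rightarrow> 'e) \<Rightarrow> ('m \<Rightarrow> 'e) \<Rightarrow> 'm \<Rightarrow> 'e"
  assumes conn: "linear_connection A D"
begin

lemma
  assumes U: "openin (mtop A) U" and X: "X \<in> vector_fields A U" and Y: "Y \<in> vector_fields A U"
  shows D_in: "D X Y \<in> vector_fields A U"
    and D_add1: "X' \<in> vector_fields A U \<Longrightarrow> p \<in> U \<Longrightarrow> D (\<lambda>q. X q + X' q) Y p = D X Y p + D X' Y p"
    and D_scale1: "smooth_fun A U f \<Longrightarrow> p \<in> U \<Longrightarrow> D (\<lambda>q. f q *\<^sub>R X q) Y p = f p *\<^sub>R D X Y p"
    and D_add2: "Y' \<in> vector_fields A U \<Longrightarrow> p \<in> U \<Longrightarrow> D X (\<lambda>q. Y q + Y' q) p = D X Y p + D X Y' p"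
    and D_scale2: "smooth_fun A U f \<Longrightarrow> p \<in> U \<Longrightarrow>
      D X (\<lambda>q. f q *\<^sub>R Y q) p = differential A f p (X p) *\<^sub>R Y p + f p *\<^sub>R D X Y p"
    and D_cong: "X' \<in> vector_fields A U \<Longrightarrow> Y' \<in> vector_fields A U \<Longrightarrow> p \<in> U \<Longrightarrow>
      (\<And>q. q \<in> U \<Longrightarrow> X q = X' q) \<Longrightarrow> (\<And>q. q \<in> U \<Longrightarrow> Y q = Y' q) \<Longrightarrow> D X Y p = D X' Y' p"
proof -
  note ax = conn[unfolded linear_connection_def, THEN spec, THEN mp, OF U]
  show "D X Y \<in> vector_fields A U" using ax[THEN conjunct1] X Y by blast
  show "D (\<lambda>q. X q + X' q) Y p = D X Y p + D X' Y p" if "X' \<in> vector_fields A U" "p \<in> U"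
    using ax[THEN conjunct2, THEN conjunct1] X Y that by blast
  show "D (\<lambda>q. f q *\<^sub>R X q) Y p = f p *\<^sub>R D X Y p" if "smooth_fun A U f" "p \<in> U"
    using ax[THEN conjunct2, THEN conjunct2, THEN conjunct1] X Y that by blast
  show "D X (\<lambda>q. Y q + Y' q) p = D X Y p + D X Y' p" if "Y' \<in> vector_fields A U" "p \<in> U"
    using ax[THEN conjunct2, THEN conjunct2, THEN conjunct2, THEN conjunct1] X Y that by blast
  show "D X (\<lambda>q. f q *\<^sub>R Y q) p = differential A f p (X p) *\<^sub>R Y p + f p *\<^sub>R D X Y p" if "smooth_fun A U f" "p \<in> U"
    using ax[THEN conjunct2, THEN conjunct2, THEN conjunct2, THEN conjunct2, THEN conjunct1] X Y that by blast
  show "D X Y p = D X' Y' p" if "X' \<in> vector_fields A U" "Y' \<in> vector_fields A U" "p \<in> U"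
      "\<And>q. q \<in> U \<Longrightarrow> X q = X' q" "\<And>q. q \<in> U \<Longrightarrow> Y q = Y' q"
    using ax[THEN conjunct2, THEN conjunct2, THEN conjunct2, THEN conjunct2, THEN conjunct2] X Y that by blast
qed

lemma D_zero1:
  assumes U: "openin (mtop A) U" "p \<in> U" and Y: "Y \<in> vector_fields A U"
  shows "D (\<lambda>q. 0) Y p = 0"
  using D_scale1[OF U(1) Y Y smooth_fun_const[of U 0] U(2)] by simp

lemma differential_const: "differential A (\<lambda>q. r) p v = 0"
  by (simp add: differential_def comp_def)

lemma D_zero2:
  assumes U: "openin (mtop A) U" "p \<in> U" and X: "X \<in> vector_fields A U"
  shows "D X (\<lambda>q. 0) p = 0"
  using D_scale2[OF U(1) X X smooth_fun_const[of U 0] U(2)] by (simp add: differential_const)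

lemma D_sum1:
  assumes U: "openin (mtop A) U" "p \<in> U" and Y: "Y \<in> vector_fields A U"
    and "finite I" "\<And>i. i \<in> I \<Longrightarrow> smooth_fun A U (f i)" "\<And>i. i \<in> I \<Longrightarrow> X i \<in> vector_fields A U"
  shows "D (\<lambda>q. \<Sum>i\<in>I. f i q *\<^sub>R X i q) Y p = (\<Sum>i\<in>I. f i p *\<^sub>R D (X i) Y p)"
  using assms(4-)
proof (induction I rule: finite_induct)
  case empty then show ?case by (simp add: D_zero1[OF U Y])
next
  case (insert i I)
  have s: "(\<lambda>q. \<Sum>i\<in>I. f i q *\<^sub>R X i q) \<in> vector_fields A U"
    using insert U by (intro vector_fields_sum) auto
  have t: "(\<lambda>q. f i q *\<^sub>R X i q) \<in> vector_fields A U" using insert U by (intro vector_fields_scale) auto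
  show ?case using insert D_add1[OF U(1) t Y s U(2)] D_scale1[OF U(1) _ Y _ U(2)] by simp
qed

lemma D_sum2:
  assumes U: "openin (mtop A) U" "p \<in> U" and X: "X \<in> vector_fields A U"
    and "finite I" "\<And>i. i \<in> I \<Longrightarrow> smooth_fun A U (f i)" "\<And>i. i \<in> I \<Longrightarrow> Y i \<in> vector_fields A U"
  shows "D X (\<lambda>q. \<Sum>i\<in>I. f i q *\<^sub>R Y i q) p = (\<Sum>i\<in>I. differential A (f i) p (X p) *\<^sub>R Y i p + f i p *\<^sub>R D X (Y i) p)"
  using assms(4-)
proof (induction I rule: finite_induct)
  case empty then show ?case by (simp add: D_zero2[OF U X])
next
  case (insert i I)
  have s: "(\<lambda>q. \<Sum>i\<in>I. f i q *\<^sub>R Y i q) \<in> vector_fields A U"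
    using insert U by (intro vector_fields_sum) auto
  have t: "(\<lambda>q. f i q *\<^sub>R Y i q) \<in> vector_fields A U" using insert U by (intro vector_fields_scale) auto
  show ?case using insert D_add2[OF U(1) X t s U(2)] D_scale2[OF U(1) X _ _ U(2)] by simp
qed

lemma christoffel_chart:
  "c \<in> A \<Longrightarrow> p \<in> fst c \<Longrightarrow> christoffel A D c (snd c p) u v = to_coords A c p (D (coord_field A c u) (coord_field A c v) p)"
  by (simp add: christoffel_def)

text \<open>The coordinate field of a sum equals the sum of the coordinate fields on the chart
  domain only, so locality of D comes in before its additivity. Homogeneity is the module rule, or
  the Leibniz rule, for a constant function.\<close>

lemma christoffel_linear:
  assumes c: "c \<in> A" and x: "x \<in> snd c ` fst c"
  shows "linear (\<lambda>u. christoffel A D c x u v)" "linear (christoffel A D c x v)"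
proof -
  note E = coord_field_in[OF c] and U = openin_chart[OF c]
  obtain p where p: "p \<in> fst c" "x = snd c p" using x by auto
  note l = linear_to_coords[OF c p(1)] and eq = coord_field_linear[OF c]
  note sc = vector_fields_scale[OF U smooth_fun_const E]
  show "linear (\<lambda>u. christoffel A D c x u v)"
  proof (rule linearI)
    show "christoffel A D c x (u + u') v = christoffel A D c x u v + christoffel A D c x u' v" for u u'
      using D_add1[OF U E[of u] E[of v] E[of u'] p(1)] D_cong[OF U E[of "u + u'"] E[of v] vector_fields_add[OF U E[of u] E[of u']] E[of v] p(1) eq(1)]
      by (simp add: p(2) christoffel_chart[OF c p(1)] linear_add[OF l])
    show "christoffel A D c x (r *\<^sub>R u) v = r *\<^sub>R christoffel A D c x u v" for r u
      using D_scale1[OF U E[of u] E[of v] smooth_fun_const p(1)] D_cong[OF U E[of "r *\<^sub>R u"] E[of v] sc[of r u] E[of v] p(1) eq(2)]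
      by (simp add: p(2) christoffel_chart[OF c p(1)] linear_cmul[OF l])
  qed
  show "linear (christoffel A D c x v)"
  proof (rule linearI)
    show "christoffel A D c x v (u + u') = christoffel A D c x v u + christoffel A D c x v u'" for u u'
      using D_add2[OF U E[of v] E[of u] E[of u'] p(1)] D_cong[OF U E[of v] E[of "u + u'"] E[of v] vector_fields_add[OF U E[of u] E[of u']] p(1) _ eq(1)]
      by (simp add: p(2) christoffel_chart[OF c p(1)] linear_add[OF l])
    show "christoffel A D c x v (r *\<^sub>R u) = r *\<^sub>R christoffel A D c x v u" for r u
      using D_scale2[OF U E[of v] E[of u] smooth_fun_const p(1)] D_cong[OF U E[of v] E[of "r *\<^sub>R u"] E[of v] sc[of r u] p(1) _ eq(2)]
      by (simp add: p(2) christoffel_chart[OF c p(1)] linear_cmul[OF l] differential_const)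
  qed
qed

lemma connection_euc: assumes c: "c \<in> A" shows "connection_euc (snd c ` fst c) (christoffel A D c)"
proof (rule connection_euc.intro)
  show "smooth_on (snd c ` fst c) (\<lambda>x. christoffel A D c x u v)" for u v
    using vector_fields_local[OF D_in[OF openin_chart[OF c] coord_field_in[OF c, of u] coord_field_in[OF c, of v]] c]
    by (simp add: christoffel_def)
qed (rule open_chart[OF c] christoffel_linear[OF c]; assumption)+

lemma field_expansion:
  assumes c: "c \<in> A" "q \<in> fst c"
  shows "X q = (\<Sum>b\<in>Basis. (local_rep A c X (snd c q) \<bullet> b) *\<^sub>R coord_field A c b q)"
  using linear_Basis_expansion[OF linear_from_coords[OF c], of "local_rep A c X (snd c q)"] c
  by (simp add: coord_field_def)

text \<open>With both fields expanded in the coordinate frame, linearity over functions in X and the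
  Leibniz rule in Y leave the derivatives of the components of Y and the values of D on frame
  fields.\<close>

lemma to_coords_D:
  assumes U: "openin (mtop A) U" "p \<in> U" and X: "X \<in> vector_fields A U" and Y: "Y \<in> vector_fields A U"
    and c: "c \<in> A" "p \<in> fst c"
  shows "to_coords A c p (D X Y p) = connection_euc.nabla_euc (christoffel A D c) (local_rep A c X) (local_rep A c Y) (snd c p)"
proof -
  interpret E: connection_euc "snd c ` fst c" "christoffel A D c" by (rule connection_euc[OF c(1)])
  \<comment> \<open>The coordinate frame lives on the chart domain; locality allows both fields to
    be restricted to it.\<close>
  define W where "W = U \<inter> fst c"
  have W: "openin (mtop A) W" "p \<in> W" "W \<subseteq> fst c" "W \<subseteq> U" "W \<noteq> {}"
    using openin_Int[OF U(1) openin_chart[OF c(1)]] U c by (auto simp: W_def)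
  note XW = vector_fields_subset[OF X W(4)] and YW = vector_fields_subset[OF Y W(4)]
  have E: "coord_field A c u \<in> vector_fields A W" for u by (rule vector_fields_subset[OF coord_field_in[OF c(1)] W(3)])
  define f where "f = (\<lambda>X b q. local_rep A c X (snd c q) \<bullet> b)"
  have f: "smooth_fun A W (f X b)" if "X \<in> vector_fields A U" for X b
    unfolding f_def
  proof (rule smooth_fun_chart[OF W(1) c(1) W(3)])
    have "open (snd c ` W)" using open_image[OF U(1) c(1)] by (simp add: W_def)
    then show "smooth_on (snd c ` W) (\<lambda>x. local_rep A c X x \<bullet> b)"
      using vector_fields_local[OF that c(1)] by (intro smooth_on_inner smooth_on_const) (simp_all add: W_def)
  qed
  have exp: "X q = (\<Sum>b\<in>Basis. f X b q *\<^sub>R coord_field A c b q)" if "q \<in> W" for X q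
    using field_expansion[OF c(1), of q X] that W(3) by (auto simp: f_def)
  have sumX: "(\<lambda>q. \<Sum>b\<in>Basis. f X b q *\<^sub>R coord_field A c b q) \<in> vector_fields A W" if "X \<in> vector_fields A U" for X
    by (rule vector_fields_sum[OF W(1,5) finite_Basis f[OF that] E])
  have cf: "to_coords A c p (coord_field A c u p) = u" for u using c by (simp add: coord_field_def)
  let ?x = "snd c p"
  let ?X = "local_rep A c X" and ?Y = "local_rep A c Y"
  let ?dY = "frechet_derivative ?Y (at ?x)"
  have dY: "?Y differentiable at ?x" by (rule local_rep_differentiable[OF Y c(1) U(2) c(2)])
  have dexp: "differential A (f Y b) p v = ?dY (to_coords A c p v) \<bullet> b" for b v
  proof -
    have "frechet_derivative (f Y b \<circ> chart_inv c) (at ?x) = frechet_derivative (\<lambda>x. ?Y x \<bullet> b) (at ?x)"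
      by (rule frechet_derivative_cong[OF open_chart[OF c(1)]]) (use c in \<open>auto simp: f_def\<close>)
    then show ?thesis
      using differential_chart[OF W(1,2) f[OF Y] c] frechet_derivative_bounded_linear[OF bounded_linear_inner_left dY] by simp
  qed
  have "D X Y p = D (\<lambda>q. \<Sum>b\<in>Basis. f X b q *\<^sub>R coord_field A c b q) (\<lambda>q. \<Sum>b\<in>Basis. f Y b q *\<^sub>R coord_field A c b q) p"
    by (rule D_cong[OF W(1) XW YW sumX[OF X] sumX[OF Y] W(2) exp exp])
  also have "\<dots> = (\<Sum>b\<in>Basis. f X b p *\<^sub>R D (coord_field A c b) (\<lambda>q. \<Sum>b\<in>Basis. f Y b q *\<^sub>R coord_field A c b q) p)"
    by (rule D_sum1[OF W(1,2) sumX[OF Y] finite_Basis f[OF X] E])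
  also have "\<dots> = (\<Sum>b\<in>Basis. f X b p *\<^sub>R (\<Sum>b'\<in>Basis. differential A (f Y b') p (coord_field A c b p) *\<^sub>R coord_field A c b' p
       + f Y b' p *\<^sub>R D (coord_field A c b) (coord_field A c b') p))"
    by (simp add: D_sum2[OF W(1,2) E finite_Basis f[OF Y] E])
  finally have "to_coords A c p (D X Y p) = (\<Sum>b\<in>Basis. (?X ?x \<bullet> b) *\<^sub>R (\<Sum>b'\<in>Basis. (?dY b \<bullet> b') *\<^sub>R b'
       + (?Y ?x \<bullet> b') *\<^sub>R christoffel A D c ?x b b'))"
    using cf by (simp add: linear_sum[OF linear_to_coords[OF c]] linear_cmul[OF linear_to_coords[OF c]]
      linear_add[OF linear_to_coords[OF c]] dexp christoffel_chart[OF c])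
       (simp add: f_def)
  also have "\<dots> = (\<Sum>b\<in>Basis. (?X ?x \<bullet> b) *\<^sub>R (?dY b + christoffel A D c ?x b (?Y ?x)))"
    using linear_Basis_expansion[OF E.linear_G2, of ?x _ "?Y ?x"] c by (simp add: sum.distrib euclidean_representation)
  also have "\<dots> = ?dY (?X ?x) + christoffel A D c ?x (?X ?x) (?Y ?x)"
    using linear_Basis_expansion[OF E.linear_G1, of ?x "?X ?x" "?Y ?x"] linear_Basis_expansion[OF linear_frechet_derivative[OF dY], of "?X ?x"] c
    by (simp only: scaleR_add_right sum.distrib) simp
  finally show ?thesis by (simp add: E.nabla_euc_def)
qed

lemma to_coords_curvature:
  assumes U: "openin (mtop A) U" "p \<in> U" and X: "X \<in> vector_fields A U" and Y: "Y \<in> vector_fields A U" and Z: "Z \<in> vector_fields A U"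
    and c: "c \<in> A" "p \<in> fst c"
  shows "to_coords A c p (curvature A D X Y Z p)
    = curvature_euc (christoffel A D c) (snd c p) (to_coords A c p (X p)) (to_coords A c p (Y p)) (to_coords A c p (Z p))"
proof -
  interpret E: connection_euc "snd c ` fst c" "christoffel A D c" by (rule connection_euc[OF c(1)])
  let ?T = "snd c ` (U \<inter> fst c)"
  have T: "open ?T" "?T \<subseteq> snd c ` fst c" "snd c p \<in> ?T" using open_image[OF U(1) c(1)] c U by auto
  note l = linear_to_coords[OF c]
  \<comment> \<open>Stated on a neighbourhood and not only at p, because the outer covariant
    derivative differentiates the inner one.\<close>
  have loc: "local_rep A c (D X Y) x = E.nabla_euc (local_rep A c X) (local_rep A c Y) x"
    if "X \<in> vector_fields A U" "Y \<in> vector_fields A U" "x \<in> ?T" for X Y x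
    using that to_coords_D[OF U(1) _ that(1,2) c(1)] c by auto
  have loc2: "E.nabla_euc V (local_rep A c (D X Y)) (snd c p) = E.nabla_euc V (E.nabla_euc (local_rep A c X) (local_rep A c Y)) (snd c p)"
    if "X \<in> vector_fields A U" "Y \<in> vector_fields A U" for X Y V
    unfolding E.nabla_euc_def[of V] using frechet_derivative_cong[OF T(1,3) loc[OF that]] loc[OF that T(3)] by simp
  \<comment> \<open>In its direction argument the covariant derivative sees only the value at the
    point, so a pointwise identity is enough.\<close>
  have br: "E.nabla_euc (local_rep A c (lie_bracket A X Y)) V (snd c p) = E.nabla_euc (lie_euc (local_rep A c X) (local_rep A c Y)) V (snd c p)" for V
    using to_coords_lie_bracket[OF U(1) X Y U(2) c] c by (simp add: E.nabla_euc_def)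
  have "to_coords A c p (curvature A D X Y Z p) =
      - to_coords A c p (D X (D Y Z) p) + to_coords A c p (D Y (D X Z) p) + to_coords A c p (D (lie_bracket A X Y) Z p)"
    by (simp add: curvature_def linear_add[OF l] linear_neg[OF l] linear_diff[OF l])
  also have "\<dots> = - E.nabla_euc (local_rep A c X) (E.nabla_euc (local_rep A c Y) (local_rep A c Z)) (snd c p)
      + E.nabla_euc (local_rep A c Y) (E.nabla_euc (local_rep A c X) (local_rep A c Z)) (snd c p)
      + E.nabla_euc (lie_euc (local_rep A c X) (local_rep A c Y)) (local_rep A c Z) (snd c p)"
    unfolding to_coords_D[OF U X D_in[OF U(1) Y Z] c] to_coords_D[OF U Y D_in[OF U(1) X Z] c]
      to_coords_D[OF U lie_bracket_in[OF U(1) X Y] Z c] loc2[OF X Z] loc2[OF Y Z] br by simp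
  also have "\<dots> = curvature_euc (christoffel A D c) (snd c p) (local_rep A c X (snd c p)) (local_rep A c Y (snd c p)) (local_rep A c Z (snd c p))"
    by (rule E.curvature_euc_fields[OF T vector_fields_local[OF X c(1)] vector_fields_local[OF Y c(1)] vector_fields_local[OF Z c(1)]])
  finally show ?thesis using c by simp
qed

end

locale almost_complex_connection = almost_complex A J + connection A D
  for A :: "('m, 'e::euclidean_space) chart set" and J D
begin

lemma to_coords_endo_app:
  "c \<in> A \<Longrightarrow> p \<in> fst c \<Longrightarrow> to_coords A c p (endo_app J X p) = local_endo A c J (snd c p) (to_coords A c p (X p))"
  by (simp add: endo_app_def local_endo_to_coords)

text \<open>The derivative of Y enters both terms as K applied to the same vector and cancels; what
  remains depends on the values of X and Y alone.\<close>

lemma to_coords_cov_deriv_endo: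
  assumes U: "openin (mtop A) U" "p \<in> U" and X: "X \<in> vector_fields A U" and Y: "Y \<in> vector_fields A U"
    and c: "c \<in> A" "p \<in> fst c"
  shows "to_coords A c p (cov_deriv_endo D J X Y p)
    = nabla_endo_euc (local_endo A c J) (christoffel A D c) (snd c p) (to_coords A c p (X p)) (to_coords A c p (Y p))"
proof -
  interpret E: connection_euc "snd c ` fst c" "christoffel A D c" by (rule connection_euc[OF c(1)])
  let ?K = "local_endo A c J" and ?Y = "local_rep A c Y" and ?x = "snd c p"
  have x: "?x \<in> snd c ` fst c" using c by auto
  note dY = differentiable_has_frechet[OF local_rep_differentiable[OF Y c(1) U(2) c(2)]]
  have "((\<lambda>x. ?K x (?Y x)) has_derivative (\<lambda>h. field_deriv ?K ?x h (?Y ?x) + ?K ?x (frechet_derivative ?Y (at ?x) h))) (at ?x)"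
    by (rule has_derivative_field[OF open_chart[OF c(1)] x linear_local_endo[OF c(1)] smooth_on_differentiable[OF smooth_local_endo[OF c(1)] x] dY])
  from frechet_eq[OF this] frechet_derivative_cong[OF open_chart[OF c(1)] x local_rep_endo_app[OF c(1)]]
  have d: "frechet_derivative (local_rep A c (endo_app J Y)) (at ?x) = (\<lambda>h. field_deriv ?K ?x h (?Y ?x) + ?K ?x (frechet_derivative ?Y (at ?x) h))"
    by simp
  have "to_coords A c p (cov_deriv_endo D J X Y p)
     = to_coords A c p (D X (endo_app J Y) p) - ?K ?x (to_coords A c p (D X Y p))"
    by (simp add: cov_deriv_endo_def linear_diff[OF linear_to_coords[OF c]] local_endo_to_coords[OF c])
  also have "\<dots> = nabla_endo_euc ?K (christoffel A D c) ?x (to_coords A c p (X p)) (to_coords A c p (Y p))"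
    unfolding to_coords_D[OF U X Y c] to_coords_D[OF U X endo_app_in[OF U(1) Y] c] E.nabla_euc_def d local_rep_endo_app[OF c(1) x]
    by (simp add: c nabla_endo_euc_def linear_add[OF linear_local_endo[OF c(1) x]])
  finally show ?thesis .
qed

definition "nabla_cond \<sigma> \<longleftrightarrow> (\<forall>U X Y p. openin (mtop A) U \<and> X \<in> vector_fields A U \<and> Y \<in> vector_fields A U \<and> p \<in> U \<longrightarrow>
       cov_deriv_endo D J X Y p = \<sigma> *\<^sub>R J p (cov_deriv_endo D J (endo_app J X) Y p))"

definition "curv_cond \<sigma> \<longleftrightarrow> (\<forall>U X Y Z p. openin (mtop A) U \<and> X \<in> vector_fields A U \<and> Y \<in> vector_fields A U \<and>
         Z \<in> vector_fields A U \<and> p \<in> U \<longrightarrow>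
       (curvature A D X Y Z p - curvature A D (endo_app J X) (endo_app J Y) Z p)
       + \<sigma> *\<^sub>R (curvature A D (endo_app J X) Y (endo_app J Z) p
               + curvature A D X (endo_app J Y) (endo_app J Z) p) = 0)"

text \<open>Both sides see only the values of the fields at p, and coordinate fields take every
  value there, so the quantifier over fields becomes one over vectors.\<close>

lemma nabla_cond_iff:
  "nabla_cond \<sigma> \<longleftrightarrow> (\<forall>c\<in>A. \<forall>x\<in>snd c ` fst c. \<forall>u v.
     nabla_endo_euc (local_endo A c J) (christoffel A D c) x u v
     = \<sigma> *\<^sub>R local_endo A c J x (nabla_endo_euc (local_endo A c J) (christoffel A D c) x (local_endo A c J x u) v))"
    (is "?L \<longleftrightarrow> ?R")
proof -
  have key: "cov_deriv_endo D J X Y p = \<sigma> *\<^sub>R J p (cov_deriv_endo D J (endo_app J X) Y p) \<longleftrightarrow>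
     nabla_endo_euc (local_endo A c J) (christoffel A D c) (snd c p) (to_coords A c p (X p)) (to_coords A c p (Y p))
     = \<sigma> *\<^sub>R local_endo A c J (snd c p) (nabla_endo_euc (local_endo A c J) (christoffel A D c) (snd c p)
          (local_endo A c J (snd c p) (to_coords A c p (X p))) (to_coords A c p (Y p)))"
    if U: "openin (mtop A) U" "X \<in> vector_fields A U" "Y \<in> vector_fields A U" "p \<in> U" and c: "c \<in> A" "p \<in> fst c" for U X Y p c
  proof -
    have "to_coords A c p (\<sigma> *\<^sub>R J p (cov_deriv_endo D J (endo_app J X) Y p))
      = \<sigma> *\<^sub>R local_endo A c J (snd c p) (to_coords A c p (cov_deriv_endo D J (endo_app J X) Y p))"
      by (simp add: linear_cmul[OF linear_to_coords[OF c]] local_endo_to_coords[OF c])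
    then show ?thesis
      using to_coords_cov_deriv_endo[OF U(1,4,2,3) c] to_coords_cov_deriv_endo[OF U(1,4) endo_app_in[OF U(1,2)] U(3) c]
        to_coords_inj[OF c, of "cov_deriv_endo D J X Y p" "\<sigma> *\<^sub>R J p (cov_deriv_endo D J (endo_app J X) Y p)"]
      by (simp add: to_coords_endo_app[OF c])
  qed
  show ?thesis
  proof
    assume L: ?L
    show ?R
    proof (intro ballI allI)
      fix c x u v assume c: "c \<in> A" and "x \<in> snd c ` fst c"
      then obtain p where p: "p \<in> fst c" "x = snd c p" by auto
      note f = openin_chart[OF c] coord_field_in[OF c, of u] coord_field_in[OF c, of v] p(1)
      show "nabla_endo_euc (local_endo A c J) (christoffel A D c) x u v
     = \<sigma> *\<^sub>R local_endo A c J x (nabla_endo_euc (local_endo A c J) (christoffel A D c) x (local_endo A c J x u) v)"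
        using key[OF f c p(1)] L f c p by (simp add: nabla_cond_def coord_field_def)
    qed
  next
    assume R: ?R
    show ?L unfolding nabla_cond_def
    proof (intro allI impI, elim conjE)
      fix U X Y p assume U: "openin (mtop A) U" "X \<in> vector_fields A U" "Y \<in> vector_fields A U" "p \<in> U"
      obtain c where c: "c \<in> A" "p \<in> fst c" using obtain_chart[OF U(1,4)] .
      then show "cov_deriv_endo D J X Y p = \<sigma> *\<^sub>R J p (cov_deriv_endo D J (endo_app J X) Y p)"
        using key[OF U c] R by blast
    qed
  qed
qed

lemma curv_cond_iff:
  "curv_cond \<sigma> \<longleftrightarrow> (\<forall>c\<in>A. \<forall>x\<in>snd c ` fst c. \<forall>u v w.
     let K = local_endo A c J x; R = curvature_euc (christoffel A D c) x in
     R u v w - R (K u) (K v) w + \<sigma> *\<^sub>R (R (K u) v (K w) + R u (K v) (K w)) = 0)"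
    (is "?L \<longleftrightarrow> ?R")
proof -
  have key: "(curvature A D X Y Z p - curvature A D (endo_app J X) (endo_app J Y) Z p)
       + \<sigma> *\<^sub>R (curvature A D (endo_app J X) Y (endo_app J Z) p + curvature A D X (endo_app J Y) (endo_app J Z) p) = 0 \<longleftrightarrow>
     (let K = local_endo A c J (snd c p); R = curvature_euc (christoffel A D c) (snd c p);
        u = to_coords A c p (X p); v = to_coords A c p (Y p); w = to_coords A c p (Z p) in
     R u v w - R (K u) (K v) w + \<sigma> *\<^sub>R (R (K u) v (K w) + R u (K v) (K w)) = 0)"
    if U: "openin (mtop A) U" "p \<in> U" and X: "X \<in> vector_fields A U" and Y: "Y \<in> vector_fields A U" and Z: "Z \<in> vector_fields A U"
      and c: "c \<in> A" "p \<in> fst c" for U X Y Z p c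
  proof -
    note l = linear_to_coords[OF c] and JX = endo_app_in[OF U(1) X] and JY = endo_app_in[OF U(1) Y] and JZ = endo_app_in[OF U(1) Z]
    show ?thesis
      by (subst to_coords_inj[OF c, symmetric])
        (simp add: linear_add[OF l] linear_diff[OF l] linear_cmul[OF l] linear_0[OF l] Let_def
        to_coords_curvature[OF U X Y Z c] to_coords_curvature[OF U JX JY Z c] to_coords_curvature[OF U JX Y JZ c]
        to_coords_curvature[OF U X JY JZ c] to_coords_endo_app[OF c])
  qed
  show ?thesis
  proof
    assume L: ?L
    show ?R
    proof (intro ballI allI)
      fix c x u v w assume c: "c \<in> A" and "x \<in> snd c ` fst c"
      then obtain p where p: "p \<in> fst c" "x = snd c p" by auto
      note f = openin_chart[OF c] p(1) coord_field_in[OF c, of u] coord_field_in[OF c, of v] coord_field_in[OF c, of w]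
      show "let K = local_endo A c J x; R = curvature_euc (christoffel A D c) x in
        R u v w - R (K u) (K v) w + \<sigma> *\<^sub>R (R (K u) v (K w) + R u (K v) (K w)) = 0"
        using key[OF f c p(1)] L f c p by (simp add: curv_cond_def coord_field_def Let_def)
    qed
  next
    assume R: ?R
    show ?L unfolding curv_cond_def
    proof (intro allI impI, elim conjE)
      fix U X Y Z p assume U: "openin (mtop A) U" "X \<in> vector_fields A U" "Y \<in> vector_fields A U" "Z \<in> vector_fields A U" "p \<in> U"
      obtain c where c: "c \<in> A" "p \<in> fst c" using obtain_chart[OF U(1,5)] .
      then show "(curvature A D X Y Z p - curvature A D (endo_app J X) (endo_app J Y) Z p)
       + \<sigma> *\<^sub>R (curvature A D (endo_app J X) Y (endo_app J Z) p + curvature A D X (endo_app J Y) (endo_app J Z) p) = 0"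
        unfolding key[OF U(1,5,2,3,4) c] using R by (auto simp: Let_def)
    qed
  qed
qed

end

section \<open>Canonical coordinates of the cotangent bundle and their transition maps\<close>

section \<open>The cotangent bundle in charts\<close>

text \<open>The momentum vector, that is the second component of \<open>cotangent_chart\<close>; its
  inner product with the components of v is the value of the covector on v.\<close>

definition covec :: "('m, 'e::euclidean_space) chart set \<Rightarrow> ('m, 'e) chart \<Rightarrow> 'm \<Rightarrow> ('e \<Rightarrow>\<^sub>L real) \<Rightarrow> 'e" where
  "covec A c p \<alpha> = riesz (\<lambda>u. blinfun_apply \<alpha> (from_coords A c p u))"

definition covec_inv :: "('m, 'e::euclidean_space) chart set \<Rightarrow> ('m, 'e) chart \<Rightarrow> 'm \<Rightarrow> 'e \<Rightarrow> ('e \<Rightarrow>\<^sub>L real)" where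
  "covec_inv A c p y = Blinfun (\<lambda>u. y \<bullet> to_coords A c p u)"

lemma fst_cotangent_chart [simp]: "fst (cotangent_chart A c) = fst c \<times> UNIV"
  by (simp add: cotangent_chart_def)

lemma snd_cotangent_chart [simp]: "snd (cotangent_chart A c) (p, \<alpha>) = (snd c p, covec A c p \<alpha>)"
  by (simp add: cotangent_chart_def covec_def riesz_def)

lemma blinfun_apply_Blinfun_linear:
  fixes f :: "'e::euclidean_space \<Rightarrow> real"
  assumes "linear f" shows "blinfun_apply (Blinfun f) = f"
  using assms by (simp add: bounded_linear_Blinfun_apply linear_conv_bounded_linear)

lemma nijenhuis_euc_cong:
  assumes S: "open S" "x \<in> S" and K: "\<And>y u. y \<in> S \<Longrightarrow> K y u = K' y u"
  shows "nijenhuis_euc K x u v = nijenhuis_euc K' x u v"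
proof -
  have "frechet_derivative (\<lambda>y. K y u) (at x) = frechet_derivative (\<lambda>y. K' y u) (at x)" for u
    by (rule frechet_derivative_cong[OF S K])
  then show ?thesis using K[OF S(2)] by (simp add: nijenhuis_euc_def field_deriv_def)
qed

text \<open>\<open>tangent_map\<close> uses the charts picked at p and at f p; the chain rule
  through both transitions frees the computation from this choice. It serves for sections of the
  cotangent bundle and for its projection.\<close>

lemma to_coords_tangent_map:
  assumes A: "atlas A" and B: "atlas B" and c: "c \<in> A" "p \<in> fst c" and c': "c' \<in> B"
    and U: "openin (mtop A) U" "p \<in> U" "\<And>q. q \<in> U \<Longrightarrow> q \<in> fst c \<Longrightarrow> f q \<in> fst c'"
    and F: "((\<lambda>x. snd c' (f (chart_inv c x))) has_derivative F) (at (snd c p))"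
  shows "to_coords B c' (f p) (tangent_map A B f p v) = F (to_coords A c p v)"
proof -
  interpret A: atlas A by (rule A)
  interpret B: atlas B by (rule B)
  have fp: "f p \<in> fst c'" using U c by auto
  define c0 where "c0 = chart_at A p"
  define d0 where "d0 = chart_at B (f p)"
  have c0: "c0 \<in> A" "p \<in> fst c0" using A.chart_at[OF A.in_carrier[OF c]] by (simp_all add: c0_def)
  have d0: "d0 \<in> B" "f p \<in> fst d0" using B.chart_at[OF B.in_carrier[OF c' fp]] by (simp_all add: d0_def)
  let ?S = "snd c0 ` (U \<inter> fst c \<inter> fst c0)"
  have S: "open ?S" "snd c0 p \<in> ?S"
    using A.open_image[OF openin_Int[OF U(1) A.openin_chart[OF c(1)]] c0(1)] c c0 U by auto
  have tr: "transition c0 c (snd c0 p) = snd c p" using c0 by simp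
  have d1: "((\<lambda>x. snd c' (f (chart_inv c (transition c0 c x)))) has_derivative (\<lambda>v. F (tmap c0 c p v))) (at (snd c0 p))"
    by (rule has_derivative_compose[OF A.transition_deriv[OF c0(1) c(1) c0(2) c(2)], of "\<lambda>x. snd c' (f (chart_inv c x))"]) (simp add: tr F)
  have d2: "(transition c' d0 has_derivative tmap c' d0 (f p)) (at (snd c' (f (chart_inv c (transition c0 c (snd c0 p))))))"
    using B.transition_deriv[OF c' d0(1) fp d0(2)] c by (simp add: tr)
  from has_derivative_compose[OF d1 d2] have "((snd d0 \<circ> f \<circ> chart_inv c0) has_derivative (\<lambda>v. tmap c' d0 (f p) (F (tmap c0 c p v)))) (at (snd c0 p))"
    by (rule has_derivative_transform_within_open[OF _ S]) (use c c0 c' U(3) in auto)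
  from frechet_eq[OF this] have "tangent_map A B f p v = tmap c' d0 (f p) (F (tmap c0 c p v))"
    by (simp add: tangent_map_def c0_def d0_def)
  then show ?thesis
    using B.to_from[OF c' fp] by (simp add: A.to_coords_tmap B.from_coords_tmap flip: c0_def d0_def)
qed

context atlas
begin

context
  fixes c p assumes c: "c \<in> A" "p \<in> fst c"
begin

lemma covec_inner: "covec A c p \<alpha> \<bullet> u = blinfun_apply \<alpha> (from_coords A c p u)"
  unfolding covec_def
  using linear_compose[OF linear_from_coords[OF c] bounded_linear.linear[OF blinfun.bounded_linear_right]]
  by (intro riesz_inner) (simp add: o_def)

lemma covec_to_coords: "covec A c p \<alpha> \<bullet> to_coords A c p v = blinfun_apply \<alpha> v"
  using c by (simp add: covec_inner)

lemma covec_add_scale: "covec A c p (\<alpha> + r *\<^sub>R \<beta>) = covec A c p \<alpha> + r *\<^sub>R covec A c p \<beta>"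
  by (rule inner_linear_eqI) (simp add: covec_inner inner_add_left blinfun.add_left blinfun.scaleR_left)

lemma covec_scale: "covec A c p (r *\<^sub>R \<beta>) = r *\<^sub>R covec A c p \<beta>"
  by (rule inner_linear_eqI) (simp add: covec_inner blinfun.scaleR_left)

lemma blinfun_apply_covec_inv: "blinfun_apply (covec_inv A c p y) u = y \<bullet> to_coords A c p u"
  unfolding covec_inv_def
  by (subst blinfun_apply_Blinfun_linear) (auto intro!: linearI simp: linear_add[OF linear_to_coords[OF c]]
    linear_cmul[OF linear_to_coords[OF c]] inner_add_right)

lemma covec_covec_inv [simp]: "covec A c p (covec_inv A c p y) = y"
  by (rule inner_linear_eqI) (simp add: covec_inner blinfun_apply_covec_inv c)

lemma covec_inj: "covec A c p \<alpha> = covec A c p \<beta> \<longleftrightarrow> \<alpha> = \<beta>"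
  by (metis covec_to_coords blinfun_eqI)

end

lemma cotangent_chart_inj: assumes c: "c \<in> A" shows "inj_on (snd (cotangent_chart A c)) (fst c \<times> UNIV)"
proof (rule inj_onI, clarsimp)
  fix p q \<alpha> \<beta> assume pq: "p \<in> fst c" "q \<in> fst c" "snd c p = snd c q" and eq: "covec A c p \<alpha> = covec A c q \<beta>"
  have "p = q" using inj_onD[OF inj_chart[OF c] pq(3,1,2)] .
  then show "p = q \<and> \<alpha> = \<beta>" using eq covec_inj[OF c pq(1)] by simp
qed

lemma cotangent_chart_image:
  assumes c: "c \<in> A" and V: "V \<subseteq> fst c"
  shows "snd (cotangent_chart A c) ` (V \<times> UNIV) = snd c ` V \<times> UNIV"
proof -
  have "(snd c p, y) \<in> snd (cotangent_chart A c) ` (V \<times> UNIV)" if "p \<in> V" for p y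
    using that V c by (intro image_eqI[of _ _ "(p, covec_inv A c p y)"]) auto
  then show ?thesis by auto
qed

text \<open>Momenta transform by the transpose of the inverse Jacobian, which is the derivative of
  the opposite transition at the image point.\<close>

lemma transition_cotangent:
  assumes c: "c \<in> A" "c' \<in> A" "p \<in> fst c" "p \<in> fst c'"
  shows "transition (cotangent_chart A c) (cotangent_chart A c') (snd c p, y)
    = (transition c c' (snd c p), riesz (\<lambda>b. y \<bullet> frechet_derivative (transition c' c) (at (transition c c' (snd c p))) b))"
proof -
  let ?k = "cotangent_chart A c"
  have "snd ?k (p, covec_inv A c p y) = (snd c p, y)" using c by simp
  then have "chart_inv ?k (snd c p, y) = (p, covec_inv A c p y)"
    unfolding chart_inv_def using inv_into_f_f[OF cotangent_chart_inj[OF c(1)], of "(p, covec_inv A c p y)"] c by simp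
  moreover have "covec A c' p (covec_inv A c p y) = riesz (\<lambda>b. y \<bullet> tmap c' c p b)"
    unfolding covec_def using c chart_at[OF in_carrier[OF c(1,3)]]
    by (simp add: blinfun_apply_covec_inv from_coords_tmap to_coords_tmap tmap_comp)
  ultimately show ?thesis using c by (simp add: transition_def[of ?k] tmap_def)
qed

text \<open>Transitions are linear in the momenta with coefficients smooth in the base point, hence
  jointly smooth.\<close>

lemma atlas_cotangent: "atlas (cotangent_atlas A)"
proof
  have Tm: "snd (cotangent_chart A c) ` (fst (cotangent_chart A c) \<inter> fst (cotangent_chart A c')) = snd c ` (fst c \<inter> fst c') \<times> UNIV"
    if "c \<in> A" for c c'
    using cotangent_chart_image[OF that, of "fst c \<inter> fst c'"] by (simp add: Times_Int_Times)
  have sm: "smooth_on (snd c ` (fst c \<inter> fst c') \<times> UNIV) (transition (cotangent_chart A c) (cotangent_chart A c'))"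
    if c: "c \<in> A" "c' \<in> A" for c c'
  proof -
    let ?S = "snd c ` (fst c \<inter> fst c')"
    have S: "open ?S" by (rule open_overlap[OF c])
    have T: "open (?S \<times> (UNIV :: 'e set))" using S by (intro open_Times) auto
    have ft: "smooth_on (?S \<times> (UNIV :: 'e set)) (\<lambda>z. transition c c' (fst z))"
      by (rule smooth_on_fst[OF S smooth_transition[OF c]])
    have der: "smooth_on ?S (\<lambda>x. frechet_derivative (transition c' c) (at (transition c c' x)) b)" for b
      by (rule smooth_on_compose[OF S open_overlap[OF c(2,1)] smooth_on_frechet[OF smooth_transition[OF c(2,1)]] smooth_transition[OF c]])
        (use c in auto)
    have "smooth_on (?S \<times> (UNIV :: 'e set)) (\<lambda>z. riesz (\<lambda>b. snd z \<bullet> frechet_derivative (transition c' c) (at (transition c c' (fst z))) b))"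
      unfolding riesz_def
      by (rule smooth_on_sum[OF T] smooth_on_scaleR[OF T] smooth_on_const smooth_on_inner[OF T] smooth_on_snd[OF T] smooth_on_fst[OF S der])+
    from smooth_on_Pair[OF T ft this] show ?thesis
      by (rule smooth_on_cong[OF T, THEN iffD2, rotated]) (use transition_cotangent[OF c] c in auto)
  qed
  show "smooth_atlas (cotangent_atlas A)"
    unfolding smooth_atlas_def cotangent_atlas_def ball_simps
  proof (intro conjI ballI)
    fix c assume c: "c \<in> A"
    show "inj_on (snd (cotangent_chart A c)) (fst (cotangent_chart A c))"
      using cotangent_chart_inj[OF c] by simp
    show "open (snd (cotangent_chart A c) ` fst (cotangent_chart A c))"
      using Tm[OF c, of c] open_chart[OF c] by (simp add: open_Times)
    fix c' assume c': "c' \<in> A"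
    show "open (snd (cotangent_chart A c) ` (fst (cotangent_chart A c) \<inter> fst (cotangent_chart A c')))"
      using Tm[OF c, of c'] open_overlap[OF c c'] by (simp only: open_Times open_UNIV)
    show "smooth_on (snd (cotangent_chart A c) ` (fst (cotangent_chart A c) \<inter> fst (cotangent_chart A c'))) (transition (cotangent_chart A c) (cotangent_chart A c'))"
      using Tm[OF c, of c'] sm[OF c c'] by simp
  qed
qed

lemma cotangent_chart_in: "c \<in> A \<Longrightarrow> cotangent_chart A c \<in> cotangent_atlas A"
  by (simp add: cotangent_atlas_def)

definition section_rep :: "('m, 'e) chart \<Rightarrow> ('m \<Rightarrow> 'e \<Rightarrow>\<^sub>L real) \<Rightarrow> 'e \<Rightarrow> 'e" where
  "section_rep c s x = covec A c (chart_inv c x) (s (chart_inv c x))"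

lemma section_rep_chart [simp]: "c \<in> A \<Longrightarrow> p \<in> fst c \<Longrightarrow> section_rep c s (snd c p) = covec A c p (s p)"
  by (simp add: section_rep_def)

lemma section_pairing: "c \<in> A \<Longrightarrow> q \<in> fst c \<Longrightarrow> blinfun_apply (s q) (Y q) = section_rep c s (snd c q) \<bullet> local_rep A c Y (snd c q)"
  by (simp add: covec_inner)

text \<open>\<open>one_forms\<close> speaks of pairings with vector fields; pairing with coordinate
  fields extracts the components.\<close>

lemma smooth_section_rep:
  assumes U: "openin (mtop A) U" and s: "s \<in> one_forms A U" and c: "c \<in> A"
  shows "smooth_on (snd c ` (U \<inter> fst c)) (section_rep c s)"
proof -
  let ?V = "U \<inter> fst c"
  have V: "openin (mtop A) ?V" by (rule openin_Int[OF U openin_chart[OF c]])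
  have S: "open (snd c ` ?V)" by (rule open_image[OF U c])
  have E: "coord_field A c b \<in> vector_fields A ?V" for b by (rule vector_fields_subset[OF coord_field_in[OF c]]) auto
  have sf: "smooth_fun A ?V (\<lambda>q. blinfun_apply (s q) (coord_field A c b q))" for b
    using s V E unfolding one_forms_def by blast
  have sb: "smooth_on (snd c ` ?V) ((\<lambda>q. blinfun_apply (s q) (coord_field A c b q)) \<circ> chart_inv c)" for b
    using bspec[OF sf[unfolded smooth_fun_def] c, of b] by (simp add: Int_assoc)
  show ?thesis
    unfolding section_rep_def[abs_def] covec_def riesz_def
    using sb by (intro smooth_on_sum[OF S] smooth_on_scaleR[OF S] smooth_on_const) (simp add: comp_def coord_field_def)
qed

text \<open>The source of sections with a prescribed value and derivative at a point.\<close>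

lemma one_form_of_section:
  assumes c: "c \<in> A" and g: "smooth_on (snd c ` fst c) g"
  shows "(\<lambda>q. covec_inv A c q (g (snd c q))) \<in> one_forms A (fst c)"
  unfolding one_forms_def
proof (intro CollectI allI impI, elim conjE)
  fix V Y assume V: "openin (mtop A) V" "V \<subseteq> fst c" and Y: "Y \<in> vector_fields A V"
  have Vc: "V \<inter> fst c = V" using V by auto
  have S: "open (snd c ` V)" using open_image[OF V(1) c] Vc by simp
  have "smooth_on (snd c ` V) (\<lambda>x. g x \<bullet> local_rep A c Y x)"
    by (rule smooth_on_inner[OF S smooth_on_subset[OF g]]) (use V vector_fields_local[OF Y c] Vc in auto)
  from smooth_fun_chart[OF V(1) c V(2) this]
  have sf: "smooth_fun A V (\<lambda>q. g (snd c q) \<bullet> local_rep A c Y (snd c q))" .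
  show "smooth_fun A V (\<lambda>q. blinfun_apply (covec_inv A c q (g (snd c q))) (Y q))"
    unfolding smooth_fun_def
  proof
    fix c' assume c': "c' \<in> A"
    show "smooth_on (snd c' ` (V \<inter> fst c')) ((\<lambda>q. blinfun_apply (covec_inv A c q (g (snd c q))) (Y q)) \<circ> chart_inv c')"
    proof (rule smooth_on_cong[OF open_image[OF V(1) c'], THEN iffD1])
      show "smooth_on (snd c' ` (V \<inter> fst c')) ((\<lambda>q. g (snd c q) \<bullet> local_rep A c Y (snd c q)) \<circ> chart_inv c')"
        using sf c' by (auto simp: smooth_fun_def)
    qed (use c c' V in \<open>auto simp: blinfun_apply_covec_inv subset_iff\<close>)
  qed
qed

end

section \<open>Horizontal and vertical lifts in canonical coordinates\<close>

section \<open>The horizontal distribution in charts\<close>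

context connection
begin

text \<open>The pairing of s with the derivative of Y occurs both in X(s(Y)) and in s(D_X Y) and
  cancels, so the result is algebraic in Y.\<close>

lemma dual_connection_chart:
  assumes U: "openin (mtop A) U" and X: "X \<in> vector_fields A U" and s: "s \<in> one_forms A U"
    and V: "openin (mtop A) V" "p \<in> V" "V \<subseteq> U" and Y: "Y \<in> vector_fields A V" and c: "c \<in> A" "p \<in> fst c"
  shows "dual_connection A D X s Y p =
    (frechet_derivative (section_rep c s) (at (snd c p)) (to_coords A c p (X p))
     - hor_part (christoffel A D c) (snd c p, covec A c p (s p)) (to_coords A c p (X p))) \<bullet> to_coords A c p (Y p)"
proof -
  interpret E: connection_euc "snd c ` fst c" "christoffel A D c" by (rule connection_euc[OF c(1)])
  let ?x = "snd c p" and ?s = "section_rep c s" and ?Y = "local_rep A c Y"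
  have x: "?x \<in> snd c ` fst c" using c by auto
  have ds: "(?s has_derivative frechet_derivative ?s (at ?x)) (at ?x)"
    by (rule smooth_on_has_derivative[OF smooth_section_rep[OF U s c(1)]]) (use V c in auto)
  have dY: "(?Y has_derivative frechet_derivative ?Y (at ?x)) (at ?x)"
    by (rule differentiable_has_frechet[OF local_rep_differentiable[OF Y c(1) V(2) c(2)]])
  have sf: "smooth_fun A V (\<lambda>q. blinfun_apply (s q) (Y q))" using s V Y unfolding one_forms_def by blast
  have "frechet_derivative ((\<lambda>q. blinfun_apply (s q) (Y q)) \<circ> chart_inv c) (at ?x) = frechet_derivative (\<lambda>x. ?s x \<bullet> ?Y x) (at ?x)"
    by (rule frechet_derivative_cong[OF open_chart[OF c(1)] x]) (use c(1) section_pairing[OF c(1)] in auto)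
  also have "\<dots> = (\<lambda>h. ?s ?x \<bullet> frechet_derivative ?Y (at ?x) h + frechet_derivative ?s (at ?x) h \<bullet> ?Y ?x)"
    by (rule frechet_eq[OF has_derivative_inner[OF ds dY]])
  finally have "differential A (\<lambda>q. blinfun_apply (s q) (Y q)) p (X p)
      = covec A c p (s p) \<bullet> frechet_derivative ?Y (at ?x) (to_coords A c p (X p))
        + frechet_derivative ?s (at ?x) (to_coords A c p (X p)) \<bullet> to_coords A c p (Y p)"
    using differential_chart[OF V(1,2) sf c] c by simp
  moreover have "blinfun_apply (s p) (D X Y p) = covec A c p (s p) \<bullet> (frechet_derivative ?Y (at ?x) (to_coords A c p (X p))
      + christoffel A D c ?x (to_coords A c p (X p)) (to_coords A c p (Y p)))"
    using to_coords_D[OF V(1,2) vector_fields_subset[OF X V(3)] Y c] covec_to_coords[OF c, of "s p" "D X Y p"] c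
    by (simp add: E.nabla_euc_def)
  ultimately show ?thesis
    using E.hor_part_inner[of "(?x, covec A c p (s p))"] x
    by (simp add: dual_connection_def inner_diff_left inner_add_right)
qed

context
  fixes c :: "('m, 'e) chart" and p :: 'm and \<alpha> :: "'e \<Rightarrow>\<^sub>L real"
  assumes c: "c \<in> A" "p \<in> fst c"
begin

abbreviation (input) "\<kappa> \<equiv> cotangent_chart A c"
abbreviation (input) "\<xi> \<equiv> (p, \<alpha>)"
abbreviation (input) "hor \<equiv> hor_part (christoffel A D c) (snd c p, covec A c p \<alpha>)"
abbreviation (input) "to_\<kappa> \<equiv> to_coords (cotangent_atlas A) (cotangent_chart A c) (p, \<alpha>)"

lemma kappa: "\<kappa> \<in> cotangent_atlas A" "\<xi> \<in> fst \<kappa>"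
  using c by (auto simp: cotangent_chart_in)

lemma chart_inv_kappa: "p' \<in> fst c \<Longrightarrow> chart_inv \<kappa> (snd c p', covec A c p' \<beta>) = (p', \<beta>)"
  using atlas.chart_inv_chart[OF atlas_cotangent kappa(1), of "(p', \<beta>)"] by simp

lemma tangent_map_section:
  assumes U: "openin (mtop A) U" "p \<in> U" and s: "s \<in> one_forms A U" "s p = \<alpha>"
  shows "to_\<kappa> (tangent_map A (cotangent_atlas A) (\<lambda>q. (q, s q)) p v)
    = (to_coords A c p v, frechet_derivative (section_rep c s) (at (snd c p)) (to_coords A c p v))"
proof -
  have ds: "(section_rep c s has_derivative frechet_derivative (section_rep c s) (at (snd c p))) (at (snd c p))"
    by (rule smooth_on_has_derivative[OF smooth_section_rep[OF U(1) s(1) c(1)]]) (use U c in auto)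
  have "((\<lambda>x. snd \<kappa> (chart_inv c x, s (chart_inv c x))) has_derivative
      (\<lambda>h. (h, frechet_derivative (section_rep c s) (at (snd c p)) h))) (at (snd c p))"
    by (rule has_derivative_transform_within_open[OF has_derivative_Pair[OF has_derivative_ident ds] open_chart[OF c(1)]])
      (use c in auto)
  from to_coords_tangent_map[OF atlas_axioms atlas_cotangent c kappa(1) U _ this, of v]
  show ?thesis using s by simp
qed

lemma tangent_map_fst: "to_coords A c p (tangent_map (cotangent_atlas A) A fst \<xi> w) = fst (to_\<kappa> w)"
proof -
  interpret C: atlas "cotangent_atlas A" by (rule atlas_cotangent)
  have o: "open (snd c ` fst c \<times> (UNIV :: 'e set))" using open_chart[OF c(1)] by (simp add: open_Times)
  have fst_in: "fst q \<in> fst c" if "q \<in> fst \<kappa>" for q :: "'m \<times> ('e \<Rightarrow>\<^sub>L real)"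
    using that by auto
  have "((\<lambda>z. snd c (fst (chart_inv \<kappa> z))) has_derivative fst) (at (snd \<kappa> \<xi>))"
  proof (rule has_derivative_transform_within_open[OF has_derivative_fst[OF has_derivative_ident] o])
    show "snd \<kappa> \<xi> \<in> snd c ` fst c \<times> UNIV" using c by simp
    fix z :: "'e \<times> 'e" assume "z \<in> snd c ` fst c \<times> UNIV"
    then obtain q y where q: "q \<in> fst c" "z = (snd c q, y)" by auto
    show "fst z = snd c (fst (chart_inv \<kappa> z))"
      using chart_inv_kappa[OF q(1), of "covec_inv A c q y"] q c by simp
  qed
  from to_coords_tangent_map[OF atlas_cotangent atlas_axioms kappa c(1) C.openin_chart[OF kappa(1)] kappa(2) fst_in this, of w]
  show ?thesis by simp
qed

lemma linear_hor: "linear hor"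
  using connection_euc.linear_hor_part[OF connection_euc[OF c(1)], of "(snd c p, covec A c p \<alpha>)"] c by simp

text \<open>Being parallel at p along X forces the derivative of the section to be
  \<open>hor\<close>, as the pairing with all Y shows; conversely an explicit section realises every
  vector of this shape.\<close>

lemma horizontal_space_chart: "w \<in> horizontal_space A D \<xi> \<longleftrightarrow> (\<exists>v. to_\<kappa> w = (v, hor v))"
proof
  assume "w \<in> horizontal_space A D \<xi>"
  then obtain U s X where w: "w = tangent_map A (cotangent_atlas A) (\<lambda>q. (q, s q)) p (X p)"
    and U: "openin (mtop A) U" "p \<in> U" and s: "s \<in> one_forms A U" "s p = \<alpha>" and X: "X \<in> vector_fields A U"
    and par: "\<And>V Y. openin (mtop A) V \<Longrightarrow> p \<in> V \<Longrightarrow> V \<subseteq> U \<Longrightarrow> Y \<in> vector_fields A V \<Longrightarrow> dual_connection A D X s Y p = 0"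
    unfolding horizontal_space_def by auto
  let ?V = "U \<inter> fst c"
  have V: "openin (mtop A) ?V" "p \<in> ?V" "?V \<subseteq> U" using openin_Int[OF U(1) openin_chart[OF c(1)]] U c by auto
  have E: "coord_field A c u \<in> vector_fields A ?V" for u by (rule vector_fields_subset[OF coord_field_in[OF c(1)]]) auto
  have "frechet_derivative (section_rep c s) (at (snd c p)) (to_coords A c p (X p)) = hor (to_coords A c p (X p))"
  proof (rule inner_linear_eqI)
    fix u
    show "frechet_derivative (section_rep c s) (at (snd c p)) (to_coords A c p (X p)) \<bullet> u = hor (to_coords A c p (X p)) \<bullet> u"
      using dual_connection_chart[OF U(1) X s(1) V E[of u] c] par[OF V E[of u]] c s(2)
      by (simp add: coord_field_def inner_diff_left)
  qed
  then show "\<exists>v. to_\<kappa> w = (v, hor v)" using tangent_map_section[OF U s] w by auto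
next
  assume "\<exists>v. to_\<kappa> w = (v, hor v)"
  then obtain v where v: "to_\<kappa> w = (v, hor v)" by auto
  \<comment> \<open>Affine in the chart, with the value of \<alpha> and derivative
    \<open>hor\<close> at p, so that the covariant derivative at p vanishes in every
    direction.\<close>
  define g where "g = (\<lambda>x. covec A c p \<alpha> + hor (x - snd c p))"
  define s where "s = (\<lambda>q. covec_inv A c q (g (snd c q)))"
  note O = open_chart[OF c(1)] and U = openin_chart[OF c(1)]
  have blh: "bounded_linear hor" using linear_hor by (simp add: linear_conv_bounded_linear)
  have g: "smooth_on (snd c ` fst c) g"
    unfolding g_def by (intro smooth_on_add[OF O] smooth_on_const smooth_on_bounded_linear[OF O blh] smooth_on_diff[OF O] smooth_on_ident[OF O])
  have s: "s \<in> one_forms A (fst c)" unfolding s_def by (rule one_form_of_section[OF c(1) g])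
  have g0: "g (snd c p) = covec A c p \<alpha>" using linear_0[OF linear_hor] by (simp add: g_def)
  have sp: "s p = \<alpha>" using covec_inj[OF c, of "s p" \<alpha>] c g0 by (simp add: s_def)
  have dg: "(g has_derivative hor) (at (snd c p))"
    unfolding g_def by (rule derivative_eq_intros bounded_linear.has_derivative[OF blh] refl | simp)+
  have ds: "frechet_derivative (section_rep c s) (at (snd c p)) = hor"
    by (rule frechet_eq, rule has_derivative_transform_within_open[OF dg O]) (use c in \<open>auto simp: s_def\<close>)
  note X = coord_field_in[OF c(1), of v]
  have "dual_connection A D (coord_field A c v) s Y p = 0"
    if "openin (mtop A) V" "p \<in> V" "V \<subseteq> fst c" "Y \<in> vector_fields A V" for V Y
    using dual_connection_chart[OF U X s that c] by (simp add: ds sp)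
  moreover have "to_\<kappa> (tangent_map A (cotangent_atlas A) (\<lambda>q. (q, s q)) p (coord_field A c v p)) = to_\<kappa> w"
    unfolding tangent_map_section[OF U c(2) s sp] v ds using c by (simp add: coord_field_def)
  then have "w = tangent_map A (cotangent_atlas A) (\<lambda>q. (q, s q)) p (coord_field A c v p)"
    using atlas.to_coords_inj[OF atlas_cotangent kappa] by metis
  ultimately show "w \<in> horizontal_space A D \<xi>"
    unfolding horizontal_space_def using U c s sp X by fastforce
qed

text \<open>The two conditions in the definite description fix the coordinates of w: the projection
  gives the base part and horizontality the fibre part. As coordinates are bijective, exactly one
  such w exists.\<close>

lemma to_coords_horizontal_lift: "to_\<kappa> (horizontal_lift A D \<xi> v) = (to_coords A c p v, hor (to_coords A c p v))"
proof -
  let ?w = "from_coords (cotangent_atlas A) \<kappa> \<xi> (to_coords A c p v, hor (to_coords A c p v))"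
  note to_from = atlas.to_from[OF atlas_cotangent kappa] and inj = atlas.to_coords_inj[OF atlas_cotangent kappa]
  have char: "w \<in> horizontal_space A D \<xi> \<and> tangent_map (cotangent_atlas A) A fst \<xi> w = v
      \<longleftrightarrow> to_\<kappa> w = (to_coords A c p v, hor (to_coords A c p v))" for w
    using horizontal_space_chart[of w] tangent_map_fst[of w] to_coords_inj[OF c] by (metis fst_conv)
  have "horizontal_lift A D \<xi> v = ?w"
    unfolding horizontal_lift_def char
  proof (rule the_equality)
    show "to_\<kappa> ?w = (to_coords A c p v, hor (to_coords A c p v))" by (rule to_from)
    show "w = ?w" if "to_\<kappa> w = (to_coords A c p v, hor (to_coords A c p v))" for w
      using that inj to_from by metis
  qed
  then show ?thesis by (simp only: to_from)
qed

lemma to_coords_vertical_lift: "to_\<kappa> (vertical_lift A \<xi> \<beta>) = (0, covec A c p \<beta>)"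
proof -
  interpret C: atlas "cotangent_atlas A" by (rule atlas_cotangent)
  \<comment> \<open>The definition differentiates in this chart, which may come from a base chart
    other than \<open>c\<close>. In the coordinates of \<open>c\<close> the curve is a straight
    line, carried over by the transition.\<close>
  define \<kappa>0 where "\<kappa>0 = chart_at (cotangent_atlas A) \<xi>"
  have k0: "\<kappa>0 \<in> cotangent_atlas A" "\<xi> \<in> fst \<kappa>0"
    using C.chart_at[OF C.in_carrier[OF kappa]] by (simp_all add: \<kappa>0_def)
  have eq: "snd \<kappa>0 (p, \<alpha> + t *\<^sub>R \<beta>) = transition \<kappa> \<kappa>0 (snd c p, covec A c p \<alpha> + t *\<^sub>R covec A c p \<beta>)" for t
    using C.transition_chart[OF kappa(1), of "(p, \<alpha> + t *\<^sub>R \<beta>)" \<kappa>0] c by (simp add: covec_add_scale)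
  have d: "(transition \<kappa> \<kappa>0 has_derivative tmap \<kappa> \<kappa>0 \<xi>) (at (snd c p, covec A c p \<alpha> + 0 *\<^sub>R covec A c p \<beta>))"
    using C.transition_deriv[OF kappa(1) k0(1) kappa(2) k0(2)] by simp
  have "((\<lambda>t. (snd c p, covec A c p \<alpha> + t *\<^sub>R covec A c p \<beta>)) has_derivative (\<lambda>t. (0, t *\<^sub>R covec A c p \<beta>))) (at 0)"
    by (auto intro!: derivative_eq_intros)
  from has_derivative_compose[OF this d]
  have "((\<lambda>t. snd \<kappa>0 (p, \<alpha> + t *\<^sub>R \<beta>)) has_derivative (\<lambda>t. tmap \<kappa> \<kappa>0 \<xi> (0, t *\<^sub>R covec A c p \<beta>))) (at 0)"
    by (simp add: eq)
  moreover have "tmap \<kappa> \<kappa>0 \<xi> (0, t *\<^sub>R covec A c p \<beta>) = t *\<^sub>R tmap \<kappa> \<kappa>0 \<xi> (0, covec A c p \<beta>)" for t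
    using linear_cmul[OF C.tmap_linear[OF kappa(1) k0(1) kappa(2) k0(2)], of t "(0, covec A c p \<beta>)"] by simp
  ultimately have "vertical_lift A \<xi> \<beta> = tmap \<kappa> \<kappa>0 \<xi> (0, covec A c p \<beta>)"
    by (simp add: vertical_lift_def \<kappa>0_def vector_derivative_at has_vector_derivative_def)
  then show ?thesis
    using C.to_from[OF kappa] by (simp add: C.from_coords_tmap \<kappa>0_def)
qed

lemma to_coords_splitting:
  "to_\<kappa> (cotangent_splitting A D \<xi> (v, \<beta>)) = (to_coords A c p v, hor (to_coords A c p v) + covec A c p \<beta>)"
  using linear_add[OF atlas.linear_to_coords[OF atlas_cotangent kappa]]
  by (simp add: cotangent_splitting_def to_coords_horizontal_lift to_coords_vertical_lift)

text \<open>The splitting is block triangular in coordinates, so its inverse subtracts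
  \<open>hor\<close> of the base part from the fibre part.\<close>

lemma inv_splitting:
  "inv (cotangent_splitting A D \<xi>) w
    = (from_coords A c p (fst (to_\<kappa> w)), covec_inv A c p (snd (to_\<kappa> w) - hor (fst (to_\<kappa> w))))" (is "_ = ?q")
proof -
  note inj_to = atlas.to_coords_inj[OF atlas_cotangent kappa]
  have "inj (cotangent_splitting A D \<xi>)"
  proof (rule injI)
    fix q q' assume eq: "cotangent_splitting A D \<xi> q = cotangent_splitting A D \<xi> q'"
    have "(to_coords A c p (fst q), hor (to_coords A c p (fst q)) + covec A c p (snd q))
      = (to_coords A c p (fst q'), hor (to_coords A c p (fst q')) + covec A c p (snd q'))"
      by (metis eq prod.collapse to_coords_splitting)
    then have "to_coords A c p (fst q) = to_coords A c p (fst q')" "covec A c p (snd q) = covec A c p (snd q')"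
      by auto
    then show "q = q'"
      using to_coords_inj[OF c] covec_inj[OF c] by (simp add: prod_eq_iff)
  qed
  moreover have "cotangent_splitting A D \<xi> ?q = w"
    by (rule inj_to[THEN iffD1]) (simp add: to_coords_splitting c)
  ultimately show ?thesis by (metis inv_f_f)
qed

lemma to_coords_cotangent_structure:
  assumes J: "linear (J p)"
  shows "to_\<kappa> (cotangent_structure A D (gen_structure \<sigma> J) \<xi> w)
    = lifted_endo (local_endo A c J) (christoffel A D c) \<sigma> (snd c p, covec A c p \<alpha>) (to_\<kappa> w)"
proof -
  let ?v = "fst (to_\<kappa> w)" and ?b = "snd (to_\<kappa> w) - hor (fst (to_\<kappa> w))"
  have lin: "linear (\<lambda>u. blinfun_apply (covec_inv A c p y) (J p u))" for y
    using linear_compose[OF J bounded_linear.linear[OF blinfun.bounded_linear_right]] by (simp add: o_def)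
  have "linear (local_endo A c J (snd c p))"
    using linear_compose[OF linear_compose[OF linear_from_coords[OF c] J] linear_to_coords[OF c]]
    by (simp add: o_def flip: local_endo_chart[OF c])
  then have lin2: "linear (\<lambda>u. y \<bullet> local_endo A c J (snd c p) u)" for y
    by (auto intro!: linearI simp: linear_add linear_cmul inner_add_right)
  \<comment> \<open>In coordinates J^* is the transpose of the matrix of J, which matches the
    vertical block of \<open>lifted_endo\<close>.\<close>
  have "covec A c p (Blinfun (\<lambda>u. blinfun_apply (covec_inv A c p ?b) (J p u))) = riesz (\<lambda>u. ?b \<bullet> local_endo A c J (snd c p) u)"
    by (rule inner_linear_eqI)
      (simp only: covec_inner[OF c] blinfun_apply_Blinfun_linear[OF lin] riesz_inner[OF lin2],
       simp only: blinfun_apply_covec_inv[OF c] local_endo_chart[OF c])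
  then show ?thesis
    using c by (simp add: cotangent_structure_def inv_splitting gen_structure_def to_coords_splitting lifted_endo_def
      covec_scale local_endo_chart)
qed

end

end

section \<open>Assembly of the chartwise equivalence on the manifold\<close>

section \<open>Integrability of the lifted structure\<close>

context almost_complex_connection
begin

context
  fixes \<sigma> :: real assumes sigma: "\<sigma> * \<sigma> = 1"
begin

abbreviation (input) "\<J> \<equiv> cotangent_structure A D (gen_structure \<sigma> J)"

lemma complex_connection_euc:
  assumes c: "c \<in> A"
  shows "complex_connection_euc (snd c ` fst c) (christoffel A D c) (local_endo A c J) \<sigma>"
  by (intro complex_connection_euc.intro connection_euc[OF c] complex_connection_euc_axioms.intro)
    (use linear_local_endo[OF c] local_endo_sq[OF c] smooth_local_endo[OF c] sigma in auto)

lemma local_endo_cotangent_structure: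
  assumes c: "c \<in> A" and z: "z \<in> snd c ` fst c \<times> UNIV"
  shows "local_endo (cotangent_atlas A) (cotangent_chart A c) \<J> z w
    = lifted_endo (local_endo A c J) (christoffel A D c) \<sigma> z w"
proof -
  obtain p y where p: "p \<in> fst c" "z = (snd c p, y)" using z by auto
  define \<alpha> where "\<alpha> = covec_inv A c p y"
  have z: "z = snd (cotangent_chart A c) (p, \<alpha>)" using p c by (simp add: \<alpha>_def)
  show ?thesis
    using to_coords_cotangent_structure[where \<sigma>=\<sigma> and J=J, OF c p(1) linear_J[OF in_carrier[OF c p(1)]], of \<alpha>]
      atlas.local_endo_chart[OF atlas_cotangent kappa(1)[OF c p(1)] kappa(2)[OF c p(1), of \<alpha>], of \<J> w]
      atlas.to_from[OF atlas_cotangent kappa(1)[OF c p(1)] kappa(2)[OF c p(1), of \<alpha>]]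
    by (simp add: z)
qed

lemma cotangent_structure_almost_complex: "almost_complex_structure (cotangent_atlas A) \<J>"
proof -
  interpret C: atlas "cotangent_atlas A" by (rule atlas_cotangent)
  have im: "snd (cotangent_chart A c) ` fst (cotangent_chart A c) = snd c ` fst c \<times> UNIV" if "c \<in> A" for c
    using cotangent_chart_image[OF that] by simp
  have chart: "\<exists>c p \<alpha>. c \<in> A \<and> p \<in> fst c \<and> \<xi> = (p, \<alpha>)" if "\<xi> \<in> carrier_of (cotangent_atlas A)" for \<xi>
    using that by (force simp: carrier_of_def cotangent_atlas_def)
  show ?thesis
  proof (rule C.almost_complex_structureI)
    fix \<xi> assume "\<xi> \<in> carrier_of (cotangent_atlas A)"
    then obtain c p \<alpha> where c: "c \<in> A" "p \<in> fst c" and xi: "\<xi> = (p, \<alpha>)" using chart by blast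
    interpret E: complex_connection_euc "snd c ` fst c" "christoffel A D c" "local_endo A c J" \<sigma>
      by (rule complex_connection_euc[OF c(1)])
    note k = kappa(1)[OF c] kappa(2)[OF c, of \<alpha>]
    let ?z = "(snd c p, covec A c p \<alpha>)"
    have z: "?z \<in> snd c ` fst c \<times> UNIV" using c by simp
    note to = to_coords_cotangent_structure[where \<sigma>=\<sigma> and J=J and \<alpha>=\<alpha>, OF c linear_J[OF in_carrier[OF c]]]
    note l = C.linear_to_coords[OF k] and inj = C.to_coords_inj[OF k]
    \<comment> \<open>\<open>to_coords\<close> is injective and turns the structure into
      \<open>lifted_endo\<close>, so linearity and the square are inherited.\<close>
    show "linear (\<J> \<xi>)"
      unfolding xi by (rule linearI; subst inj[symmetric])
        (simp_all only: to linear_add[OF l] linear_cmul[OF l] linear_add[OF E.linear_K[OF z]] linear_cmul[OF E.linear_K[OF z]])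
    show "\<J> \<xi> (\<J> \<xi> w) = - w" for w
      unfolding xi by (subst inj[symmetric]) (simp only: to linear_neg[OF l] E.K_K[OF z])
  next
    fix \<kappa> w assume "\<kappa> \<in> cotangent_atlas A"
    then obtain c where c: "c \<in> A" and k: "\<kappa> = cotangent_chart A c" by (auto simp: cotangent_atlas_def)
    interpret E: complex_connection_euc "snd c ` fst c" "christoffel A D c" "local_endo A c J" \<sigma>
      by (rule complex_connection_euc[OF c(1)])
    show "smooth_on (snd \<kappa> ` fst \<kappa>) (\<lambda>z. local_endo (cotangent_atlas A) \<kappa> \<J> z w)"
      unfolding k im[OF c]
      by (rule smooth_on_cong[OF E.open_T, THEN iffD1, OF _ E.smooth_K]) (simp add: local_endo_cotangent_structure[OF c])
  qed
qed

text \<open>The cotangent atlas consists of the lifted charts, whose images are base times full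
  fibre, so the Euclidean equivalence applies chart by chart.\<close>

lemma integrable_cotangent_structure_iff:
  "integrable_structure (cotangent_atlas A) \<J> \<longleftrightarrow> integrable_structure A J \<and> nabla_cond \<sigma> \<and> curv_cond \<sigma>"
proof -
  interpret C: almost_complex "cotangent_atlas A" \<J>
    by (intro almost_complex.intro atlas_cotangent almost_complex_axioms.intro cotangent_structure_almost_complex)
  have all: "(\<forall>\<kappa>\<in>cotangent_atlas A. P \<kappa>) \<longleftrightarrow> (\<forall>c\<in>A. P (cotangent_chart A c))" for P
    by (simp add: cotangent_atlas_def)
  have "integrable_structure (cotangent_atlas A) \<J> \<longleftrightarrow> (\<forall>c\<in>A. \<forall>z\<in>snd c ` fst c \<times> UNIV. \<forall>u v.
      nijenhuis_euc (local_endo (cotangent_atlas A) (cotangent_chart A c) \<J>) z u v = 0)"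
    unfolding C.integrable_iff_nijenhuis_euc all by (simp add: cotangent_chart_image[OF _ subset_refl])
  also have "\<dots> \<longleftrightarrow> (\<forall>c\<in>A. \<forall>z\<in>snd c ` fst c \<times> UNIV. \<forall>u v.
      nijenhuis_euc (lifted_endo (local_endo A c J) (christoffel A D c) \<sigma>) z u v = 0)"
  proof (intro ball_cong refl)
    fix c and z :: "'e \<times> 'e" assume c: "c \<in> A" and z: "z \<in> snd c ` fst c \<times> UNIV"
    \<comment> \<open>The tensor differentiates the structure, so its identification with
      \<open>lifted_endo\<close> is needed on an open set around z.\<close>
    have o: "open (snd c ` fst c \<times> (UNIV :: 'e set))" using open_chart[OF c] by (simp add: open_Times)
    show "(\<forall>u v. nijenhuis_euc (local_endo (cotangent_atlas A) (cotangent_chart A c) \<J>) z u v = 0)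
      \<longleftrightarrow> (\<forall>u v. nijenhuis_euc (lifted_endo (local_endo A c J) (christoffel A D c) \<sigma>) z u v = 0)"
      using nijenhuis_euc_cong[OF o z local_endo_cotangent_structure[OF c]] by simp
  qed
  also have "\<dots> \<longleftrightarrow> (\<forall>c\<in>A. \<forall>x\<in>snd c ` fst c.
     let K = local_endo A c J; R = curvature_euc (christoffel A D c) x; N = nabla_endo_euc K (christoffel A D c) x in
       (\<forall>u v. nijenhuis_euc K x u v = 0) \<and> (\<forall>u v. N u v = \<sigma> *\<^sub>R K x (N (K x u) v)) \<and>
       (\<forall>u v w. R u v w - R (K x u) (K x v) w + \<sigma> *\<^sub>R (R (K x u) v (K x w) + R u (K x v) (K x w)) = 0))"
    unfolding Let_def
    by (intro ball_cong refl complex_connection_euc.nijenhuis_lifted_endo_iff[OF complex_connection_euc])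
  also have "\<dots> \<longleftrightarrow> integrable_structure A J \<and> nabla_cond \<sigma> \<and> curv_cond \<sigma>"
    unfolding integrable_iff_nijenhuis_euc nabla_cond_iff curv_cond_iff Let_def ball_conj_distrib ..
  finally show ?thesis .
qed

end

end

theorem proposition33:
  fixes A :: "('m, 'e::euclidean_space) chart set"
    and J :: "'m \<Rightarrow> 'e \<Rightarrow> 'e"
    and D :: "('m \<Rightarrow> 'e) \<Rightarrow> ('m \<Rightarrow> 'e) \<Rightarrow> 'm \<Rightarrow> 'e"
    and \<sigma> :: real
  assumes "smooth_manifold A"
    and "almost_complex_structure A J"
    and "linear_connection A D"
    and "\<sigma> = 1 \<or> \<sigma> = -1"
  shows "integrable_structure (cotangent_atlas A) (cotangent_structure A D (gen_structure \<sigma> J)) \<longleftrightarrow>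
    integrable_structure A J \<and>
    (\<forall>U X Y p. openin (mtop A) U \<and> X \<in> vector_fields A U \<and> Y \<in> vector_fields A U \<and> p \<in> U \<longrightarrow>
       cov_deriv_endo D J X Y p = \<sigma> *\<^sub>R J p (cov_deriv_endo D J (endo_app J X) Y p)) \<and>
    (\<forall>U X Y Z p. openin (mtop A) U \<and> X \<in> vector_fields A U \<and> Y \<in> vector_fields A U \<and>
         Z \<in> vector_fields A U \<and> p \<in> U \<longrightarrow>
       (curvature A D X Y Z p - curvature A D (endo_app J X) (endo_app J Y) Z p)
       + \<sigma> *\<^sub>R (curvature A D (endo_app J X) Y (endo_app J Z) p
               + curvature A D X (endo_app J Y) (endo_app J Z) p) = 0)"
proof -
  interpret almost_complex_connection A J D
    using assms by unfold_locales (auto simp: smooth_manifold_def)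
  have "\<sigma> * \<sigma> = 1" using assms(4) by auto
  from integrable_cotangent_structure_iff[OF this] show ?thesis
    unfolding nabla_cond_def curv_cond_def .
qed

end
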